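(* There is a universal constant $C$ such that for every graph $G=(V,E)$ with $n=|V|$: (i) if $G$ has genus $g$, then $\alpha(G)\leq C\,n^{-3/2}(g+1)^{3/2}$, and $G$ has a $(\frac13,\frac23)$-balanced vertex separator of size at most $C(g+1)^{3/2}\sqrt n$; (ii) if $G$ is $K_h$-minor-free for an integer $h\ge 2$, then $\alpha(G)\leq C\,n^{-3/2}h^3\sqrt{\log h}$, and $G$ has a $(\frac13,\frac23)$-balanced vertex separator of size at most $C\,h^3\sqrt{\log h}\sqrt n$.
   Context: A vertex separator of $G$ is a partition $V=A\cup B\cup S$ with no edge of $G$ between $A$ and $B$. Define $\alpha(A,B,S)=\frac{|S|}{|A\cup S|\cdot|B\cup S|}$ and $\alpha(G)=\min\alpha(A,B,S)$ over all vertex separators. A $(\frac13,\frac23)$-balanced vertex separator is a vertex set $S$ whose removal leaves a partition $V\setminus S=A\cup B$ with no edges between $A$ and $B$ and $|A|,|B|\leq\frac23 n$; its size is $|S|$. Genus $g$ means embeddable without crossings in a closed orientable surface of genus $g$; $K_h$-minor-free means $K_h$ is not a minor of $G$. *)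

theory Defs
  imports "HOL-Homology.Homology"
begin

section \<open>Finite simple graphs\<close>

definition finite_simple_graph :: "'a set \<Rightarrow> 'a set set \<Rightarrow> bool" where
  "finite_simple_graph V E \<longleftrightarrow>
     finite V \<and> V \<noteq> {} \<and> (\<forall>e\<in>E. \<exists>u\<in>V. \<exists>v\<in>V. u \<noteq> v \<and> e = {u, v})"

definition no_edges_between :: "'a set set \<Rightarrow> 'a set \<Rightarrow> 'a set \<Rightarrow> bool" where
  "no_edges_between E A B \<longleftrightarrow> (\<forall>a\<in>A. \<forall>b\<in>B. {a, b} \<notin> E)"


section \<open>Vertex separators\<close>

text \<open>The parts may be empty: a complete graph has no separator with both \<open>A\<close> and \<open>B\<close> nonempty.\<close>

definition vertex_separator ::
  "'a set \<Rightarrow> 'a set set \<Rightarrow> 'a set \<Rightarrow> 'a set \<Rightarrow> 'a set \<Rightarrow> bool" where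
  "vertex_separator V E A B S \<longleftrightarrow>
     A \<union> B \<union> S = V \<and> A \<inter> B = {} \<and> A \<inter> S = {} \<and> B \<inter> S = {} \<and> no_edges_between E A B"

definition separator_ratio :: "'a set \<Rightarrow> 'a set \<Rightarrow> 'a set \<Rightarrow> real" where
  "separator_ratio A B S = real (card S) / (real (card (A \<union> S)) * real (card (B \<union> S)))"

text \<open>
  The two nonemptiness conditions say that the denominator of the ratio is nonzero. Without them the
  partition with \<open>A = S = {}\<close> and \<open>B = V\<close> would contribute \<open>0 / 0 = 0\<close> for every graph.
  The remaining degenerate separators, those with \<open>A\<close> or \<open>B\<close> empty and \<open>S \<noteq> {}\<close>, have
  ratio \<open>1 / card V\<close>. Since \<open>card (A \<union> S) * card (B \<union> S) = card A * card B + card S * card V\<close>,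
  every separator has ratio at most \<open>1 / card V\<close>, so these do not lower the minimum of a
  graph that has a separator with \<open>A\<close> and \<open>B\<close> nonempty.
\<close>

definition alpha :: "'a set \<Rightarrow> 'a set set \<Rightarrow> real" where
  "alpha V E = Min {separator_ratio A B S | A B S.
     vertex_separator V E A B S \<and> A \<union> S \<noteq> {} \<and> B \<union> S \<noteq> {}}"

lemma alpha_set_finite_nonempty:
  assumes "finite V" "V \<noteq> {}"
  shows "finite {separator_ratio A B S | A B S.
           vertex_separator V E A B S \<and> A \<union> S \<noteq> {} \<and> B \<union> S \<noteq> {}}" (is "finite ?R")
    and "{separator_ratio A B S | A B S.
           vertex_separator V E A B S \<and> A \<union> S \<noteq> {} \<and> B \<union> S \<noteq> {}} \<noteq> {}"
proof -
  have "?R \<subseteq> (\<lambda>(A, B, S). separator_ratio A B S) ` (Pow V \<times> Pow V \<times> Pow V)"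
  proof
    fix r
    assume "r \<in> ?R"
    then obtain A B S where r: "r = separator_ratio A B S" and "vertex_separator V E A B S"
      by blast
    then have "(A, B, S) \<in> Pow V \<times> Pow V \<times> Pow V"
      unfolding vertex_separator_def by blast
    with r show "r \<in> (\<lambda>(A, B, S). separator_ratio A B S) ` (Pow V \<times> Pow V \<times> Pow V)"
      by (intro image_eqI[where x = "(A, B, S)"]) simp_all
  qed
  moreover have "finite (Pow V \<times> Pow V \<times> Pow V)"
    using assms by simp
  ultimately show "finite ?R"
    by (meson finite_imageI finite_subset)
  have "vertex_separator V E {} {} V"
    by (simp add: vertex_separator_def no_edges_between_def)
  moreover have "{} \<union> V \<noteq> {}"
    using assms by simp
  ultimately show "?R \<noteq> {}"
    by blast
qed

definition balanced_vertex_separator :: "'a set \<Rightarrow> 'a set set \<Rightarrow> 'a set \<Rightarrow> bool" where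
  "balanced_vertex_separator V E S \<longleftrightarrow>
     S \<subseteq> V \<and>
     (\<exists>A B. A \<union> B = V - S \<and> A \<inter> B = {} \<and> no_edges_between E A B \<and>
        real (card A) \<le> 2 / 3 * real (card V) \<and> real (card B) \<le> 2 / 3 * real (card V))"


section \<open>Minors\<close>

definition connected_in :: "'a set set \<Rightarrow> 'a set \<Rightarrow> bool" where
  "connected_in E U \<longleftrightarrow>
     U \<noteq> {} \<and> (\<forall>u\<in>U. \<forall>v\<in>U. (u, v) \<in> {(x, y). x \<in> U \<and> y \<in> U \<and> {x, y} \<in> E}\<^sup>*)"

text \<open>\<open>W x\<close> is the branch set of the vertex \<open>x\<close>, the set of vertices contracted to \<open>x\<close>.\<close>

definition is_minor :: "'b set \<Rightarrow> 'b set set \<Rightarrow> 'a set \<Rightarrow> 'a set set \<Rightarrow> bool" where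
  "is_minor VH EH V E \<longleftrightarrow>
     (\<exists>W :: 'b \<Rightarrow> 'a set.
        (\<forall>x\<in>VH. W x \<subseteq> V \<and> connected_in E (W x)) \<and>
        (\<forall>x\<in>VH. \<forall>y\<in>VH. x \<noteq> y \<longrightarrow> W x \<inter> W y = {}) \<and>
        (\<forall>x\<in>VH. \<forall>y\<in>VH. {x, y} \<in> EH \<longrightarrow> (\<exists>u\<in>W x. \<exists>v\<in>W y. {u, v} \<in> E)))"

definition complete_edges :: "'a set \<Rightarrow> 'a set set" where
  "complete_edges V = {{u, v} | u v. u \<in> V \<and> v \<in> V \<and> u \<noteq> v}"

definition complete_minor_free :: "nat \<Rightarrow> 'a set \<Rightarrow> 'a set set \<Rightarrow> bool" where
  "complete_minor_free h V E \<longleftrightarrow> \<not> is_minor {..<h} (complete_edges {..<h}) V E"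


section \<open>Closed orientable surfaces and graph embeddings\<close>

definition closed_surface :: "'s topology \<Rightarrow> bool" where
  "closed_surface X \<longleftrightarrow>
     topspace X \<noteq> {} \<and> compact_space X \<and> connected_space X \<and> Hausdorff_space X \<and>
     (\<forall>x\<in>topspace X. \<exists>U. openin X U \<and> x \<in> U \<and>
        subtopology X U homeomorphic_space Euclidean_space 2)"

text \<open>
  An orientation assigns to each point \<open>x\<close> a generator \<open>\<mu> x\<close> of the infinite cyclic group
  \<open>H\<^sub>2(X, X - {x})\<close>. The assignment is locally consistent: near every point, the \<open>\<mu> y\<close> are the
  images of a single class of \<open>H\<^sub>2(X, X - B)\<close>.
\<close>

definition orientable_surface :: "'s topology \<Rightarrow> bool" where
  "orientable_surface X \<longleftrightarrow>
     (\<exists>\<mu>.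
        (\<forall>x\<in>topspace X.
           \<mu> x \<in> carrier (relative_homology_group 2 X (topspace X - {x})) \<and>
           subgroup_generated (relative_homology_group 2 X (topspace X - {x})) {\<mu> x}
             = relative_homology_group 2 X (topspace X - {x})) \<and>
        (\<forall>x\<in>topspace X. \<exists>B. openin X B \<and> x \<in> B \<and>
           (\<exists>\<nu>\<in>carrier (relative_homology_group 2 X (topspace X - B)).
              \<forall>y\<in>B. hom_induced 2 X (topspace X - B) X (topspace X - {y}) id \<nu> = \<mu> y)))"

text \<open>The genus of a closed orientable surface is half the rank of its first homology group.\<close>

definition closed_orientable_surface_of_genus :: "nat \<Rightarrow> 's topology \<Rightarrow> bool" where
  "closed_orientable_surface_of_genus g X \<longleftrightarrow>
     closed_surface X \<and> orientable_surface X \<and>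
     homology_group 1 X \<cong> free_Abelian_group {..<2 * g}"

text \<open>
  Vertices are drawn as distinct points and edges as simple arcs that meet each other and the
  vertices only in common endpoints.
\<close>

definition graph_embedding ::
  "'a set \<Rightarrow> 'a set set \<Rightarrow> 's topology \<Rightarrow> ('a \<Rightarrow> 's) \<Rightarrow> ('a set \<Rightarrow> real \<Rightarrow> 's) \<Rightarrow> bool" where
  "graph_embedding V E X f \<gamma> \<longleftrightarrow>
     inj_on f V \<and> f ` V \<subseteq> topspace X \<and>
     (\<forall>e\<in>E. pathin X (\<gamma> e) \<and> inj_on (\<gamma> e) {0..1} \<and>
        {\<gamma> e 0, \<gamma> e 1} = f ` e \<and> \<gamma> e ` {0<..<1} \<inter> f ` V = {}) \<and>
     (\<forall>e\<in>E. \<forall>e'\<in>E. e \<noteq> e' \<longrightarrow> \<gamma> e ` {0<..<1} \<inter> \<gamma> e' ` {0<..<1} = {})"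

text \<open>
  The type \<open>real\<close> only supplies the points of the surface; the topology \<open>X\<close> is arbitrary. A closed
  surface has the cardinality of the continuum, so every closed surface is homeomorphic to such an
  \<open>X\<close>.
\<close>

definition has_genus :: "nat \<Rightarrow> 'a set \<Rightarrow> 'a set set \<Rightarrow> bool" where
  "has_genus g V E \<longleftrightarrow>
     (\<exists>(X :: real topology) f \<gamma>.
        closed_orientable_surface_of_genus g X \<and> graph_embedding V E X f \<gamma>)"

end

theory Submission
  imports Defs
begin

text \<open>
  Both parts follow from the fact that a graph without a \<open>K\<^sub>h\<close>-minor has a balanced separator of size
  \<open>O(h\<^sup>2 \<surd>n)\<close>. If there is no such separator, every set of this size leaves a component with more
  than \<open>2n/3\<close> vertices, and following Alon, Seymour and Thomas one grows branch sets of a complete minor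
  around a shrinking large component \<open>B\<close>: either a small connected set in \<open>B\<close> meets the neighbourhoods
  of all branch sets and becomes a new one, or a small set \<open>Z \<subseteq> B\<close> cuts the large component off from one
  of them, which then absorbs part of \<open>B\<close>.

  A graph of genus \<open>g\<close> has no \<open>K\<^sub>h\<close>-minor once \<open>h\<close> exceeds a multiple of \<open>\<surd>(g + 1)\<close>. This is the Euler
  bound, obtained directly from \<open>H\<^sub>1(X, X - K)\<close> and \<open>H\<^sub>2(X, X - K)\<close> for the drawings \<open>K\<close> of subgraphs,
  by adding one edge at a time. By the Mayer-Vietoris sequence and orientability, an edge that joins two
  components of the graph separates nothing, an edge has at most two sides, and all but at most \<open>2g\<close> of
  the edges that close a cycle separate two points. Consider spanning trees of the branch sets with one
  edge for each pair of branch sets: there are at least \<open>h(h-1)/2 - h + 2 - 2g\<close> faces, each is incident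
  with at least three of the \<open>h(h-1)/2\<close> connecting edges, and each connecting edge with at most two faces.
\<close>

section \<open>Relative Mayer-Vietoris arguments for singular chains\<close>

text \<open>Arcs in a surface may be wild and faces need not be discs, so there is no cell structure
  to count with. Duality for a closed set \<open>K\<close> takes its place: a class of H_2(X, X - K)
  plays the part of a locally constant integer function on \<open>K\<close>, with values read off
  against local generators, and H_1(X, X - K) plays that of H^1(K); it vanishes when
  \<open>K\<close> is a point or an arc. Two points off \<open>K\<close> are joined off
  \<open>K\<close> once a 1-chain between them is zero in H_1(X, X - K). When an arc is attached to
  \<open>K\<close> at its two ends, the obstruction is a class of H_2 at these two points, a pair of
  integers of which only the difference matters; all statements about edges and faces rest on this
  one integer. The order h^2 sqrt n comes from guarding at most \<open>h\<close> branch sets by at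
  most \<open>h * d\<close> vertices each, with \<open>d\<close> close to sqrt n. It suffices: h^2
  is of order g + 1 in the first part and at most h^3 sqrt(ln h) in the second. The bound on alpha
  is read off from the balanced separator, since each side together with \<open>S\<close> has at
  least n/3 vertices.\<close>

lemma diff_eq_diff_of_sums:
  "(c::'b::ab_group_add) = a + s \<Longrightarrow> c = b + t \<Longrightarrow> a - b = t - s"
  by (metis add_diff_cancel_left add_diff_cancel_right)

text \<open>Iterated subdivision makes every simplex small enough to lie in \<open>U\<close> or in
  \<open>V\<close>. The chain homotopy \<open>h\<close> undoes the subdivision up to a term in the
  boundary of \<open>s\<close>; as \<open>h\<close> preserves the subspace that carries a chain,
  that term splits because the boundary was split beforehand.\<close>

lemma singular_chain_split:
  assumes U: "openin X U" and V: "openin X V" and "1 \<le> p"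
    and s: "singular_chain p (subtopology X (U \<union> V)) s"
    and bd: "chain_boundary p s = a + b"
    and a: "singular_chain (p - 1) (subtopology X U) a"
    and b: "singular_chain (p - 1) (subtopology X V) b"
  obtains e u v where "singular_chain (Suc p) (subtopology X (U \<union> V)) e"
    "singular_chain p (subtopology X U) u" "singular_chain p (subtopology X V) v"
    "s = chain_boundary (Suc p) e + u + v"
proof -
  let ?Y = "subtopology X (U \<union> V)"
  have oU: "openin ?Y U" "openin ?Y V"
    using U V by (auto simp: openin_subtopology_alt image_iff intro: exI[of _ U] exI[of _ V])
  obtain n where n: "\<And>m f. \<lbrakk>n \<le> m; f \<in> Poly_Mapping.keys ((singular_subdivision p ^^ m) s)\<rbrakk>
                             \<Longrightarrow> \<exists>W \<in> {U, V}. f \<in> standard_simplex p \<rightarrow> W"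
    by (rule sufficient_iterated_singular_subdivision_exists[of "{U,V}" ?Y p s]) (use oU s in auto)
  let ?s' = "(singular_subdivision p ^^ n) s"
  have "singular_chain p ?Y ((singular_subdivision p ^^ m) s)" for m
    by (induction m) (auto simp: s singular_chain_singular_subdivision)
  then have "Poly_Mapping.keys ?s' \<subseteq> singular_simplex_set p (subtopology X U) \<union> singular_simplex_set p (subtopology X V)"
    using n[OF order_refl] by (fastforce simp: singular_chain_def singular_simplex_subtopology image_subset_iff)
  then obtain d1 d2 where d: "singular_chain p (subtopology X U) d1" "singular_chain p (subtopology X V) d2" "?s' = d1 + d2"
    unfolding singular_chain_def using frag_split by metis
  obtain h where h: "\<And>p. h p 0 = (0 :: 'a chain)"
        "\<And>p c1 c2. h p (c1-c2) = h p c1 - h p c2"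
        "\<And>p X c. singular_chain p X c \<Longrightarrow> singular_chain (Suc p) X (h p c)"
        "\<And>p X c. singular_chain p X c
                 \<Longrightarrow> chain_boundary (Suc p) (h p c) + h (p - Suc 0) (chain_boundary p c)
                   = (singular_subdivision p ^^ n) c - c"
    by (rule chain_homotopic_iterated_singular_subdivision) blast
  have hadd: "h q (x + y) = h q x + h q y" for q x y
    using h(2)[of q x "0 - y"] h(2)[of q 0 y] h(1) by simp
  have eq: "chain_boundary (Suc p) (h p s) + (h (p - 1) a + h (p - 1) b) = ?s' - s"
    using h(4)[OF s] bd hadd by simp
  show thesis
  proof
    show "singular_chain (Suc p) ?Y (- h p s)"
      by (simp add: h(3) s singular_chain_minus)
    show "singular_chain p (subtopology X U) (d1 - h (p-1) a)"
      using d(1) h(3)[OF a] \<open>1 \<le> p\<close> by (simp add: singular_chain_diff)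
    show "singular_chain p (subtopology X V) (d2 - h (p-1) b)"
      using d(2) h(3)[OF b] \<open>1 \<le> p\<close> by (simp add: singular_chain_diff)
    show "s = chain_boundary (Suc p) (- h p s) + (d1 - h (p - 1) a) + (d2 - h (p - 1) b)"
      using eq d(3) by (simp add: chain_boundary_minus algebra_simps)
  qed
qed

lemma singular_chain_Int:
  "singular_chain p (subtopology X U) c \<Longrightarrow> singular_chain p (subtopology X V) c
    \<Longrightarrow> singular_chain p (subtopology X (U \<inter> V)) c"
  by (auto simp: singular_chain_subtopology)

lemma singular_relcycle_mono:
  "singular_relcycle p X S c \<Longrightarrow> S \<subseteq> T \<Longrightarrow> singular_relcycle p X T c"
  unfolding singular_relcycle using singular_chain_mono by blast

lemma singular_relboundary_mono:
  "singular_relboundary p X S c \<Longrightarrow> S \<subseteq> T \<Longrightarrow> singular_relboundary p X T c"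
  unfolding singular_relboundary using singular_chain_mono by blast

text \<open>Exactness of Mayer-Vietoris at the middle term. The chain \<open>s\<close> that measures
  the disagreement splits into \<open>u\<close> in \<open>U\<close> and \<open>v\<close> in
  \<open>V\<close>, and \<open>\<beta> - u\<close> is at the same time \<open>\<gamma>\<close>
  corrected in \<open>V\<close> by \<open>v\<close>, up to a boundary. For the complements
  \<open>K\<close> and \<open>L\<close>: classes that agree on the intersection come from the
  union.\<close>

lemma singular_relcycle_glue:
  assumes U: "openin X U" and V: "openin X V" and "1 \<le> p"
    and \<beta>: "singular_relcycle p X U \<beta>" and \<gamma>: "singular_relcycle p X V \<gamma>"
    and eq: "homologous_rel p X (U \<union> V) \<beta> \<gamma>"
  obtains z where "singular_relcycle p X (U \<inter> V) z"
    "homologous_rel p X U z \<beta>" "homologous_rel p X V z \<gamma>"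
proof -
  obtain d s where d: "singular_chain (Suc p) X d" and s: "singular_chain p (subtopology X (U \<union> V)) s"
    and ds: "chain_boundary (Suc p) d + s = \<beta> - \<gamma>"
    using eq unfolding homologous_rel_def singular_relboundary by blast
  have "chain_boundary p (chain_boundary (Suc p) d) = 0"
    using d chain_boundary_boundary_alt by blast
  then have bs: "chain_boundary p s = chain_boundary p \<beta> + (- chain_boundary p \<gamma>)"
    using arg_cong[OF ds, of "chain_boundary p"] by (simp add: chain_boundary_add chain_boundary_diff)
  obtain e u v where e: "singular_chain (Suc p) (subtopology X (U \<union> V)) e"
    and u: "singular_chain p (subtopology X U) u" and v: "singular_chain p (subtopology X V) v"
    and seq: "s = chain_boundary (Suc p) e + u + v"
    by (rule singular_chain_split[OF U V \<open>1 \<le> p\<close> s bs])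
      (use \<beta> \<gamma> in \<open>auto simp: singular_relcycle singular_chain_minus\<close>)
  have eX: "singular_chain (Suc p) X e"
    using e singular_chain_subtopology by blast
  have uX: "singular_chain p X u" using u singular_chain_subtopology by blast
  have z2: "\<beta> - u = \<gamma> + v + chain_boundary (Suc p) (d + e)"
    using ds seq by (simp add: chain_boundary_add algebra_simps)
  have bde: "chain_boundary p (chain_boundary (Suc p) (d + e)) = 0"
    using d eX chain_boundary_boundary_alt singular_chain_add by blast
  show thesis
  proof
    have 1: "singular_chain (p-1) (subtopology X U) (chain_boundary p (\<beta> - u))"
      using \<beta> singular_chain_boundary[OF u] by (simp add: singular_relcycle chain_boundary_diff singular_chain_diff)
    have 2: "singular_chain (p-1) (subtopology X V) (chain_boundary p (\<beta> - u))"
      unfolding z2 using \<gamma> singular_chain_boundary[OF v] bde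
      by (simp add: singular_relcycle chain_boundary_add singular_chain_add)
    show "singular_relcycle p X (U \<inter> V) (\<beta> - u)"
      using \<beta> uX singular_chain_Int[OF 1 2] by (simp add: singular_relcycle singular_chain_diff)
    show "homologous_rel p X U (\<beta> - u) \<beta>"
      by (simp add: homologous_rel_def singular_relboundary_minus singular_chain_imp_relboundary[OF u])
    have "\<beta> - u - \<gamma> = chain_boundary (Suc p) (d + e) + v" using z2 by simp
    then show "homologous_rel p X V (\<beta> - u) \<gamma>"
      unfolding homologous_rel_def singular_relboundary
      by (intro exI[of _ "d + e"] exI[of _ v]) (use d eX v singular_chain_add in auto)
  qed
qed

text \<open>The Mayer-Vietoris connecting map from \<open>H\<^sub>p\<^sub>+\<^sub>1(X, U \<union> V)\<close> to \<open>H\<^sub>p(X, U \<inter> V)\<close>, as a relation between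
  representing chains.\<close>

definition connecting :: "nat \<Rightarrow> 'a topology \<Rightarrow> 'a set \<Rightarrow> 'a set \<Rightarrow> 'a chain \<Rightarrow> 'a chain \<Rightarrow> bool" where
  "connecting p X U V \<alpha> c \<longleftrightarrow>
     (\<exists>d1 d2 s1 s2. singular_chain (Suc p) X d1 \<and> singular_chain (Suc p) X d2 \<and>
        singular_chain p (subtopology X U) s1 \<and> singular_chain p (subtopology X V) s2 \<and>
        c = chain_boundary (Suc p) d1 + s1 \<and> c = chain_boundary (Suc p) d2 + s2 \<and> \<alpha> = d1 - d2)"

lemma connecting_cmul:
  "connecting p X U V \<alpha> c \<Longrightarrow> connecting p X U V (frag_cmul k \<alpha>) (frag_cmul k c)"
  unfolding connecting_def
proof (elim exE conjE)
  fix d1 d2 s1 s2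
  assume d: "singular_chain (Suc p) X d1" "singular_chain (Suc p) X d2"
    "singular_chain p (subtopology X U) s1" "singular_chain p (subtopology X V) s2"
    "c = chain_boundary (Suc p) d1 + s1" "c = chain_boundary (Suc p) d2 + s2" "\<alpha> = d1 - d2"
  have diff: "frag_cmul k (a - b) = frag_cmul k a - frag_cmul k b" for a b :: "'a chain"
    by (metis add_diff_cancel_right' diff_add_cancel frag_cmul_distrib2)
  show "\<exists>d1 d2 s1 s2. singular_chain (Suc p) X d1 \<and> singular_chain (Suc p) X d2 \<and>
        singular_chain p (subtopology X U) s1 \<and> singular_chain p (subtopology X V) s2 \<and>
        frag_cmul k c = chain_boundary (Suc p) d1 + s1 \<and>
        frag_cmul k c = chain_boundary (Suc p) d2 + s2 \<and> frag_cmul k \<alpha> = d1 - d2"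
  proof (intro exI conjI)
    show "frag_cmul k c = chain_boundary (Suc p) (frag_cmul k d1) + frag_cmul k s1"
      using d(5) by (simp add: chain_boundary_cmul frag_cmul_distrib2)
    show "frag_cmul k c = chain_boundary (Suc p) (frag_cmul k d2) + frag_cmul k s2"
      using d(6) by (simp add: chain_boundary_cmul frag_cmul_distrib2)
    show "frag_cmul k \<alpha> = frag_cmul k d1 - frag_cmul k d2"
      using d(7) diff by simp
  qed (use d in \<open>auto intro: singular_chain_cmul\<close>)
qed

lemma connecting_diff:
  assumes "connecting p X U V \<alpha> c" "connecting p X U V \<alpha>' c'"
  shows "connecting p X U V (\<alpha> - \<alpha>') (c - c')"
proof -
  obtain d1 d2 s1 s2 where d: "singular_chain (Suc p) X d1" "singular_chain (Suc p) X d2"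
        "singular_chain p (subtopology X U) s1" "singular_chain p (subtopology X V) s2"
        "c = chain_boundary (Suc p) d1 + s1" "c = chain_boundary (Suc p) d2 + s2" "\<alpha> = d1 - d2"
    using assms(1) unfolding connecting_def by blast
  obtain e1 e2 t1 t2 where e: "singular_chain (Suc p) X e1" "singular_chain (Suc p) X e2"
        "singular_chain p (subtopology X U) t1" "singular_chain p (subtopology X V) t2"
        "c' = chain_boundary (Suc p) e1 + t1" "c' = chain_boundary (Suc p) e2 + t2" "\<alpha>' = e1 - e2"
    using assms(2) unfolding connecting_def by blast
  show ?thesis
    unfolding connecting_def
  proof (intro exI conjI)
    show "c - c' = chain_boundary (Suc p) (d1 - e1) + (s1 - t1)"
      using d(5) e(5) by (simp add: chain_boundary_diff)
    show "c - c' = chain_boundary (Suc p) (d2 - e2) + (s2 - t2)"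
      using d(6) e(6) by (simp add: chain_boundary_diff)
    show "\<alpha> - \<alpha>' = (d1 - e1) - (d2 - e2)" using d(7) e(7) by simp
  qed (use d e in \<open>auto intro: singular_chain_diff\<close>)
qed

text \<open>Bounding \<open>c\<close> relative to \<open>U\<close> and relative to \<open>V\<close>
  gives two chains; their difference is the class that obstructs bounding relative to
  \<open>U \<inter> V\<close>.\<close>

lemma connecting_exists:
  assumes "singular_relboundary p X U c" "singular_relboundary p X V c"
  obtains \<alpha> where "singular_relcycle (Suc p) X (U \<union> V) \<alpha>" "connecting p X U V \<alpha> c"
proof -
  obtain d1 s1 where 1: "singular_chain (Suc p) X d1" "singular_chain p (subtopology X U) s1"
    "chain_boundary (Suc p) d1 + s1 = c"
    using assms(1) unfolding singular_relboundary by blast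
  obtain d2 s2 where 2: "singular_chain (Suc p) X d2" "singular_chain p (subtopology X V) s2"
    "chain_boundary (Suc p) d2 + s2 = c"
    using assms(2) unfolding singular_relboundary by blast
  have "chain_boundary (Suc p) (d1 - d2) = s2 - s1"
    unfolding chain_boundary_diff by (rule diff_eq_diff_of_sums) (use 1 2 in auto)
  moreover have "singular_chain p (subtopology X (U \<union> V)) (s2 - s1)"
    by (meson 1(2) 2(2) Un_upper1 Un_upper2 singular_chain_diff singular_chain_mono)
  ultimately have "singular_relcycle (Suc p) X (U \<union> V) (d1 - d2)"
    using 1 2 by (simp add: singular_relcycle singular_chain_diff)
  moreover have "connecting p X U V (d1 - d2) c"
    unfolding connecting_def
    by (intro exI[of _ d1] exI[of _ d2] exI[of _ s1] exI[of _ s2]) (use 1 2 in auto)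
  ultimately show thesis using that by blast
qed

text \<open>Two successive Mayer-Vietoris maps compose to zero: splitting the chain between
  \<open>\<alpha>\<close> and \<open>\<beta> + \<gamma>\<close> corrects \<open>d1\<close> to a
  \<open>d\<close> that bounds \<open>c\<close> modulo \<open>U\<close> and modulo \<open>V\<close>
  at once. Later proofs that a chain is null off a union of two closed sets apply this.\<close>

lemma connecting_kernel:
  assumes U: "openin X U" and V: "openin X V"
    and con: "connecting p X U V \<alpha> c"
    and \<beta>: "singular_relcycle (Suc p) X U \<beta>" and \<gamma>: "singular_relcycle (Suc p) X V \<gamma>"
    and eq: "homologous_rel (Suc p) X (U \<union> V) \<alpha> (\<beta> + \<gamma>)"
  shows "singular_relboundary p X (U \<inter> V) c"
proof -
  obtain d1 d2 s1 s2 where d: "singular_chain (Suc p) X d1" "singular_chain (Suc p) X d2"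
        "singular_chain p (subtopology X U) s1" "singular_chain p (subtopology X V) s2"
        "c = chain_boundary (Suc p) d1 + s1" "c = chain_boundary (Suc p) d2 + s2" "\<alpha> = d1 - d2"
    using con unfolding connecting_def by blast
  obtain e s where e: "singular_chain (Suc (Suc p)) X e"
    and s: "singular_chain (Suc p) (subtopology X (U \<union> V)) s"
    and es: "chain_boundary (Suc (Suc p)) e + s = \<alpha> - (\<beta> + \<gamma>)"
    using eq unfolding homologous_rel_def singular_relboundary by blast
  have ee: "chain_boundary (Suc p) (chain_boundary (Suc (Suc p)) e) = 0"
    using e chain_boundary_boundary_alt by blast
  have s12: "chain_boundary (Suc p) d1 - chain_boundary (Suc p) d2 = s2 - s1"
    by (rule diff_eq_diff_of_sums) (use d in auto)
  have "chain_boundary (Suc p) s = chain_boundary (Suc p) \<alpha> - (chain_boundary (Suc p) \<beta> + chain_boundary (Suc p) \<gamma>)"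
    using arg_cong[OF es, of "chain_boundary (Suc p)"] ee by (simp add: chain_boundary_add chain_boundary_diff)
  then have bs: "chain_boundary (Suc p) s = (- s1 - chain_boundary (Suc p) \<beta>) + (s2 - chain_boundary (Suc p) \<gamma>)"
    using s12 unfolding d(7) by (simp add: chain_boundary_diff)
  obtain e' u v where e': "singular_chain (Suc (Suc p)) (subtopology X (U \<union> V)) e'"
    and u: "singular_chain (Suc p) (subtopology X U) u" and v: "singular_chain (Suc p) (subtopology X V) v"
    and seq: "s = chain_boundary (Suc (Suc p)) e' + u + v"
    by (rule singular_chain_split[OF U V _ s bs])
      (use \<beta> \<gamma> d(3,4) in \<open>auto simp: singular_relcycle singular_chain_minus intro: singular_chain_diff\<close>)
  have ee': "chain_boundary (Suc p) (chain_boundary (Suc (Suc p)) e') = 0"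
    using e' chain_boundary_boundary_alt by blast
  define d where "d = d1 - \<beta> - u"
  have d': "d = d2 + \<gamma> + v + chain_boundary (Suc (Suc p)) e + chain_boundary (Suc (Suc p)) e'"
    using es seq unfolding d_def d(7) by (simp add: algebra_simps)
  have 1: "c - chain_boundary (Suc p) d = s1 + chain_boundary (Suc p) \<beta> + chain_boundary (Suc p) u"
    unfolding d_def using d(5) by (simp add: chain_boundary_diff)
  have 2: "c - chain_boundary (Suc p) d = s2 - chain_boundary (Suc p) \<gamma> - chain_boundary (Suc p) v"
    unfolding d' using d(6) ee ee' by (simp add: chain_boundary_add)
  have "singular_chain p (subtopology X (U \<inter> V)) (c - chain_boundary (Suc p) d)"
  proof (rule singular_chain_Int)
    show "singular_chain p (subtopology X U) (c - chain_boundary (Suc p) d)"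
      unfolding 1 using d(3) \<beta> singular_chain_boundary[OF u]
      by (simp add: singular_relcycle singular_chain_add)
    show "singular_chain p (subtopology X V) (c - chain_boundary (Suc p) d)"
      unfolding 2 using d(4) \<gamma> singular_chain_boundary[OF v]
      by (simp add: singular_relcycle singular_chain_diff)
  qed
  moreover have "singular_chain (Suc p) X d"
    unfolding d_def using d(1) \<beta> u by (auto simp: singular_relcycle singular_chain_subtopology intro!: singular_chain_diff)
  ultimately show ?thesis
    unfolding singular_relboundary
    by (intro exI[of _ d] exI[of _ "c - chain_boundary (Suc p) d"]) auto
qed

text \<open>The other half of exactness at \<open>U \<union> V\<close>: a chain \<open>e\<close>
  bounding \<open>c\<close> relative to the intersection splits \<open>\<alpha>\<close> as
  \<open>(d1 - e) + (e - d2)\<close>.\<close>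

lemma connecting_relboundary:
  assumes con: "connecting p X U V \<alpha> c" and c: "singular_relboundary p X (U \<inter> V) c"
  obtains \<beta> \<gamma> where "singular_relcycle (Suc p) X U \<beta>" "singular_relcycle (Suc p) X V \<gamma>" "\<alpha> = \<beta> + \<gamma>"
proof -
  obtain d1 d2 s1 s2 where d: "singular_chain (Suc p) X d1" "singular_chain (Suc p) X d2"
        "singular_chain p (subtopology X U) s1" "singular_chain p (subtopology X V) s2"
        "c = chain_boundary (Suc p) d1 + s1" "c = chain_boundary (Suc p) d2 + s2" "\<alpha> = d1 - d2"
    using con unfolding connecting_def by blast
  obtain e s where e: "singular_chain (Suc p) X e" and s: "singular_chain p (subtopology X (U \<inter> V)) s"
    and es: "chain_boundary (Suc p) e + s = c"
    using c unfolding singular_relboundary by blast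
  have s': "singular_chain p (subtopology X U) s" "singular_chain p (subtopology X V) s"
    using s singular_chain_mono by (metis inf_le1, metis inf_le2)
  have "chain_boundary (Suc p) (d1 - e) = s - s1" "chain_boundary (Suc p) (e - d2) = s2 - s"
    unfolding chain_boundary_diff by (rule diff_eq_diff_of_sums[of c]; use es d(5,6) in simp)+
  then have "singular_relcycle (Suc p) X U (d1 - e)" "singular_relcycle (Suc p) X V (e - d2)"
    using d e s' by (auto simp: singular_relcycle intro: singular_chain_diff)
  then show thesis using that[of "d1 - e" "e - d2"] d(7) by simp
qed

text \<open>The boundary of \<open>\<alpha>\<close> splits into a part in \<open>U\<close> and a
  part \<open>v\<close> in \<open>V\<close>, and \<open>v\<close> is the image. The witness
  \<open>d2 = 0\<close> matters: the image is represented by a chain inside \<open>V\<close>, which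
  later keeps it off the drawing.\<close>

lemma connecting_surj:
  assumes U: "openin X U" and V: "openin X V" and "1 \<le> p"
    and \<alpha>: "singular_relcycle (Suc p) X (U \<union> V) \<alpha>"
  obtains \<alpha>' c where "homologous_rel (Suc p) X (U \<union> V) \<alpha>' \<alpha>" "connecting p X U V \<alpha>' c"
    "singular_chain p (subtopology X V) c" "singular_relboundary p X U c" "singular_relcycle p X (U \<inter> V) c"
proof -
  let ?t = "chain_boundary (Suc p) \<alpha>"
  have t: "singular_chain p (subtopology X (U \<union> V)) ?t" and \<alpha>X: "singular_chain (Suc p) X \<alpha>"
    using \<alpha> by (auto simp: singular_relcycle)
  have bt: "chain_boundary p ?t = 0 + 0"
    using \<alpha>X chain_boundary_boundary_alt by simp
  obtain e u v where e: "singular_chain (Suc p) (subtopology X (U \<union> V)) e"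
    and u: "singular_chain p (subtopology X U) u" and v: "singular_chain p (subtopology X V) v"
    and teq: "?t = chain_boundary (Suc p) e + u + v"
    by (rule singular_chain_split[OF U V \<open>1 \<le> p\<close> t bt]) auto
  have eX: "singular_chain (Suc p) X e" using e singular_chain_subtopology by blast
  have v': "v = chain_boundary (Suc p) (\<alpha> - e) + (- u)"
    using teq by (simp add: chain_boundary_diff)
  have 0: "chain_boundary p (chain_boundary (Suc p) (\<alpha> - e)) = 0"
    using chain_boundary_boundary_alt singular_chain_diff[OF \<alpha>X eX] by blast
  show thesis
  proof
    show "homologous_rel (Suc p) X (U \<union> V) (\<alpha> - e) \<alpha>"
      by (simp add: homologous_rel_def singular_relboundary_minus singular_chain_imp_relboundary[OF e])
    show "connecting p X U V (\<alpha> - e) v"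
      unfolding connecting_def
      by (rule exI[of _ "\<alpha> - e"], rule exI[of _ 0], rule exI[of _ "-u"], rule exI[of _ v])
        (use \<alpha>X eX u v v' in \<open>auto simp: singular_chain_minus intro: singular_chain_diff\<close>)
    show "singular_chain p (subtopology X V) v" by fact
    show "singular_relboundary p X U v"
      unfolding singular_relboundary
      by (rule exI[of _ "\<alpha> - e"], rule exI[of _ "-u"])
        (use v' \<alpha>X eX u in \<open>auto simp: singular_chain_minus intro: singular_chain_diff\<close>)
    have "chain_boundary p v = - chain_boundary p u"
      using arg_cong[OF v', of "chain_boundary p"] 0
      unfolding chain_boundary_add chain_boundary_minus by simp
    then have "singular_chain (p-1) (subtopology X (U \<inter> V)) (chain_boundary p v)"
      using singular_chain_boundary[OF u] singular_chain_boundary[OF v]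
      by (intro singular_chain_Int) (auto simp: singular_chain_minus)
    then show "singular_relcycle p X (U \<inter> V) v"
      using v by (auto simp: singular_relcycle singular_chain_subtopology)
  qed
qed

text \<open>The closed complements are disjoint, so the obstruction lies in the homology of X
  relative to itself, which is zero.\<close>

lemma singular_relboundary_Int:
  assumes "openin X U" "openin X V" "U \<union> V = topspace X"
    and "singular_relboundary p X U c" "singular_relboundary p X V c"
  shows "singular_relboundary p X (U \<inter> V) c"
proof -
  obtain \<alpha> where \<alpha>: "singular_relcycle (Suc p) X (U \<union> V) \<alpha>" "connecting p X U V \<alpha> c"
    using connecting_exists assms by blast
  then have "singular_relboundary (Suc p) X (topspace X) \<alpha>"
    by (auto simp: singular_relcycle intro: singular_chain_imp_relboundary)
  then have "homologous_rel (Suc p) X (U \<union> V) \<alpha> (0 + 0)"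
    using assms(3) by (simp add: homologous_rel_def)
  then show ?thesis
    using connecting_kernel[OF assms(1,2) \<alpha>(2) singular_relcycle_0 singular_relcycle_0] by blast
qed

section \<open>Points, paths and compact supports\<close>

definition vertex0 :: "nat \<Rightarrow> real" where
  "vertex0 = (\<lambda>j. if j = 0 then 1 else 0)"

definition point_simplex :: "'a \<Rightarrow> (nat \<Rightarrow> real) \<Rightarrow> 'a" where
  "point_simplex x = restrict (\<lambda>_. x) (standard_simplex 0)"

lemma vertex0_in_simplex: "vertex0 \<in> standard_simplex 0"
  by (simp add: vertex0_def standard_simplex_0)

lemma point_simplex_apply [simp]: "point_simplex x vertex0 = x"
  by (simp add: point_simplex_def vertex0_in_simplex)

lemma singular_simplex_point: "x \<in> topspace X \<Longrightarrow> singular_simplex 0 X (point_simplex x)"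
  by (simp add: singular_simplex_def point_simplex_def)

lemma singular_simplex_0_point:
  assumes "singular_simplex 0 X f"
  shows "f vertex0 \<in> topspace X" "f = point_simplex (f vertex0)"
proof -
  show "f vertex0 \<in> topspace X"
    using assms vertex0_in_simplex
    by (auto simp: singular_simplex_def continuous_map_def)
  have 0: "standard_simplex 0 = {vertex0}"
    by (simp add: standard_simplex_0 vertex0_def)
  have "f \<in> extensional {vertex0}"
    using assms by (simp add: singular_simplex_def 0)
  then show "f = point_simplex (f vertex0)"
    by (rule extensionalityI[of _ "{vertex0}"]) (auto simp: point_simplex_def 0)
qed

text \<open>All points of a path-connected space are homologous; this is applied to the path
  component of \<open>x\<close>.\<close>

lemma path_component_of_chain:
  assumes "path_component_of X x y"
  obtains d where "singular_chain (Suc 0) X d"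
    "chain_boundary (Suc 0) d = frag_of (point_simplex y) - frag_of (point_simplex x)"
proof -
  define P where "P = Collect (path_component_of X x)"
  have P: "path_connectedin X P" unfolding P_def by (rule path_connectedin_path_component_of)
  have xy: "x \<in> P" "y \<in> P" "P \<subseteq> topspace X"
    using assms path_component_of_equiv path_component_of_subset_topspace unfolding P_def
    by (fastforce simp: path_component_of_refl)+
  have "homologous_rel 0 (subtopology X P) {} (frag_of (point_simplex y)) (frag_of (point_simplex x))"
    by (rule iso_integer_zeroth_homology_group_aux)
      (use P xy in \<open>auto simp: path_connectedin_def intro!: singular_simplex_point\<close>)
  then obtain d where "singular_chain (Suc 0) (subtopology X P) d"
     "chain_boundary (Suc 0) d = frag_of (point_simplex y) - frag_of (point_simplex x)"
    unfolding homologous_rel_def singular_boundary by blast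
  then show thesis
    using that singular_chain_subtopology by blast
qed

text \<open>Augmentation refined by a labelling: the two ends of a singular 1-simplex lie in one
  path component, so they carry the same label and cancel.\<close>

lemma frag_extend_chain_boundary_1:
  assumes r: "\<And>x y. path_component_of X x y \<Longrightarrow> r x = r y"
    and d: "singular_chain (Suc 0) X d"
  shows "frag_extend (\<lambda>f. frag_of (r (f vertex0))) (chain_boundary (Suc 0) d) = 0"
  using d unfolding singular_chain_def
proof (induction d rule: frag_induction)
  case (one \<sigma>)
  then have \<sigma>: "singular_simplex (Suc 0) X \<sigma>" by simp
  define a where "a k = \<sigma> (simplical_face k vertex0)" for k
  have face: "(singular_face (Suc 0) k \<sigma>) vertex0 = a k" for k
    by (simp add: singular_face_def a_def vertex0_in_simplex)
  have pc: "path_connectedin X (\<sigma> ` standard_simplex (Suc 0))"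
    using \<sigma> path_connectedin_continuous_map_image[of "subtopology (powertop_real UNIV) (standard_simplex (Suc 0))" X \<sigma>]
      path_connectedin_standard_simplex[of "Suc 0"]
    by (simp add: singular_simplex_def path_connectedin_subtopology)
  have "a k \<in> \<sigma> ` standard_simplex (Suc 0)" if "k \<le> Suc 0" for k
    unfolding a_def using simplical_face_in_standard_simplex[of "Suc 0" k vertex0] vertex0_in_simplex that by simp
  then have "path_component_of X (a 0) (a (Suc 0))"
    using pc by (meson le_numeral_extra(3) path_component_of order_refl zero_le)
  then have "r (a 0) = r (a (Suc 0))" by (rule r)
  then show ?case
    by (simp add: chain_boundary_of frag_extend_diff face)
next
  case (diff a b)
  then show ?case by (simp add: chain_boundary_diff frag_extend_diff)
qed auto

section \<open>Compact supports of chains\<close>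

lemma singular_chain_compact_support:
  assumes "singular_chain p (subtopology X T) c"
  obtains C where "compactin X C" "C \<subseteq> T" "singular_chain p (subtopology X C) c"
proof
  let ?C = "\<Union>f \<in> Poly_Mapping.keys c. f ` standard_simplex p"
  have c: "singular_chain p X c" "\<And>f. f \<in> Poly_Mapping.keys c \<Longrightarrow> f ` standard_simplex p \<subseteq> T"
    using assms by (auto simp: singular_chain_subtopology)
  have "compactin X (f ` standard_simplex p)" if "f \<in> Poly_Mapping.keys c" for f
  proof -
    have "continuous_map (subtopology (powertop_real UNIV) (standard_simplex p)) X f"
      using c that by (auto simp: singular_chain_def singular_simplex_def)
    moreover have "compactin (subtopology (powertop_real UNIV) (standard_simplex p)) (standard_simplex p)"
      by (simp add: compactin_subtopology compactin_standard_simplex)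
    ultimately show ?thesis
      by (metis image_compactin)
  qed
  then show "compactin X ?C"
    by (intro compactin_Union) auto
  show "?C \<subseteq> T" using c by blast
  show "singular_chain p (subtopology X ?C) c"
    using c by (auto simp: singular_chain_subtopology)
qed

lemma singular_relboundary_compact_support:
  assumes "singular_relboundary p X T c"
  obtains C where "compactin X C" "C \<subseteq> T" "singular_relboundary p X C c"
proof -
  obtain d e where d: "singular_chain (Suc p) X d" "singular_chain p (subtopology X T) e"
      "chain_boundary (Suc p) d + e = c"
    using assms unfolding singular_relboundary by blast
  obtain C where C: "compactin X C" "C \<subseteq> T" "singular_chain p (subtopology X C) e"
    using singular_chain_compact_support[OF d(2)] .
  then show thesis
    using that d unfolding singular_relboundary by blast
qed

text \<open>A relative boundary uses only a compact, hence closed, part of the complement of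
  \<open>x\<close>; what remains is a neighbourhood of \<open>x\<close>. This is why the values of a
  class are locally constant.\<close>

lemma singular_relboundary_nbhd:
  assumes "Hausdorff_space X" "x \<in> topspace X" "singular_relboundary p X (topspace X - {x}) c"
  obtains N where "openin X N" "x \<in> N" "singular_relboundary p X (topspace X - N) c"
proof -
  obtain C where C: "compactin X C" "C \<subseteq> topspace X - {x}" "singular_relboundary p X C c"
    using singular_relboundary_compact_support assms(3) by blast
  have "closedin X C" using C assms compactin_imp_closedin by blast
  moreover have "topspace X - (topspace X - C) = C" using C by blast
  ultimately show thesis
    using that[of "topspace X - C"] C assms by auto
qed

text \<open>A relation between differences of points in \<open>H\<^sub>0\<close> of an open set is detected by the free abelian
  group on its path components.\<close>

lemma relboundary_point_difference:
  assumes "singular_relboundary (Suc 0) X U c"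
    and "chain_boundary (Suc 0) c = frag_cmul i (frag_of (point_simplex u) - frag_of (point_simplex w))
          - frag_cmul j (frag_of (point_simplex v) - frag_of (point_simplex w))"
  shows "frag_cmul i (frag_of (path_component_of_set (subtopology X U) u) - frag_of (path_component_of_set (subtopology X U) w))
          = frag_cmul j (frag_of (path_component_of_set (subtopology X U) v) - frag_of (path_component_of_set (subtopology X U) w))"
proof -
  obtain d s where d: "singular_chain (Suc (Suc 0)) X d" and s: "singular_chain (Suc 0) (subtopology X U) s"
    and c: "chain_boundary (Suc (Suc 0)) d + s = c"
    using assms(1) unfolding singular_relboundary by blast
  have "chain_boundary (Suc 0) c = chain_boundary (Suc 0) s"
    using chain_boundary_boundary_alt[OF d] by (simp flip: c add: chain_boundary_add)
  then have "frag_extend (\<lambda>f. frag_of (path_component_of_set (subtopology X U) (f vertex0))) (chain_boundary (Suc 0) c) = 0"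
    using frag_extend_chain_boundary_1[OF _ s, of "path_component_of_set (subtopology X U)"]
    by (simp add: path_component_of_equiv)
  then show ?thesis
    unfolding assms(2) by (simp add: frag_extend_diff frag_extend_cmul)
qed

lemma relboundary_imp_path_component_of:
  assumes "singular_relboundary (Suc 0) X U c" "u \<in> U" "w \<in> U" "U \<subseteq> topspace X"
    and "chain_boundary (Suc 0) c = frag_of (point_simplex u) - frag_of (point_simplex w)"
  shows "path_component_of (subtopology X U) u w"
proof -
  have "frag_of (path_component_of_set (subtopology X U) u) = frag_of (path_component_of_set (subtopology X U) w)"
    using relboundary_point_difference[of X U c 1 u w 0 w] assms by simp
  then have "path_component_of_set (subtopology X U) u = path_component_of_set (subtopology X U) w"
    by (simp add: frag_of_eq)
  moreover have "w \<in> path_component_of_set (subtopology X U) w"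
    using assms by (simp add: path_component_of_refl inf_absorb2)
  ultimately show ?thesis by blast
qed

text \<open>Three distinct path components are three basis elements of the free abelian group; the
  coefficients at those of \<open>u\<close> and \<open>v\<close> can be compared separately.\<close>

lemma relboundary_imp_coefficients_0:
  assumes "singular_relboundary (Suc 0) X U (frag_cmul i c - frag_cmul j c')"
    and "u \<in> U" "v \<in> U" "w \<in> U" "U \<subseteq> topspace X"
    and "chain_boundary (Suc 0) c = frag_of (point_simplex u) - frag_of (point_simplex w)"
    and "chain_boundary (Suc 0) c' = frag_of (point_simplex v) - frag_of (point_simplex w)"
    and "\<not> path_component_of (subtopology X U) u v" "\<not> path_component_of (subtopology X U) u w"
      "\<not> path_component_of (subtopology X U) v w"
  shows "i = 0 \<and> j = 0"
proof -
  let ?P = "path_component_of_set (subtopology X U)"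
  have self: "x \<in> ?P x" if "x \<in> U" for x
    using that assms(5) by (simp add: path_component_of_refl inf_absorb2)
  have ne: "?P u \<noteq> ?P v" "?P u \<noteq> ?P w" "?P v \<noteq> ?P w"
    using assms(8-10) self[OF assms(3)] self[OF assms(4)] by blast+
  have eq: "frag_cmul i (frag_of (?P u) - frag_of (?P w)) = frag_cmul j (frag_of (?P v) - frag_of (?P w))"
    using relboundary_point_difference[OF assms(1), of i u w j v] assms(6,7)
    by (simp add: chain_boundary_diff chain_boundary_cmul)
  have "i = 0" using arg_cong[OF eq, of "\<lambda>x. Poly_Mapping.lookup x (?P u)"] ne
    by (simp add: lookup_minus lookup_single)
  moreover have "j = 0" using arg_cong[OF eq, of "\<lambda>x. Poly_Mapping.lookup x (?P v)"] ne
    by (simp add: lookup_minus lookup_single)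
  ultimately show ?thesis by blast
qed

text \<open>No two path components of \<open>W\<close> merge in \<open>U\<close>, so H_0 of
  \<open>W\<close> injects into H_0 of \<open>U\<close>. Each point of \<open>W\<close> is joined
  inside \<open>W\<close> to a representative of its \<open>U\<close>-component, and the
  representatives cancel because the 0-chain bounds in \<open>U\<close>.\<close>

lemma chain_boundary_transfer:
  assumes O: "W \<subseteq> U" "U \<subseteq> topspace X"
    and nonmerge: "\<And>x y. x \<in> W \<Longrightarrow> y \<in> W \<Longrightarrow> path_component_of (subtopology X U) x y
                \<Longrightarrow> path_component_of (subtopology X W) x y"
    and c: "singular_chain (Suc 0) (subtopology X U) c"
    and bc: "singular_chain 0 (subtopology X W) (chain_boundary (Suc 0) c)"
  obtains t where "singular_chain (Suc 0) (subtopology X W) t" "chain_boundary (Suc 0) t = chain_boundary (Suc 0) c"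
proof -
  \<comment> \<open>The choice depends on \<open>y\<close> only through its component in
    \<open>U\<close>, so \<open>r\<close> is a labelling constant on components.\<close>
  define r where "r y = (SOME z. z \<in> W \<and> path_component_of (subtopology X U) y z)" for y
  have r: "r y \<in> W \<and> path_component_of (subtopology X U) y (r y)" if "y \<in> W" for y
    unfolding r_def by (rule someI[of _ y]) (use that O in \<open>auto simp: path_component_of_refl\<close>)
  have rc: "r x = r y" if "path_component_of (subtopology X U) x y" for x y
    unfolding r_def using that by (metis path_component_of_sym path_component_of_trans)
  have "\<exists>d. singular_chain (Suc 0) (subtopology X W) d \<and>
      chain_boundary (Suc 0) d = frag_of f - frag_of (point_simplex (r (f vertex0)))"
    if f: "singular_simplex 0 (subtopology X W) f" for f
  proof -
    have fW: "f vertex0 \<in> W" using singular_simplex_0_point(1)[OF f] by simp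
    then have "path_component_of (subtopology X W) (r (f vertex0)) (f vertex0)"
      using nonmerge r path_component_of_sym by metis
    then show ?thesis
      using path_component_of_chain singular_simplex_0_point(2)[OF f] by metis
  qed
  then obtain h where h: "\<And>f. singular_simplex 0 (subtopology X W) f \<Longrightarrow>
      singular_chain (Suc 0) (subtopology X W) (h f) \<and>
      chain_boundary (Suc 0) (h f) = frag_of f - frag_of (point_simplex (r (f vertex0)))"
    by metis
  have ext: "chain_boundary (Suc 0) (frag_extend h b)
      = b - frag_extend (\<lambda>f. frag_of (point_simplex (r (f vertex0)))) b"
    if "singular_chain 0 (subtopology X W) b" for b
    using that unfolding singular_chain_def
  proof (induction b rule: frag_induction)
    case (one f)
    then show ?case using h by simp
  next
    case (diff a b)
    then show ?case by (simp add: frag_extend_diff chain_boundary_diff)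
  qed auto
  show thesis
  proof
    show "singular_chain (Suc 0) (subtopology X W) (frag_extend h (chain_boundary (Suc 0) c))"
      using bc h by (intro singular_chain_extend) (auto simp: singular_chain_def)
    have "frag_extend (\<lambda>f. frag_of (point_simplex (r (f vertex0)))) (chain_boundary (Suc 0) c) = 0"
      using frag_extend_chain_boundary_1[OF _ c, of "\<lambda>x. point_simplex (r x)"] rc by metis
    then show "chain_boundary (Suc 0) (frag_extend h (chain_boundary (Suc 0) c)) = chain_boundary (Suc 0) c"
      using ext[OF bc] by simp
  qed
qed

section \<open>Local homology along arcs in an oriented surface\<close>

lemma frag_cmul_diff_distrib2: "frag_cmul k (a - b) = frag_cmul k a - frag_cmul k b"
  by (metis add_diff_cancel_right' diff_add_cancel frag_cmul_distrib2)

lemma homologous_rel_cmul: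
  "homologous_rel p X S a b \<Longrightarrow> homologous_rel p X S (frag_cmul k a) (frag_cmul k b)"
  unfolding homologous_rel_def by (metis frag_cmul_diff_distrib2 singular_relboundary_cmul)

lemma homologous_rel_trans_sym:
  "homologous_rel p X S a c \<Longrightarrow> homologous_rel p X S b c \<Longrightarrow> homologous_rel p X S a b"
  using homologous_rel_trans[of p X S c b a] homologous_rel_sym[of p X S b c] by blast

lemma homologous_rel_mono:
  "homologous_rel p X S a b \<Longrightarrow> S \<subseteq> T \<Longrightarrow> homologous_rel p X T a b"
  unfolding homologous_rel_def by (rule singular_relboundary_mono)

text \<open>The chain-level facts about a connected oriented surface from which the arguments on
  arcs and graphs start. \<open>local_generator\<close> and \<open>local_infinite_order\<close> make
  H_2(X, X - {x}) infinite cyclic on \<open>m x\<close>, so a class on \<open>K\<close> has a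
  well-defined integer at each point of \<open>K\<close>; \<open>local_consistency\<close> is the
  orientation.\<close>

locale oriented_surface =
  fixes X :: "'s topology" and m :: "'s \<Rightarrow> 's chain"
  assumes hausdorff: "Hausdorff_space X"
    and locally_path_connected: "locally_path_connected_space X"
    and path_connected: "path_connected_space X"
    and H1_point: "\<lbrakk>x \<in> topspace X; singular_relcycle (Suc 0) X (topspace X - {x}) c\<rbrakk>
          \<Longrightarrow> singular_relboundary (Suc 0) X (topspace X - {x}) c"
    and local_class: "x \<in> topspace X \<Longrightarrow> singular_relcycle (Suc (Suc 0)) X (topspace X - {x}) (m x)"
    and local_generator: "\<lbrakk>x \<in> topspace X; singular_relcycle (Suc (Suc 0)) X (topspace X - {x}) c\<rbrakk>
          \<Longrightarrow> \<exists>k. homologous_rel (Suc (Suc 0)) X (topspace X - {x}) c (frag_cmul k (m x))"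
    and local_infinite_order: "\<lbrakk>x \<in> topspace X;
          singular_relboundary (Suc (Suc 0)) X (topspace X - {x}) (frag_cmul k (m x))\<rbrakk> \<Longrightarrow> k = 0"
    and local_consistency: "x \<in> topspace X \<Longrightarrow>
          \<exists>B n. openin X B \<and> x \<in> B \<and> singular_relcycle (Suc (Suc 0)) X (topspace X - B) n \<and>
            (\<forall>y\<in>B. homologous_rel (Suc (Suc 0)) X (topspace X - {y}) n (m y))"
begin

text \<open>Groups are indexed by the set \<open>K\<close> and not by its complement: classes then
  restrict from \<open>K\<close> to its subsets, like functions on \<open>K\<close>.\<close>

abbreviation cyc where "cyc p K \<equiv> singular_relcycle p X (topspace X - K)"
abbreviation nul where "nul p K \<equiv> singular_relboundary p X (topspace X - K)"
abbreviation hlg where "hlg p K \<equiv> homologous_rel p X (topspace X - K)"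
abbreviation cyc1 where "cyc1 \<equiv> cyc (Suc 0)"
abbreviation nul1 where "nul1 \<equiv> nul (Suc 0)"
abbreviation cyc2 where "cyc2 \<equiv> cyc (Suc (Suc 0))"
abbreviation nul2 where "nul2 \<equiv> nul (Suc (Suc 0))"
abbreviation hlg2 where "hlg2 \<equiv> hlg (Suc (Suc 0))"

lemma cyc_mono: "cyc p K c \<Longrightarrow> L \<subseteq> K \<Longrightarrow> cyc p L c"
  by (erule singular_relcycle_mono) blast

lemma nul_mono: "nul p K c \<Longrightarrow> L \<subseteq> K \<Longrightarrow> nul p L c"
  by (erule singular_relboundary_mono) blast

lemma hlg_mono: "hlg p K a b \<Longrightarrow> L \<subseteq> K \<Longrightarrow> hlg p L a b"
  by (erule homologous_rel_mono) blast

lemma nul_empty: "cyc p {} c \<Longrightarrow> nul p {} c"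
  by (auto simp: singular_relcycle intro: singular_chain_imp_relboundary)

lemma hlg_local_unique:
  assumes "x \<in> topspace X" "hlg2 {x} c (frag_cmul k (m x))" "hlg2 {x} c (frag_cmul l (m x))"
  shows "k = l"
proof -
  have "hlg2 {x} (frag_cmul k (m x)) (frag_cmul l (m x))"
    using assms(2,3) homologous_rel_sym homologous_rel_trans_sym by blast
  then have "nul2 {x} (frag_cmul (k - l) (m x))"
    by (simp add: homologous_rel_def frag_cmul_diff_distrib)
  then show ?thesis using local_infinite_order[OF assms(1)] by fastforce
qed

lemma cyc_glue:
  assumes "closedin X K" "closedin X L" "cyc (Suc p) K b" "cyc (Suc p) L c" "hlg (Suc p) (K \<inter> L) b c"
  shows "\<exists>z. cyc (Suc p) (K \<union> L) z \<and> hlg (Suc p) K z b \<and> hlg (Suc p) L z c"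
  using singular_relcycle_glue[of X "topspace X - K" "topspace X - L" "Suc p" b c] assms
  by (auto simp: Diff_Un Diff_Int)

text \<open>Distinct points impose no condition on each other, as there is no obstruction to
  combining disjoint closed sets.\<close>

lemma nul_finite:
  assumes "finite F" "F \<subseteq> topspace X" "cyc p F c" "\<And>x. x \<in> F \<Longrightarrow> nul p {x} c"
  shows "nul p F c"
  using assms
proof (induction F)
  case empty
  then show ?case using nul_empty by simp
next
  case (insert x F)
  have cl: "closedin X F" "closedin X {x}"
    using insert.prems insert.hyps hausdorff by (auto intro: closedin_Hausdorff_finite)
  have "nul p F c"
    using insert.IH insert.prems cyc_mono[of p "insert x F" c F] by blast
  moreover have "nul p {x} c" using insert.prems by blast
  moreover have "(topspace X - F) \<union> (topspace X - {x}) = topspace X"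
    using insert.hyps by blast
  ultimately have "singular_relboundary p X ((topspace X - F) \<inter> (topspace X - {x})) c"
    using cl by (intro singular_relboundary_Int) auto
  moreover have "(topspace X - F) \<inter> (topspace X - {x}) = topspace X - insert x F" by blast
  ultimately show ?case by simp
qed

lemma hlg_finite:
  assumes "finite F" "F \<subseteq> topspace X" "cyc p F b" "cyc p F c" "\<And>x. x \<in> F \<Longrightarrow> hlg p {x} b c"
  shows "hlg p F b c"
  unfolding homologous_rel_def
  using nul_finite[of F p "b - c"] assms by (simp add: homologous_rel_def singular_relcycle_diff)

text \<open>Values prescribed at single points can be glued freely, since the intersections are
  empty.\<close>

lemma cyc_finite_exists:
  assumes "finite F" "F \<subseteq> topspace X"
  shows "\<exists>c. cyc2 F c \<and> (\<forall>x\<in>F. hlg2 {x} c (frag_cmul (k x) (m x)))"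
    using assms
  proof (induction F)
    case empty
    then show ?case by (auto intro: exI[of _ 0])
  next
    case (insert x F)
    then obtain c where c: "cyc2 F c" "\<And>x. x \<in> F \<Longrightarrow> hlg2 {x} c (frag_cmul (k x) (m x))"
      by auto
    let ?d = "frag_cmul (k x) (m x)"
    have d: "cyc2 {x} ?d"
      using insert.prems by (simp add: local_class singular_relcycle_cmul)
    have cl: "closedin X F" "closedin X {x}"
      using insert.prems insert.hyps hausdorff by (auto intro: closedin_Hausdorff_finite)
    have "F \<inter> {x} = {}" using insert.hyps by blast
    then have "hlg2 (F \<inter> {x}) c ?d"
      using nul_empty[of "Suc (Suc 0)" "c - ?d"] cyc_mono[OF c(1), of "{}"] cyc_mono[OF d, of "{}"]
      unfolding homologous_rel_def by (simp add: singular_relcycle_diff)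
    from cyc_glue[OF cl c(1) d this]
    obtain z where z: "cyc2 (F \<union> {x}) z" "hlg2 F z c" "hlg2 {x} z ?d"
      by (elim exE conjE)
    moreover have "hlg2 {y} z (frag_cmul (k y) (m y))" if "y \<in> F" for y
      using homologous_rel_trans[OF c(2)[OF that] hlg_mono[OF z(2), of "{y}"]] that by blast
    ultimately show ?case by auto
  qed

end

locale surface_arc = oriented_surface X m for X :: "'s topology" and m +
  fixes \<gamma> :: "real \<Rightarrow> 's"
  assumes pathin: "pathin X \<gamma>" and inj: "inj_on \<gamma> {0..1}"
begin

lemma compactin_arc: "0 \<le> s \<Longrightarrow> t \<le> 1 \<Longrightarrow> compactin X (\<gamma> ` {s..t})"
  by (rule image_compactin[of "top_of_set {0..1}"])
    (use pathin in \<open>auto simp: pathin_def compactin_subtopology\<close>)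

lemma closedin_arc: "0 \<le> s \<Longrightarrow> t \<le> 1 \<Longrightarrow> closedin X (\<gamma> ` {s..t})"
  using compactin_arc compactin_imp_closedin hausdorff by blast

lemma arc_in_topspace: "s \<in> {0..1} \<Longrightarrow> \<gamma> s \<in> topspace X"
  using compactin_subset_topspace[OF compactin_arc[of 0 1]] by auto

lemma arc_local:
  assumes "openin X N" "x \<in> {0..1}" "\<gamma> x \<in> N"
  obtains d where "d > 0" "\<And>s t. 0 \<le> s \<Longrightarrow> s \<le> x \<Longrightarrow> x \<le> t \<Longrightarrow> t \<le> 1 \<Longrightarrow> t - s < d \<Longrightarrow> \<gamma> ` {s..t} \<subseteq> N"
proof -
  have "openin (top_of_set {0..1}) {y \<in> {0..1}. \<gamma> y \<in> N}"
    using pathin assms(1) unfolding pathin_def continuous_map_def by auto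
  then obtain e where e: "e > 0" "ball x e \<inter> {0..1} \<subseteq> {y \<in> {0..1}. \<gamma> y \<in> N}"
    using assms(2,3) unfolding openin_contains_ball by blast
  have "\<gamma> y \<in> N" if "0 \<le> s" "s \<le> x" "x \<le> t" "t \<le> 1" "t - s < e" "y \<in> {s..t}" for s t y
  proof -
    have "y \<in> ball x e \<inter> {0..1}" using that by (auto simp: dist_real_def)
    then show ?thesis using e by blast
  qed
  then show thesis by (intro that[of e] e(1) image_subsetI)
qed

text \<open>Compactness of the interval as Bolzano's principle: additivity over adjacent subarcs and
  validity on short subarcs around each point suffice.\<close>

lemma arc_induct [consumes 2, case_names trans local]:
  assumes st: "0 \<le> s" "s \<le> t" "t \<le> 1"
    and trans: "\<And>a b c. \<lbrakk>0 \<le> a; a \<le> b; b \<le> c; c \<le> 1; P a b; P b c\<rbrakk> \<Longrightarrow> P a c"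
    and local: "\<And>x. \<lbrakk>0 \<le> x; x \<le> 1\<rbrakk> \<Longrightarrow> \<exists>N. openin X N \<and> \<gamma> x \<in> N \<and>
          (\<forall>a b. 0 \<le> a \<and> a \<le> x \<and> x \<le> b \<and> b \<le> 1 \<and> \<gamma> ` {a..b} \<subseteq> N \<longrightarrow> P a b)"
  shows "P s t"
proof -
  have "0 \<le> s \<and> s \<le> t \<and> t \<le> 1 \<longrightarrow> P s t"
    using st(2)
  proof (induction s t rule: Bolzano)
    case (trans a b c)
    then show ?case using order.trans[of 0 a b] order.trans[of b c 1] assms(4)[of a b c] by blast
  next
    case (local x)
    then have x: "0 \<le> x" "x \<le> 1" using st by auto
    obtain N where N: "openin X N" "\<gamma> x \<in> N"
      "\<And>a b. \<lbrakk>0 \<le> a; a \<le> x; x \<le> b; b \<le> 1; \<gamma> ` {a..b} \<subseteq> N\<rbrakk> \<Longrightarrow> P a b"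
      using assms(5)[OF x] by blast
    obtain d where "d > 0" "\<And>s t. 0 \<le> s \<Longrightarrow> s \<le> x \<Longrightarrow> x \<le> t \<Longrightarrow> t \<le> 1 \<Longrightarrow> t - s < d \<Longrightarrow> \<gamma> ` {s..t} \<subseteq> N"
      using arc_local[OF N(1) _ N(2)] x by auto
    then have "0 \<le> a \<and> a \<le> b \<and> b \<le> 1 \<longrightarrow> P a b" if "a \<le> x \<and> x \<le> b \<and> b - a < d" for a b
      using N(3)[of a b] that by blast
    then show ?case using \<open>d > 0\<close> by (intro exI[of _ d]) simp
  qed
  then show ?thesis using st by simp
qed

lemma arc_Int:
  assumes "0 \<le> a" "a \<le> b" "b \<le> c" "c \<le> 1"
  shows "\<gamma> ` {a..b} \<inter> \<gamma> ` {b..c} = {\<gamma> b}" "\<gamma> ` {a..b} \<union> \<gamma> ` {b..c} = \<gamma> ` {a..c}"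
proof -
  have "\<gamma> ` {a..b} \<inter> \<gamma> ` {b..c} = \<gamma> ` ({a..b} \<inter> {b..c})"
    by (rule inj_on_image_Int[OF inj, symmetric]) (use assms in auto)
  moreover have "{a..b} \<inter> {b..c} = {b}" using assms by auto
  ultimately show "\<gamma> ` {a..b} \<inter> \<gamma> ` {b..c} = {\<gamma> b}" by simp
  have "{a..b} \<union> {b..c} = {a..c}" using assms by auto
  then show "\<gamma> ` {a..b} \<union> \<gamma> ` {b..c} = \<gamma> ` {a..c}" by (simp flip: image_Un)
qed

text \<open>Consecutive classes overlap in the single point \<open>\<gamma> b\<close>, where both
  equal \<open>m (\<gamma> b)\<close>, so they glue. The arc thus carries a class with value 1
  everywhere, and its multiples realise every constant.\<close>

lemma arc_class_exists:
  assumes "0 \<le> s" "s \<le> t" "t \<le> 1"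
  shows "\<exists>\<nu>. cyc2 (\<gamma> ` {s..t}) \<nu> \<and> (\<forall>y\<in>\<gamma> ` {s..t}. hlg2 {y} \<nu> (m y))"
proof (rule arc_induct[where s = s and t = t and P = "\<lambda>s t. \<exists>\<nu>. cyc2 (\<gamma> ` {s..t}) \<nu> \<and>
    (\<forall>y\<in>\<gamma> ` {s..t}. hlg2 {y} \<nu> (m y))"])
  fix a b c :: real
  assume ab: "0 \<le> a" "a \<le> b" "b \<le> c" "c \<le> 1"
    and 1: "\<exists>\<nu>. cyc2 (\<gamma> ` {a..b}) \<nu> \<and> (\<forall>y\<in>\<gamma> ` {a..b}. hlg2 {y} \<nu> (m y))"
    and 2: "\<exists>\<nu>. cyc2 (\<gamma> ` {b..c}) \<nu> \<and> (\<forall>y\<in>\<gamma> ` {b..c}. hlg2 {y} \<nu> (m y))"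
  obtain \<nu> where \<nu>: "cyc2 (\<gamma> ` {a..b}) \<nu>" "\<forall>y\<in>\<gamma> ` {a..b}. hlg2 {y} \<nu> (m y)"
    using 1 by (elim exE conjE)
  obtain \<nu>' where \<nu>': "cyc2 (\<gamma> ` {b..c}) \<nu>'" "\<forall>y\<in>\<gamma> ` {b..c}. hlg2 {y} \<nu>' (m y)"
    using 2 by (elim exE conjE)
  have "\<gamma> b \<in> \<gamma> ` {a..b}" "\<gamma> b \<in> \<gamma> ` {b..c}" using ab by auto
  then have "hlg2 {\<gamma> b} \<nu> \<nu>'"
    using homologous_rel_trans_sym[OF bspec[OF \<nu>(2)] bspec[OF \<nu>'(2)]] by simp
  then have "hlg2 (\<gamma> ` {a..b} \<inter> \<gamma> ` {b..c}) \<nu> \<nu>'" using arc_Int(1)[OF ab] by simp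
  moreover have "closedin X (\<gamma> ` {a..b})" "closedin X (\<gamma> ` {b..c})" using ab by (auto intro: closedin_arc)
  ultimately have "\<exists>z. cyc2 (\<gamma> ` {a..c}) z \<and> hlg2 (\<gamma> ` {a..b}) z \<nu> \<and> hlg2 (\<gamma> ` {b..c}) z \<nu>'"
    using cyc_glue[OF _ _ \<nu>(1) \<nu>'(1)] arc_Int(2)[OF ab] by simp
  then obtain z where z: "cyc2 (\<gamma> ` {a..c}) z" "hlg2 (\<gamma> ` {a..b}) z \<nu>" "hlg2 (\<gamma> ` {b..c}) z \<nu>'"
    by (elim exE conjE)
  have "hlg2 {y} z (m y)" if "y \<in> \<gamma> ` {a..c}" for y
  proof -
    have "y \<in> \<gamma> ` {a..b} \<or> y \<in> \<gamma> ` {b..c}" using that arc_Int(2)[OF ab] by blast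
    then show ?thesis
    proof
      assume "y \<in> \<gamma> ` {a..b}"
      then show ?thesis using homologous_rel_trans[OF bspec[OF \<nu>(2)] hlg_mono[OF z(2)]] by simp
    next
      assume "y \<in> \<gamma> ` {b..c}"
      then show ?thesis using homologous_rel_trans[OF bspec[OF \<nu>'(2)] hlg_mono[OF z(3)]] by simp
    qed
  qed
  then show "\<exists>\<nu>. cyc2 (\<gamma> ` {a..c}) \<nu> \<and> (\<forall>y\<in>\<gamma> ` {a..c}. hlg2 {y} \<nu> (m y))"
    using z(1) by blast
next
  fix x :: real assume x: "0 \<le> x" "x \<le> 1"
  then have "\<gamma> x \<in> topspace X" using arc_in_topspace by simp
  from local_consistency[OF this]
  obtain B n where B: "openin X B" "\<gamma> x \<in> B" "cyc2 B n" "\<forall>y\<in>B. hlg2 {y} n (m y)"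
    by (elim exE conjE)
  show "\<exists>N. openin X N \<and> \<gamma> x \<in> N \<and>
          (\<forall>a b. 0 \<le> a \<and> a \<le> x \<and> x \<le> b \<and> b \<le> 1 \<and> \<gamma> ` {a..b} \<subseteq> N \<longrightarrow>
      (\<exists>\<nu>. cyc2 (\<gamma> ` {a..b}) \<nu> \<and> (\<forall>y\<in>\<gamma> ` {a..b}. hlg2 {y} \<nu> (m y))))"
  proof (intro exI[of _ B] conjI allI impI B(1,2))
    fix a b assume ab: "0 \<le> a \<and> a \<le> x \<and> x \<le> b \<and> b \<le> 1 \<and> \<gamma> ` {a..b} \<subseteq> B"
    then have "cyc2 (\<gamma> ` {a..b}) n" using cyc_mono[OF B(3)] by blast
    then show "\<exists>\<nu>. cyc2 (\<gamma> ` {a..b}) \<nu> \<and> (\<forall>y\<in>\<gamma> ` {a..b}. hlg2 {y} \<nu> (m y))"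
      using B(4) ab by blast
  qed
qed (use assms in auto)

text \<open>The obstruction to combining two adjacent subarcs lies in H_2 at their common point,
  hence is a multiple of \<open>m (\<gamma> s)\<close>; that multiple extends over the second subarc
  by \<open>arc_class_exists\<close> and so maps to zero. Short subarcs are covered by
  \<open>H1_point\<close> and compact supports.\<close>

lemma H1_arc:
  assumes c: "cyc1 (\<gamma> ` {0..1}) c"
  shows "nul1 (\<gamma> ` {0..1}) c"
proof (rule arc_induct[where s = 0 and t = 1 and P = "\<lambda>s t. nul1 (\<gamma> ` {s..t}) c"])
  fix r s t :: real
  assume ab: "0 \<le> r" "r \<le> s" "s \<le> t" "t \<le> 1"
    and n1: "nul1 (\<gamma> ` {r..s}) c" and n2: "nul1 (\<gamma> ` {s..t}) c"
  let ?U = "topspace X - \<gamma> ` {r..s}" and ?V = "topspace X - \<gamma> ` {s..t}"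
  have UV: "?U \<union> ?V = topspace X - {\<gamma> s}" "?U \<inter> ?V = topspace X - \<gamma> ` {r..t}"
    using arc_Int[OF ab] by blast+
  have oU: "openin X ?U" "openin X ?V" using closedin_arc ab by auto
  obtain \<alpha> where \<alpha>: "cyc2 {\<gamma> s} \<alpha>" "connecting (Suc 0) X ?U ?V \<alpha> c"
    using connecting_exists[OF n1 n2] UV by auto
  have "0 \<le> s" "t \<le> 1" using ab by auto
  from arc_class_exists[OF this(1) ab(3) this(2)]
  obtain \<nu> where \<nu>: "cyc2 (\<gamma> ` {s..t}) \<nu>" "\<forall>y\<in>\<gamma> ` {s..t}. hlg2 {y} \<nu> (m y)"
    by (elim exE conjE)
  have "\<gamma> s \<in> topspace X" using arc_in_topspace ab by simp
  from local_generator[OF this \<alpha>(1)]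
  obtain k where k: "hlg2 {\<gamma> s} \<alpha> (frag_cmul k (m (\<gamma> s)))" ..
  have "hlg2 {\<gamma> s} \<nu> (m (\<gamma> s))" using \<nu>(2) ab by auto
  then have "hlg2 {\<gamma> s} (frag_cmul k \<nu>) (frag_cmul k (m (\<gamma> s)))"
    by (rule homologous_rel_cmul)
  from homologous_rel_trans_sym[OF k this] have "hlg2 {\<gamma> s} \<alpha> (0 + frag_cmul k \<nu>)"
    by simp
  then show "nul1 (\<gamma> ` {r..t}) c"
    using connecting_kernel[OF oU \<alpha>(2) singular_relcycle_0 singular_relcycle_cmul[OF \<nu>(1)]] UV by simp
next
  fix x :: real assume x: "0 \<le> x" "x \<le> 1"
  have "nul1 {\<gamma> x} c"
    by (rule H1_point) (use x arc_in_topspace cyc_mono[OF c] in auto)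
  from singular_relboundary_nbhd[OF hausdorff _ this]
  obtain N where N: "openin X N" "\<gamma> x \<in> N" "nul1 N c"
    using x arc_in_topspace by auto
  then show "\<exists>N. openin X N \<and> \<gamma> x \<in> N \<and>
          (\<forall>a b. 0 \<le> a \<and> a \<le> x \<and> x \<le> b \<and> b \<le> 1 \<and> \<gamma> ` {a..b} \<subseteq> N \<longrightarrow> nul1 (\<gamma> ` {a..b}) c)"
    by (intro exI[of _ N] conjI allI impI N(1,2)) (use nul_mono[OF N(3)] in simp)
qed auto

text \<open>Near each point of the arc the class equals a fixed multiple \<open>j\<close> of
  \<open>\<nu>\<close>, because vanishing of the difference spreads to a neighbourhood. So having
  the value \<open>k\<close> is a locally constant property along the arc.\<close>

lemma arc_constant:
  assumes \<beta>: "cyc2 (\<gamma> ` {0..1}) \<beta>"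
  shows "hlg2 {\<gamma> 0} \<beta> (frag_cmul k (m (\<gamma> 0))) \<longleftrightarrow> hlg2 {\<gamma> 1} \<beta> (frag_cmul k (m (\<gamma> 1)))"
proof -
  from arc_class_exists[OF order.refl zero_le_one order.refl]
  obtain \<nu> where \<nu>: "cyc2 (\<gamma> ` {0..1}) \<nu>" "\<forall>y\<in>\<gamma> ` {0..1}. hlg2 {y} \<nu> (m y)"
    by (elim exE conjE)
  define \<beta>' where "\<beta>' j = \<beta> - frag_cmul j \<nu>" for j
  have \<beta>': "cyc2 (\<gamma> ` {0..1}) (\<beta>' j)" for j
    unfolding \<beta>'_def using \<beta> \<nu>(1) by (intro singular_relcycle_diff singular_relcycle_cmul)
  have iff: "nul2 {\<gamma> t} (\<beta>' j) \<longleftrightarrow> hlg2 {\<gamma> t} \<beta> (frag_cmul j (m (\<gamma> t)))"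
    if "t \<in> {0..1}" for t j
  proof -
    have "hlg2 {\<gamma> t} (frag_cmul j \<nu>) (frag_cmul j (m (\<gamma> t)))"
      using homologous_rel_cmul[OF bspec[OF \<nu>(2)]] that by simp
    then have "hlg2 {\<gamma> t} \<beta> (frag_cmul j \<nu>) \<longleftrightarrow> hlg2 {\<gamma> t} \<beta> (frag_cmul j (m (\<gamma> t)))"
      using homologous_rel_trans homologous_rel_trans_sym by blast
    then show ?thesis unfolding \<beta>'_def homologous_rel_def .
  qed
  have "(0::real) \<le> 0" "(0::real) \<le> 1" "(1::real) \<le> 1" by auto
  then have "nul2 {\<gamma> 0} (\<beta>' k) \<longleftrightarrow> nul2 {\<gamma> 1} (\<beta>' k)"
  proof (rule arc_induct[where s = 0 and t = 1 and P = "\<lambda>s t. nul2 {\<gamma> s} (\<beta>' k) \<longleftrightarrow> nul2 {\<gamma> t} (\<beta>' k)"])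
    fix x :: real assume x: "0 \<le> x" "x \<le> 1"
    then have \<gamma>x: "\<gamma> x \<in> topspace X" using arc_in_topspace by simp
    have "cyc2 {\<gamma> x} \<beta>" using cyc_mono[OF \<beta>] x by simp
    from local_generator[OF \<gamma>x this]
    obtain j where "hlg2 {\<gamma> x} \<beta> (frag_cmul j (m (\<gamma> x)))" ..
    then have "nul2 {\<gamma> x} (\<beta>' j)" using iff x by simp
    from singular_relboundary_nbhd[OF hausdorff \<gamma>x this]
    obtain N where N: "openin X N" "\<gamma> x \<in> N" "nul2 N (\<beta>' j)" .
    have "nul2 {\<gamma> t} (\<beta>' k) \<longleftrightarrow> j = k" if "t \<in> {0..1}" "\<gamma> t \<in> N" for t
    proof -
      have "nul2 {\<gamma> t} (\<beta>' j)" using nul_mono[OF N(3)] that by simp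
      then show ?thesis
        using hlg_local_unique[of "\<gamma> t" \<beta> j k] iff[OF that(1)] arc_in_topspace[OF that(1)] by auto
    qed
    then have "nul2 {\<gamma> a} (\<beta>' k) \<longleftrightarrow> nul2 {\<gamma> b} (\<beta>' k)"
      if "0 \<le> a" "a \<le> x" "x \<le> b" "b \<le> 1" "\<gamma> ` {a..b} \<subseteq> N" for a b
      using that by (auto simp: image_subset_iff)
    then show "\<exists>N. openin X N \<and> \<gamma> x \<in> N \<and>
          (\<forall>a b. 0 \<le> a \<and> a \<le> x \<and> x \<le> b \<and> b \<le> 1 \<and> \<gamma> ` {a..b} \<subseteq> N \<longrightarrow>
            nul2 {\<gamma> a} (\<beta>' k) = nul2 {\<gamma> b} (\<beta>' k))"
      by (intro exI[of _ N] conjI allI impI N(1,2)) simp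
  qed auto
  then show ?thesis using iff by simp
qed

end

section \<open>Adding an edge to an embedded graph\<close>

definition reachable :: "'a set set \<Rightarrow> ('a \<times> 'a) set" where
  "reachable F = {(x, y). {x, y} \<in> F}\<^sup>*"

lemma reachable_edge: "{x, y} \<in> F \<Longrightarrow> (x, y) \<in> reachable F"
  unfolding reachable_def by blast

lemma reachable_sym: "(x, y) \<in> reachable F \<Longrightarrow> (y, x) \<in> reachable F"
  unfolding reachable_def
  by (rule symD[OF sym_rtrancl]) (auto simp: sym_def insert_commute)

lemma reachable_trans: "(x, y) \<in> reachable F \<Longrightarrow> (y, z) \<in> reachable F \<Longrightarrow> (x, z) \<in> reachable F"
  unfolding reachable_def by (rule rtrancl_trans)

locale embedded_graph = oriented_surface X m for X :: "'s topology" and m +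
  fixes V :: "'a set" and E :: "'a set set" and f :: "'a \<Rightarrow> 's" and \<gamma> :: "'a set \<Rightarrow> real \<Rightarrow> 's"
  assumes finite_graph: "finite_simple_graph V E" and embedding: "graph_embedding V E X f \<gamma>"
begin

lemma finite_V: "finite V" and finite_E: "finite E"
proof -
  show "finite V" using finite_graph by (simp add: finite_simple_graph_def)
  moreover have "E \<subseteq> Pow V" using finite_graph by (auto simp: finite_simple_graph_def)
  ultimately show "finite E" by (meson finite_Pow_iff finite_subset)
qed

lemma inj_f: "inj_on f V" and f_in: "v \<in> V \<Longrightarrow> f v \<in> topspace X"
  using embedding by (auto simp: graph_embedding_def)

lemma arc: "e \<in> E \<Longrightarrow> surface_arc X m (\<gamma> e)"
  using embedding oriented_surface_axioms
  by (auto simp: graph_embedding_def surface_arc_def surface_arc_axioms_def)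

text \<open>\<open>graph_embedding\<close> gives the end points of an arc only as a set; this
  records at which vertex the parametrisation starts.\<close>

definition ends :: "'a set \<Rightarrow> 'a \<Rightarrow> 'a \<Rightarrow> bool" where
  "ends e u v \<longleftrightarrow> u \<in> V \<and> v \<in> V \<and> u \<noteq> v \<and> e = {u, v} \<and> \<gamma> e 0 = f u \<and> \<gamma> e 1 = f v"

lemma ends_exists:
  assumes "e \<in> E" obtains u v where "ends e u v"
proof -
  obtain u v where uv: "u \<in> V" "v \<in> V" "u \<noteq> v" "e = {u, v}"
    using assms finite_graph unfolding finite_simple_graph_def by meson
  have "{\<gamma> e 0, \<gamma> e 1} = {f u, f v}"
    using assms embedding uv by (auto simp: graph_embedding_def)
  then have "ends e u v \<or> ends e v u"
    using uv by (auto simp: ends_def doubleton_eq_iff)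
  then show thesis using that by blast
qed

text \<open>All vertices belong to every drawing, also to that of the empty edge set. Hence a new
  edge meets the old drawing in exactly its two ends.\<close>

definition drawing :: "'a set set \<Rightarrow> 's set" where
  "drawing F = f ` V \<union> (\<Union>e\<in>F. \<gamma> e ` {0..1})"

lemma drawing_mono: "F \<subseteq> G \<Longrightarrow> drawing F \<subseteq> drawing G"
  by (auto simp: drawing_def)

lemma drawing_insert: "drawing (insert e F) = drawing F \<union> \<gamma> e ` {0..1}"
  by (auto simp: drawing_def)

lemma closedin_drawing: "F \<subseteq> E \<Longrightarrow> closedin X (drawing F)"
proof -
  assume F: "F \<subseteq> E"
  have "closedin X (f ` V)"
    using hausdorff finite_V f_in by (auto intro: closedin_Hausdorff_finite)
  moreover have "closedin X (\<Union>e\<in>F. \<gamma> e ` {0..1})"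
    using surface_arc.closedin_arc[OF arc, of _ 0 1] F finite_subset[OF F finite_E]
    by (intro closedin_Union) auto
  ultimately show ?thesis by (simp add: drawing_def closedin_Un)
qed

lemma open_arc_disjoint:
  assumes "F \<subseteq> E" "e \<in> E" "e \<notin> F" "t \<in> {0<..<1}"
  shows "\<gamma> e t \<notin> drawing F"
proof
  assume "\<gamma> e t \<in> drawing F"
  moreover have "\<gamma> e ` {0<..<1} \<inter> f ` V = {}"
    using embedding assms(2) by (simp add: graph_embedding_def)
  then have fV: "\<gamma> e t \<notin> f ` V"
    using assms(4) by blast
  ultimately obtain e' s where e': "e' \<in> F" "s \<in> {0..1}" "\<gamma> e t = \<gamma> e' s"
    by (auto simp: drawing_def)
  have "\<gamma> e' s \<in> f ` V \<or> s \<in> {0<..<1}"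
  proof (cases "s = 0 \<or> s = 1")
    case True
    obtain u v where "ends e' u v" using ends_exists e' assms by blast
    then show ?thesis using True by (auto simp: ends_def)
  qed (use e' in auto)
  moreover have "\<gamma> e' ` {0<..<1} \<inter> \<gamma> e ` {0<..<1} = {}"
    using embedding e' assms unfolding graph_embedding_def by (metis subsetD)
  ultimately show False
    using e'(3) assms fV by force
qed

lemma drawing_Int_arc:
  assumes "F \<subseteq> E" "e \<in> E" "e \<notin> F" "ends e u v"
  shows "drawing F \<inter> \<gamma> e ` {0..1} = {f u, f v}"
proof
  show "{f u, f v} \<subseteq> drawing F \<inter> \<gamma> e ` {0..1}"
  proof -
    have "\<gamma> e 0 \<in> \<gamma> e ` {0..1}" "\<gamma> e 1 \<in> \<gamma> e ` {0..1}" by simp_all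
    moreover have "u \<in> V" "v \<in> V" "\<gamma> e 0 = f u" "\<gamma> e 1 = f v" using assms(4) unfolding ends_def by blast+
    ultimately show ?thesis by (simp add: drawing_def)
  qed
  show "drawing F \<inter> \<gamma> e ` {0..1} \<subseteq> {f u, f v}"
  proof
    fix z assume z: "z \<in> drawing F \<inter> \<gamma> e ` {0..1}"
    then obtain t where t: "t \<in> {0..1}" "z = \<gamma> e t" by blast
    then have "t = 0 \<or> t = 1"
      using open_arc_disjoint[OF assms(1-3), of t] z by force
    then show "z \<in> {f u, f v}" using t assms(4) by (auto simp: ends_def)
  qed
qed

text \<open>The H^0 side of the duality: start with the prescribed values at the vertices and glue,
  edge by edge, the multiple \<open>\<kappa> u\<close> of the arc class. Both ends require the same
  multiple because \<open>\<kappa>\<close> is constant on edges.\<close>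

lemma drawing_class:
  assumes "F \<subseteq> E" "\<And>x y. {x, y} \<in> F \<Longrightarrow> \<kappa> x = \<kappa> y"
  shows "\<exists>\<beta>. cyc2 (drawing F) \<beta> \<and> (\<forall>v\<in>V. hlg2 {f v} \<beta> (frag_cmul (\<kappa> v) (m (f v))))"
  using finite_subset[OF assms(1) finite_E] assms
proof (induction F)
  case empty
  have fV: "finite (f ` V)" "f ` V \<subseteq> topspace X" using finite_V f_in by auto
  from cyc_finite_exists[OF fV, of "\<lambda>x. \<kappa> (inv_into V f x)"]
  obtain c where c: "cyc2 (f ` V) c"
    "\<forall>x \<in> f ` V. hlg2 {x} c (frag_cmul (\<kappa> (inv_into V f x)) (m x))"
    by (elim exE conjE)
  have "hlg2 {f v} c (frag_cmul (\<kappa> v) (m (f v)))" if "v \<in> V" for v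
    using bspec[OF c(2), of "f v"] that inv_into_f_f[OF inj_f that] by simp
  then have "\<forall>v\<in>V. hlg2 {f v} c (frag_cmul (\<kappa> v) (m (f v)))" by (rule ballI)
  then show ?case using c(1) by (intro exI[of _ c] conjI) (simp_all add: drawing_def)
next
  case (insert e F)
  have F: "F \<subseteq> E" and e: "e \<in> E" using insert.prems by auto
  have "\<exists>\<beta>. cyc2 (drawing F) \<beta> \<and> (\<forall>v\<in>V. hlg2 {f v} \<beta> (frag_cmul (\<kappa> v) (m (f v))))"
    by (rule insert.IH[OF F]) (simp add: insert.prems(2))
  then obtain \<beta> where \<beta>: "cyc2 (drawing F) \<beta>" "\<forall>v\<in>V. hlg2 {f v} \<beta> (frag_cmul (\<kappa> v) (m (f v)))"
    by (elim exE conjE)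
  obtain u v where uv: "ends e u v" using ends_exists e by blast
  interpret a: surface_arc X m "\<gamma> e" using arc e by blast
  from a.arc_class_exists[OF order.refl zero_le_one order.refl]
  obtain \<nu> where \<nu>: "cyc2 (\<gamma> e ` {0..1}) \<nu>" "\<forall>y\<in>\<gamma> e ` {0..1}. hlg2 {y} \<nu> (m y)"
    by (elim exE conjE)
  have int: "drawing F \<inter> \<gamma> e ` {0..1} = {f u, f v}"
    by (rule drawing_Int_arc) (use F e insert uv in auto)
  have \<kappa>: "\<kappa> v = \<kappa> u" using insert.prems(2)[of u v] uv by (auto simp: ends_def)
  let ?\<nu> = "frag_cmul (\<kappa> u) \<nu>"
  have \<nu>': "cyc2 (\<gamma> e ` {0..1}) ?\<nu>" using \<nu>(1) by (rule singular_relcycle_cmul)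
  have "hlg2 (drawing F \<inter> \<gamma> e ` {0..1}) \<beta> ?\<nu>"
    unfolding int
  proof (rule hlg_finite)
    show "{f u, f v} \<subseteq> topspace X" using uv f_in by (auto simp: ends_def)
    show "cyc2 {f u, f v} \<beta>" by (rule cyc_mono[OF \<beta>(1)]) (use int in blast)
    show "cyc2 {f u, f v} ?\<nu>" by (rule cyc_mono[OF \<nu>']) (use int in blast)
    fix x assume x: "x \<in> {f u, f v}"
    have "u \<in> V" "v \<in> V" using uv unfolding ends_def by blast+
    then have "hlg2 {x} \<beta> (frag_cmul (\<kappa> u) (m x))"
      using x bspec[OF \<beta>(2), of u] bspec[OF \<beta>(2), of v] \<kappa> by (elim insertE emptyE) simp_all
    moreover have "hlg2 {x} \<nu> (m x)"
      by (rule bspec[OF \<nu>(2)]) (use x int in blast)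
    from homologous_rel_trans_sym[OF calculation homologous_rel_cmul[OF this]]
    show "hlg2 {x} \<beta> ?\<nu>" .
  qed simp
  from cyc_glue[OF closedin_drawing[OF F] a.closedin_arc[of 0 1, OF order.refl order.refl] \<beta>(1) \<nu>' this]
  obtain z where z: "cyc2 (drawing F \<union> \<gamma> e ` {0..1}) z" "hlg2 (drawing F) z \<beta>"
    by (elim exE conjE)
  have "hlg2 {f w} z (frag_cmul (\<kappa> w) (m (f w)))" if "w \<in> V" for w
  proof -
    have "hlg2 {f w} z \<beta>"
      by (rule hlg_mono[OF z(2)]) (use that in \<open>auto simp: drawing_def\<close>)
    then show ?thesis by (rule homologous_rel_trans[OF bspec[OF \<beta>(2) that]])
  qed
  then have "\<forall>v\<in>V. hlg2 {f v} z (frag_cmul (\<kappa> v) (m (f v)))" by (rule ballI)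
  then show ?case using z(1) by (intro exI[of _ z] conjI) (simp_all add: drawing_insert)
qed

text \<open>A class has one value along each arc by \<open>arc_constant\<close>, hence along each
  walk in \<open>F\<close>.\<close>

lemma drawing_constant:
  assumes F: "F \<subseteq> E" and \<beta>: "cyc2 (drawing F) \<beta>" and xy: "(x, y) \<in> reachable F"
    and "hlg2 {f x} \<beta> (frag_cmul k (m (f x)))"
  shows "hlg2 {f y} \<beta> (frag_cmul k (m (f y)))"
  using xy assms(4) unfolding reachable_def
proof (induction rule: rtrancl_induct)
  case (step y z)
  then have e: "{y, z} \<in> F" by simp
  obtain u v where uv: "ends {y, z} u v" using ends_exists e F by blast
  interpret a: surface_arc X m "\<gamma> {y, z}" using arc e F by blast
  have "cyc2 (\<gamma> {y, z} ` {0..1}) \<beta>"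
    by (rule cyc_mono[OF \<beta>]) (use e in \<open>auto simp: drawing_def\<close>)
  moreover have "\<gamma> {y, z} 0 = f u" "\<gamma> {y, z} 1 = f v"
    using uv unfolding ends_def by blast+
  ultimately have "hlg2 {f u} \<beta> (frag_cmul k (m (f u))) \<longleftrightarrow> hlg2 {f v} \<beta> (frag_cmul k (m (f v)))"
    using a.arc_constant[of \<beta> k] by simp
  moreover have "{y, z} = {u, v}" using uv unfolding ends_def by blast
  then have "u = y \<and> v = z \<or> u = z \<and> v = y"
    by (auto simp: doubleton_eq_iff)
  moreover have "hlg2 {f y} \<beta> (frag_cmul k (m (f y)))" by (rule step.IH[OF step.prems])
  ultimately show ?case by (elim disjE conjE) simp_all
qed

abbreviation connected_off :: "'a set set \<Rightarrow> 's \<Rightarrow> 's \<Rightarrow> bool" where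
  "connected_off F \<equiv> path_component_of (subtopology X (topspace X - drawing F))"

context
  fixes F e u v
  assumes F: "F \<subseteq> E" and e: "e \<in> E" "e \<notin> F" and uv: "ends e u v"
begin

text \<open>The Mayer-Vietoris pair for adding \<open>e\<close>: the obstruction group H_2(X, X - {f
  u, f v}) consists of pairs of integers, one for each end.\<close>

lemma off_insert:
  "(topspace X - drawing F) \<union> (topspace X - \<gamma> e ` {0..1}) = topspace X - {f u, f v}"
  "(topspace X - drawing F) \<inter> (topspace X - \<gamma> e ` {0..1}) = topspace X - drawing (insert e F)"
  unfolding drawing_insert drawing_Int_arc[OF F e uv, symmetric] by blast+

lemma open_off: "openin X (topspace X - drawing F)" "openin X (topspace X - \<gamma> e ` {0..1})"
  using closedin_drawing[OF F] surface_arc.closedin_arc[OF arc[OF e(1)], of 0 1] by auto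

lemma ends_in: "f u \<in> topspace X" "f v \<in> topspace X" "{f u, f v} \<subseteq> topspace X" "f u \<noteq> f v"
  using uv f_in inj_f by (auto simp: ends_def inj_on_eq_iff)

lemma arc_ends: "\<gamma> e 0 = f u" "\<gamma> e 1 = f v" "u \<in> V" "v \<in> V"
  using uv unfolding ends_def by blast+

lemma ends_in_both: "f u \<in> drawing F \<inter> \<gamma> e ` {0..1}" "f v \<in> drawing F \<inter> \<gamma> e ` {0..1}"
  unfolding drawing_Int_arc[OF F e uv] by simp_all

text \<open>The pair \<open>(i, j)\<close> is \<open>(j, j) + (i - j, 0)\<close>. The arc
  contributes the first summand, since its class is constant, and the drawing of \<open>F\<close>
  the second through \<open>\<beta>\<close>; so the connecting map kills the pair.\<close>

lemma connecting_ends_nul: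
  assumes c: "connecting (Suc 0) X (topspace X - drawing F) (topspace X - \<gamma> e ` {0..1}) \<alpha> c"
    and \<alpha>: "cyc2 {f u, f v} \<alpha>"
    and i: "hlg2 {f u} \<alpha> (frag_cmul i (m (f u)))"
    and j: "hlg2 {f v} \<alpha> (frag_cmul j (m (f v)))"
    and \<beta>: "cyc2 (drawing F) \<beta>"
    and \<beta>u: "hlg2 {f u} \<beta> (frag_cmul (i - j) (m (f u)))"
    and \<beta>v: "hlg2 {f v} \<beta> (frag_cmul 0 (m (f v)))"
  shows "nul1 (drawing (insert e F)) c"
proof -
  interpret a: surface_arc X m "\<gamma> e" using arc e by blast
  from a.arc_class_exists[OF order.refl zero_le_one order.refl]
  obtain \<nu> where \<nu>: "cyc2 (\<gamma> e ` {0..1}) \<nu>" "\<forall>y\<in>\<gamma> e ` {0..1}. hlg2 {y} \<nu> (m y)"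
    by (elim exE conjE)
  have ends: "f u \<in> \<gamma> e ` {0..1}" "f v \<in> \<gamma> e ` {0..1}" "f u \<in> drawing F" "f v \<in> drawing F"
    using ends_in_both by blast+
  have \<nu>': "cyc2 (\<gamma> e ` {0..1}) (frag_cmul j \<nu>)" using \<nu>(1) by (rule singular_relcycle_cmul)
  have "hlg2 {f u, f v} \<alpha> (\<beta> + frag_cmul j \<nu>)"
  proof (rule hlg_finite)
    show "{f u, f v} \<subseteq> topspace X" using ends_in by simp
    show "cyc2 {f u, f v} (\<beta> + frag_cmul j \<nu>)"
      using cyc_mono[OF \<beta>, of "{f u, f v}"] cyc_mono[OF \<nu>', of "{f u, f v}"] ends
      by (simp add: singular_relcycle_add)
    fix x assume x: "x \<in> {f u, f v}"
    have "hlg2 {f u} (\<beta> + frag_cmul j \<nu>) (frag_cmul (i - j) (m (f u)) + frag_cmul j (m (f u)))"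
      by (intro homologous_rel_add \<beta>u homologous_rel_cmul bspec[OF \<nu>(2)] ends)
    then have 1: "hlg2 {f u} (\<beta> + frag_cmul j \<nu>) (frag_cmul i (m (f u)))"
      by (simp flip: frag_cmul_distrib)
    have "hlg2 {f v} (\<beta> + frag_cmul j \<nu>) (frag_cmul 0 (m (f v)) + frag_cmul j (m (f v)))"
      by (intro homologous_rel_add \<beta>v homologous_rel_cmul bspec[OF \<nu>(2)] ends)
    then have 2: "hlg2 {f v} (\<beta> + frag_cmul j \<nu>) (frag_cmul j (m (f v)))"
      by simp
    show "hlg2 {x} \<alpha> (\<beta> + frag_cmul j \<nu>)"
      using x homologous_rel_trans_sym[OF i 1] homologous_rel_trans_sym[OF j 2] by auto
  qed (use \<alpha> in auto)
  then show ?thesis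
    using connecting_kernel[OF open_off c \<beta> \<nu>'] off_insert by simp
qed

lemma connecting_ends_nul_eq:
  assumes c: "connecting (Suc 0) X (topspace X - drawing F) (topspace X - \<gamma> e ` {0..1}) \<alpha> c"
    and \<alpha>: "cyc2 {f u, f v} \<alpha>"
    and i: "hlg2 {f u} \<alpha> (frag_cmul i (m (f u)))"
    and j: "hlg2 {f v} \<alpha> (frag_cmul i (m (f v)))"
  shows "nul1 (drawing (insert e F)) c"
  by (rule connecting_ends_nul[OF c \<alpha> i j singular_relcycle_0]) auto

text \<open>A chain from \<open>y\<close> to \<open>x\<close> off the drawing of \<open>F\<close> is
  null on that drawing, and null on the arc by \<open>H1_arc\<close>. Comparing the two reasons
  yields a pair \<open>(i, j)\<close> at the ends, and \<open>i - j\<close> is what may prevent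
  joining the points off the larger drawing.\<close>

lemma connected_off_connecting:
  assumes "connected_off F y x" "x \<notin> drawing (insert e F)" "y \<notin> drawing (insert e F)"
  obtains \<sigma> \<alpha> i j where
    "chain_boundary (Suc 0) \<sigma> = frag_of (point_simplex x) - frag_of (point_simplex y)"
    "connecting (Suc 0) X (topspace X - drawing F) (topspace X - \<gamma> e ` {0..1}) \<alpha> \<sigma>"
    "cyc2 {f u, f v} \<alpha>"
    "hlg2 {f u} \<alpha> (frag_cmul i (m (f u)))"
    "hlg2 {f v} \<alpha> (frag_cmul j (m (f v)))"
proof -
  interpret a: surface_arc X m "\<gamma> e" using arc e by blast
  obtain \<sigma> where \<sigma>: "singular_chain (Suc 0) (subtopology X (topspace X - drawing F)) \<sigma>"
    "chain_boundary (Suc 0) \<sigma> = frag_of (point_simplex x) - frag_of (point_simplex y)"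
    using path_component_of_chain[OF assms(1)] .
  have xy: "x \<in> topspace X" "y \<in> topspace X"
    using iffD1[OF path_component_of_equiv assms(1)] by simp_all
  have \<sigma>X: "singular_chain (Suc 0) X \<sigma>" using \<sigma>(1) singular_chain_subtopology by blast
  have "singular_chain 0 (subtopology X (topspace X - \<gamma> e ` {0..1})) (frag_of (point_simplex x) - frag_of (point_simplex y))"
    using xy assms(2,3) by (auto simp: drawing_insert singular_chain_of intro!: singular_chain_diff singular_simplex_point)
  then have "cyc1 (\<gamma> e ` {0..1}) \<sigma>"
    using \<sigma>X \<sigma>(2) by (simp add: singular_relcycle)
  then have "nul1 (\<gamma> e ` {0..1}) \<sigma>" by (rule a.H1_arc)
  from connecting_exists[OF singular_chain_imp_relboundary[OF \<sigma>(1)] this]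
  obtain \<alpha> where \<alpha>: "cyc2 {f u, f v} \<alpha>"
    "connecting (Suc 0) X (topspace X - drawing F) (topspace X - \<gamma> e ` {0..1}) \<alpha> \<sigma>"
    unfolding off_insert .
  have \<alpha>': "cyc2 {f u} \<alpha>" "cyc2 {f v} \<alpha>"
    by (auto intro: cyc_mono[OF \<alpha>(1)])
  from local_generator[OF ends_in(1) \<alpha>'(1)] obtain i where i: "hlg2 {f u} \<alpha> (frag_cmul i (m (f u)))" ..
  from local_generator[OF ends_in(2) \<alpha>'(2)] obtain j where j: "hlg2 {f v} \<alpha> (frag_cmul j (m (f v)))" ..
  show thesis using that[OF \<sigma>(2) \<alpha>(2,1) i j] .
qed

lemma nul_imp_connected_off:
  assumes "nul1 (drawing F') \<sigma>" "x \<in> topspace X - drawing F'" "y \<in> topspace X - drawing F'"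
    "chain_boundary (Suc 0) \<sigma> = frag_of (point_simplex x) - frag_of (point_simplex y)"
  shows "connected_off F' x y"
  by (rule relboundary_imp_path_component_of[OF assms(1-3) _ assms(4)]) blast

lemma connected_off_imp_in: "connected_off F' x y \<Longrightarrow> x \<in> topspace X" "connected_off F' x y \<Longrightarrow> y \<in> topspace X"
  using iffD1[OF path_component_of_equiv, of "subtopology X (topspace X - drawing F')" x y] by simp_all

text \<open>The ends lie in different components of \<open>F\<close>, so a class on the drawing may
  take the value \<open>i - j\<close> at \<open>u\<close> and 0 at \<open>v\<close>, which removes
  the obstruction.\<close>

lemma connected_off_insert_bridge:
  assumes nr: "(u, v) \<notin> reachable F" and con: "connected_off F y x"
    and off: "x \<notin> drawing (insert e F)" "y \<notin> drawing (insert e F)"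
  shows "connected_off (insert e F) x y"
proof -
  obtain \<sigma> \<alpha> i j where \<sigma>:
    "chain_boundary (Suc 0) \<sigma> = frag_of (point_simplex x) - frag_of (point_simplex y)"
    "connecting (Suc 0) X (topspace X - drawing F) (topspace X - \<gamma> e ` {0..1}) \<alpha> \<sigma>"
    "cyc2 {f u, f v} \<alpha>"
    "hlg2 {f u} \<alpha> (frag_cmul i (m (f u)))"
    "hlg2 {f v} \<alpha> (frag_cmul j (m (f v)))"
    using connected_off_connecting[OF con off] .
  define \<kappa> where "\<kappa> w = (if (u, w) \<in> reachable F then i - j else 0)" for w
  have \<kappa>F: "\<kappa> p = \<kappa> q" if "{p, q} \<in> F" for p q
  proof -
    have "(u, p) \<in> reachable F \<longleftrightarrow> (u, q) \<in> reachable F"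
      using reachable_trans[OF _ reachable_edge[OF that], of u]
        reachable_trans[OF _ reachable_sym[OF reachable_edge[OF that]], of u] by iprover
    then show ?thesis by (simp add: \<kappa>_def)
  qed
  have "\<exists>\<beta>. cyc2 (drawing F) \<beta> \<and>
     (\<forall>v\<in>V. hlg2 {f v} \<beta> (frag_cmul (\<kappa> v) (m (f v))))"
    by (rule drawing_class[OF F]) (rule \<kappa>F)
  then obtain \<beta> where \<beta>: "cyc2 (drawing F) \<beta>"
     "\<forall>v\<in>V. hlg2 {f v} \<beta> (frag_cmul (\<kappa> v) (m (f v)))"
    by (elim exE conjE)
  have \<kappa>: "\<kappa> u = i - j" "\<kappa> v = 0" using nr by (auto simp: \<kappa>_def reachable_def)
  have "nul1 (drawing (insert e F)) \<sigma>"
    by (rule connecting_ends_nul[OF \<sigma>(2-5) \<beta>(1)])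
      (use bspec[OF \<beta>(2), of u] bspec[OF \<beta>(2), of v] \<kappa> arc_ends in simp_all)
  then show ?thesis
    using nul_imp_connected_off[OF _ _ _ \<sigma>(1)] off connected_off_imp_in[OF con] by simp
qed

text \<open>The obstructions \<open>p\<close> and \<open>p'\<close> of two chains are single
  integers, hence proportional, and \<open>p'\<close> times \<open>\<sigma>\<close> minus
  \<open>p\<close> times \<open>\<tau>\<close> has none. If the three points lay in three faces, its
  coefficients would vanish; but \<open>p = 0\<close> means that \<open>\<sigma>\<close> joins two
  of them.\<close>

lemma connected_off_insert_two_sides:
  assumes con: "connected_off F z x" "connected_off F z y"
    and off: "x \<notin> drawing (insert e F)" "y \<notin> drawing (insert e F)" "z \<notin> drawing (insert e F)"
  shows "connected_off (insert e F) x y \<or> connected_off (insert e F) x z \<or> connected_off (insert e F) y z"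
proof (rule ccontr)
  assume neg: "\<not> ?thesis"
  have inX: "x \<in> topspace X" "y \<in> topspace X" "z \<in> topspace X"
    using con connected_off_imp_in by blast+
  obtain \<sigma> \<alpha> i j where \<sigma>:
    "chain_boundary (Suc 0) \<sigma> = frag_of (point_simplex x) - frag_of (point_simplex z)"
    "connecting (Suc 0) X (topspace X - drawing F) (topspace X - \<gamma> e ` {0..1}) \<alpha> \<sigma>"
    "cyc2 {f u, f v} \<alpha>"
    "hlg2 {f u} \<alpha> (frag_cmul i (m (f u)))"
    "hlg2 {f v} \<alpha> (frag_cmul j (m (f v)))"
    using connected_off_connecting[OF con(1) off(1,3)] .
  obtain \<tau> \<alpha>' i' j' where \<tau>:
    "chain_boundary (Suc 0) \<tau> = frag_of (point_simplex y) - frag_of (point_simplex z)"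
    "connecting (Suc 0) X (topspace X - drawing F) (topspace X - \<gamma> e ` {0..1}) \<alpha>' \<tau>"
    "cyc2 {f u, f v} \<alpha>'"
    "hlg2 {f u} \<alpha>' (frag_cmul i' (m (f u)))"
    "hlg2 {f v} \<alpha>' (frag_cmul j' (m (f v)))"
    using connected_off_connecting[OF con(2) off(2,3)] .
  define p where "p = i - j"
  define p' where "p' = i' - j'"
  let ?a = "frag_cmul p' \<alpha> - frag_cmul p \<alpha>'"
  have "p' * i - p * i' = p' * j - p * j'" unfolding p_def p'_def by (simp add: algebra_simps)
  moreover have "hlg2 {f u} ?a (frag_cmul p' (frag_cmul i (m (f u))) - frag_cmul p (frag_cmul i' (m (f u))))"
    "hlg2 {f v} ?a (frag_cmul p' (frag_cmul j (m (f v))) - frag_cmul p (frag_cmul j' (m (f v))))"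
    by (intro homologous_rel_diff homologous_rel_cmul \<sigma> \<tau>)+
  ultimately have "hlg2 {f u} ?a (frag_cmul (p' * i - p * i') (m (f u)))"
     "hlg2 {f v} ?a (frag_cmul (p' * i - p * i') (m (f v)))"
    by (auto simp flip: frag_cmul_diff_distrib)
  moreover have "connecting (Suc 0) X (topspace X - drawing F) (topspace X - \<gamma> e ` {0..1}) ?a (frag_cmul p' \<sigma> - frag_cmul p \<tau>)"
    by (intro connecting_diff connecting_cmul \<sigma> \<tau>)
  moreover have "cyc2 {f u, f v} ?a"
    by (intro singular_relcycle_diff singular_relcycle_cmul \<sigma> \<tau>)
  ultimately have "nul1 (drawing (insert e F)) (frag_cmul p' \<sigma> - frag_cmul p \<tau>)"
    using connecting_ends_nul_eq[of ?a "frag_cmul p' \<sigma> - frag_cmul p \<tau>" "p' * i - p * i'"] by simp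
  from relboundary_imp_coefficients_0[OF this _ _ _ _ \<sigma>(1) \<tau>(1)]
  have "p' = 0 \<and> p = 0" using off inX neg by auto
  then have "nul1 (drawing (insert e F)) \<sigma>"
    using connecting_ends_nul_eq[OF \<sigma>(2-4)] \<sigma>(5) by (simp add: p_def)
  then have "connected_off (insert e F) x z"
    using nul_imp_connected_off[OF _ _ _ \<sigma>(1)] off inX by simp
  then show False using neg by blast
qed

text \<open>The classes \<open>w\<close> of the edges that separate nothing are independent in \<open>H\<^sub>1(X)\<close>,
  since each vanishes off the drawing of the earlier edges.\<close>

lemma connected_off_insert_cycle:
  assumes re: "(u, v) \<in> reachable F"
    and nosep: "\<And>x y. \<lbrakk>x \<notin> drawing (insert e F); y \<notin> drawing (insert e F); connected_off F x y\<rbrakk>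
          \<Longrightarrow> connected_off (insert e F) x y"
  obtains w where "singular_relcycle (Suc 0) X {} w" "nul1 (drawing F) w"
    "\<And>k. nul1 (drawing (insert e F)) (frag_cmul k w) \<Longrightarrow> k = 0"
proof -
  interpret a: surface_arc X m "\<gamma> e" using arc e by blast
  let ?U = "topspace X - drawing F" and ?V = "topspace X - \<gamma> e ` {0..1}"
  have UV: "?V \<union> ?U = topspace X - {f u, f v}" "?V \<inter> ?U = topspace X - drawing (insert e F)"
    using off_insert by blast+
  \<comment> \<open>The values 1 at \<open>f u\<close> and 0 at \<open>f v\<close> are chosen
    because every class on the arc, and by \<open>re\<close> every class on the drawing of
    \<open>F\<close>, has equal values at the two ends.\<close>
  have "finite {f u, f v}" by simp
  from cyc_finite_exists[OF this ends_in(3), of "\<lambda>x. if x = f u then 1 else 0"]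
  obtain \<alpha> where \<alpha>: "cyc2 {f u, f v} \<alpha>"
    and \<alpha>1: "\<forall>x\<in>{f u, f v}. hlg2 {x} \<alpha> (frag_cmul (if x = f u then 1 else 0) (m x))"
    by (elim exE conjE)
  have \<alpha>uv: "hlg2 {f u} \<alpha> (frag_cmul 1 (m (f u)))" "hlg2 {f v} \<alpha> (frag_cmul 0 (m (f v)))"
    using bspec[OF \<alpha>1, of "f u"] bspec[OF \<alpha>1, of "f v"] ends_in(4) by simp_all
  \<comment> \<open>The complement of the drawing stands second, so that \<open>c\<close> is
    obtained off the drawing of \<open>F\<close>.\<close>
  obtain \<alpha>' c where \<alpha>': "hlg2 {f u, f v} \<alpha>' \<alpha>" and con: "connecting (Suc 0) X ?V ?U \<alpha>' c"
    and c: "singular_chain (Suc 0) (subtopology X ?U) c" "singular_relcycle (Suc 0) X (?V \<inter> ?U) c"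
    by (rule connecting_surj[OF open_off(2,1), of "Suc 0" \<alpha>]) (use \<alpha> in \<open>simp_all add: UV(1)\<close>)
  have \<alpha>'u: "hlg2 {f u} \<alpha>' (frag_cmul 1 (m (f u)))"
    by (rule homologous_rel_trans[OF \<alpha>uv(1) hlg_mono[OF \<alpha>']]) simp
  have \<alpha>'v: "hlg2 {f v} \<alpha>' (frag_cmul 0 (m (f v)))"
    by (rule homologous_rel_trans[OF \<alpha>uv(2) hlg_mono[OF \<alpha>']]) simp
  have bc: "singular_chain 0 (subtopology X (?V \<inter> ?U)) (chain_boundary (Suc 0) c)"
    using c(2) by (simp add: singular_relcycle)
  obtain t where t: "singular_chain (Suc 0) (subtopology X (?V \<inter> ?U)) t"
    "chain_boundary (Suc 0) t = chain_boundary (Suc 0) c"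
  proof (rule chain_boundary_transfer[OF _ _ _ c(1) bc])
    fix x y assume "x \<in> ?V \<inter> ?U" "y \<in> ?V \<inter> ?U" "connected_off F x y"
    then show "path_component_of (subtopology X (?V \<inter> ?U)) x y"
      using nosep[of x y] unfolding UV by blast
  qed auto
  \<comment> \<open>By \<open>nosep\<close> the boundary of \<open>c\<close> is filled by a chain
    \<open>t\<close> off the larger drawing; the difference is an absolute cycle, homologous to
    \<open>c\<close> relative to that complement.\<close>
  define w where "w = c - t"
  have tU: "singular_chain (Suc 0) (subtopology X ?U) t" using t(1) singular_chain_mono by blast
  have wU: "singular_chain (Suc 0) (subtopology X ?U) w"
    unfolding w_def using c(1) tU by (rule singular_chain_diff)
  show thesis
  proof
    show "singular_relcycle (Suc 0) X {} w"
      using wU t(2) by (auto simp: singular_cycle w_def chain_boundary_diff singular_chain_subtopology)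
    show "nul1 (drawing F) w" using wU by (rule singular_chain_imp_relboundary)
    fix k assume "nul1 (drawing (insert e F)) (frag_cmul k w)"
    moreover have "nul1 (drawing (insert e F)) (frag_cmul k t)"
      using t(1) unfolding UV by (intro singular_chain_imp_relboundary singular_chain_cmul)
    ultimately have "singular_relboundary (Suc 0) X (?V \<inter> ?U) (frag_cmul k w + frag_cmul k t)"
      unfolding UV by (rule singular_relboundary_add)
    then have "singular_relboundary (Suc 0) X (?V \<inter> ?U) (frag_cmul k c)"
      by (simp add: w_def flip: frag_cmul_distrib2)
    from connecting_relboundary[OF connecting_cmul[OF con] this]
    obtain b g where b: "cyc2 (\<gamma> e ` {0..1}) b" and g: "cyc2 (drawing F) g"
      and bg: "frag_cmul k \<alpha>' = b + g" .
    have ends: "f u \<in> \<gamma> e ` {0..1}" "f v \<in> \<gamma> e ` {0..1}" "f u \<in> drawing F" "f v \<in> drawing F"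
      using ends_in_both by blast+
    have "cyc2 {f u} b" "cyc2 {f u} g"
      using cyc_mono[OF b] cyc_mono[OF g] ends by auto
    from local_generator[OF ends_in(1) this(1)] local_generator[OF ends_in(1) this(2)]
    obtain i j where i: "hlg2 {f u} b (frag_cmul i (m (f u)))"
      and j: "hlg2 {f u} g (frag_cmul j (m (f u)))" by (elim exE)
    have i': "hlg2 {f v} b (frag_cmul i (m (f v)))"
      using a.arc_constant[OF b, of i] i by (simp add: arc_ends)
    have j': "hlg2 {f v} g (frag_cmul j (m (f v)))"
      by (rule drawing_constant[OF F g re j])
    have 1: "hlg2 {f u} (frag_cmul k \<alpha>') (frag_cmul (i + j) (m (f u)))"
      unfolding bg frag_cmul_distrib by (intro homologous_rel_add i j)
    have 2: "hlg2 {f v} (frag_cmul k \<alpha>') (frag_cmul (i + j) (m (f v)))"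
      unfolding bg frag_cmul_distrib by (intro homologous_rel_add i' j')
    \<comment> \<open>\<open>k\<close> times the pair (1, 0) would be a sum of two constant
      pairs.\<close>
    have "k = i + j"
      using hlg_local_unique[OF ends_in(1) _ 1] homologous_rel_cmul[OF \<alpha>'u, of k] by simp
    moreover have "0 = i + j"
      by (rule hlg_local_unique[OF ends_in(2) _ 2]) (use homologous_rel_cmul[OF \<alpha>'v, of k] in simp)
    ultimately show "k = 0" by simp
  qed
qed

end

end

section \<open>Faces of an embedded graph\<close>

text \<open>Built by edges that join different components, which is the situation of
  \<open>connected_off_insert_bridge\<close>.\<close>

inductive forest :: "'a set set \<Rightarrow> bool" where
  forest_empty: "forest {}"
| forest_insert: "forest F \<Longrightarrow> (u, v) \<notin> reachable F \<Longrightarrow> forest (insert {u, v} F)"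

lemma reachable_invariant:
  assumes "(x, y) \<in> reachable F" "\<And>p q. {p, q} \<in> F \<Longrightarrow> L p = L q"
  shows "L x = L y"
  using assms(1) unfolding reachable_def
  by (induction rule: rtrancl_induct) (use assms(2) in auto)

lemma reachable_mono: "F \<subseteq> G \<Longrightarrow> reachable F \<subseteq> reachable G"
  unfolding reachable_def by (rule rtrancl_mono) blast

lemma closure_of_meets_open:
  "q \<in> X closure_of S \<Longrightarrow> openin X T \<Longrightarrow> q \<in> T \<Longrightarrow> \<exists>y. y \<in> S \<and> y \<in> T"
  by (auto simp: in_closure_of)

context embedded_graph
begin

section \<open>Faces as path components off the drawing\<close>

lemma connected_off_antimono:
  "connected_off G x y \<Longrightarrow> F \<subseteq> G \<Longrightarrow> connected_off F x y"
  by (erule path_component_of_mono) (use drawing_mono in blast)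

lemma connected_off_D:
  assumes "connected_off F x y"
  shows "x \<in> topspace X" "y \<in> topspace X" "x \<notin> drawing F" "y \<notin> drawing F"
  using path_component_in_topspace[OF assms] by auto

lemma connected_off_refl: "x \<in> topspace X \<Longrightarrow> x \<notin> drawing F \<Longrightarrow> connected_off F x x"
  by (simp add: path_component_of_refl)

lemma openin_face:
  assumes "F \<subseteq> E" shows "openin X (Collect (connected_off F x))"
proof -
  have o: "openin X (topspace X - drawing F)" using closedin_drawing[OF assms] by blast
  then have "locally_path_connected_space (subtopology X (topspace X - drawing F))"
    by (rule locally_path_connected_space_open_subset[OF locally_path_connected])
  then have "openin (subtopology X (topspace X - drawing F)) (Collect (connected_off F x))"
    by (rule openin_path_component_of_locally_path_connected_space)
  then show ?thesis using o openin_open_subtopology by blast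
qed

text \<open>A chain joining the two points in the surface is null at each vertex by
  \<open>H1_point\<close>, hence null on the finite vertex set.\<close>

lemma connected_off_empty:
  assumes "x \<in> topspace X" "y \<in> topspace X" "x \<notin> drawing {}" "y \<notin> drawing {}"
  shows "connected_off {} x y"
proof -
  have d: "drawing {} = f ` V" by (simp add: drawing_def)
  have fV: "finite (f ` V)" "f ` V \<subseteq> topspace X" using finite_V f_in by auto
  have "path_component_of X y x"
    using path_connected assms by (simp add: path_connected_space_iff_path_component)
  then obtain \<sigma> where \<sigma>: "singular_chain (Suc 0) X \<sigma>"
    "chain_boundary (Suc 0) \<sigma> = frag_of (point_simplex x) - frag_of (point_simplex y)"
    by (rule path_component_of_chain)
  have "singular_chain 0 (subtopology X (topspace X - f ` V)) (frag_of (point_simplex x) - frag_of (point_simplex y))"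
    using assms unfolding d by (auto simp: singular_chain_of intro!: singular_chain_diff singular_simplex_point)
  then have c: "cyc1 (f ` V) \<sigma>" using \<sigma> by (simp add: singular_relcycle)
  have "nul1 (f ` V) \<sigma>"
  proof (rule nul_finite[OF fV c])
    fix z assume z: "z \<in> f ` V"
    have "cyc1 {z} \<sigma>" by (rule cyc_mono[OF c]) (use z in simp)
    then show "nul1 {z} \<sigma>" using H1_point z fV by blast
  qed
  then show ?thesis
    using relboundary_imp_path_component_of[where U = "topspace X - f ` V", OF _ _ _ _ \<sigma>(2)] assms unfolding d by simp
qed

lemma connected_off_forest:
  assumes "forest F" "F \<subseteq> E" "x \<in> topspace X" "y \<in> topspace X" "x \<notin> drawing F" "y \<notin> drawing F"
  shows "connected_off F x y"
  using assms
proof (induction arbitrary: x y)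
  case forest_empty
  then show ?case by (intro connected_off_empty)
next
  case (forest_insert F p q)
  have F: "F \<subseteq> E" and e: "{p, q} \<in> E" using forest_insert.prems by auto
  have off: "x \<notin> drawing F" "y \<notin> drawing F"
    using forest_insert.prems(4,5) unfolding drawing_insert by simp_all
  have "{p, q} \<notin> F"
    using forest_insert.hyps(2) reachable_edge[of p q F] by (rule contrapos_nn)
  moreover obtain u v where uv: "ends {p, q} u v" using ends_exists[OF e] .
  moreover have "(u, v) \<notin> reachable F"
  proof -
    have "{p, q} = {u, v}" using uv unfolding ends_def by (elim conjE)
    then have "(u = p \<and> v = q) \<or> (u = q \<and> v = p)" by (auto simp: doubleton_eq_iff)
    moreover have "(q, p) \<notin> reachable F"
      using forest_insert.hyps(2) reachable_sym by (rule contrapos_nn)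
    ultimately show ?thesis using forest_insert.hyps(2) by (elim disjE conjE) simp_all
  qed
  moreover have "connected_off F y x"
    by (rule forest_insert.IH[OF F _ _ off(2,1)]) (rule forest_insert.prems)+
  ultimately show ?case
    using connected_off_insert_bridge[OF F e] forest_insert.prems(4,5) by simp
qed

lemma connected_off_open_arc:
  assumes "F \<subseteq> E" "e \<in> E" "e \<notin> F" "s \<in> {0<..<1}" "t \<in> {0<..<1}"
  shows "connected_off F (\<gamma> e s) (\<gamma> e t)"
proof -
  interpret a: surface_arc X m "\<gamma> e" using arc assms by blast
  have "path_connectedin (top_of_set {0..1}) {0<..<1::real}"
    by (simp add: path_connectedin_subtopology greaterThanLessThan_subseteq_atLeastAtMost_iff is_interval_path_connected)
  then have "path_connectedin X (\<gamma> e ` {0<..<1})"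
    by (rule path_connectedin_continuous_map_image[rotated]) (use a.pathin in \<open>simp add: pathin_def\<close>)
  moreover have "\<gamma> e ` {0<..<1} \<subseteq> topspace X - drawing F"
    using a.arc_in_topspace open_arc_disjoint[OF assms(1-3)] by force
  ultimately show ?thesis
    unfolding path_component_of path_connectedin_subtopology using assms by blast
qed

text \<open>Before \<open>e\<close> is added its open arc lies in one face, so every point of
  \<open>S\<close> was connected to \<open>\<gamma> e (1/2)\<close>. Three such points would
  contradict \<open>connected_off_insert_two_sides\<close>.\<close>

lemma edge_at_most_two_faces:
  assumes F: "F \<subseteq> E" and e: "e \<in> E" "e \<notin> F"
    and S: "S \<subseteq> topspace X - drawing (insert e F)" "\<And>x y. \<lbrakk>x \<in> S; y \<in> S; connected_off (insert e F) x y\<rbrakk> \<Longrightarrow> x = y"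
    and adj: "\<And>x. x \<in> S \<Longrightarrow> \<exists>t\<in>{0<..<1}. \<gamma> e t \<in> X closure_of Collect (connected_off (insert e F) x)"
  shows "finite S \<and> card S \<le> 2"
proof -
  obtain u v where uv: "ends e u v" using ends_exists[OF e(1)] .
  have half: "connected_off F (\<gamma> e (1/2)) x" if x: "x \<in> S" for x
  proof -
    obtain t where t: "t \<in> {0<..<1}" "\<gamma> e t \<in> X closure_of Collect (connected_off (insert e F) x)"
      using adj[OF x] by (elim bexE)
    have "\<gamma> e t \<in> Collect (connected_off F (\<gamma> e t))"
      using connected_off_open_arc[OF F e t(1) t(1)] by simp
    from closure_of_meets_open[OF t(2) openin_face[OF F] this]
    have "\<exists>q. q \<in> Collect (connected_off (insert e F) x) \<and> q \<in> Collect (connected_off F (\<gamma> e t))" .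
    then obtain q where q: "connected_off (insert e F) x q" "connected_off F (\<gamma> e t) q" by auto
    have "connected_off F x q" by (rule connected_off_antimono[OF q(1)]) blast
    then have "connected_off F (\<gamma> e t) x"
      by (rule path_component_of_trans[OF q(2) path_component_of_sym])
    moreover have "connected_off F (\<gamma> e (1/2)) (\<gamma> e t)"
      by (rule connected_off_open_arc[OF F e _ t(1)]) simp
    ultimately show ?thesis by (rule path_component_of_trans[rotated])
  qed
  have two: "x = y \<or> x = z \<or> y = z" if "x \<in> S" "y \<in> S" "z \<in> S" for x y z
  proof -
    have "connected_off F z x" "connected_off F z y"
      using half[OF that(1)] half[OF that(2)] path_component_of_sym[OF half[OF that(3)]]
      by (auto intro: path_component_of_trans)
    from connected_off_insert_two_sides[OF F e uv this]
    show ?thesis using S that by blast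
  qed
  show ?thesis
  proof (rule ccontr)
    assume neg: "\<not> ?thesis"
    obtain T where "T \<subseteq> S" "card T = 3"
    proof (cases "finite S")
      case True
      then have "3 \<le> card S" using neg by simp
      then show thesis using obtain_subset_with_card_n[of 3 S] that by blast
    next
      case False
      then show thesis using infinite_arbitrarily_large[of S 3] that by blast
    qed
    then obtain x y z where "x \<in> S" "y \<in> S" "z \<in> S" "x \<noteq> y" "x \<noteq> z" "y \<noteq> z"
      by (auto simp: card_3_iff)
    then show False using two by blast
  qed
qed

text \<open>Let \<open>D\<close> be the edges of \<open>C\<close> that the face touches. If there
  are at most two, the face is open and closed in the complement of the forest
  \<open>F \<union> D\<close>, which is connected, and so is all of it; but that complement also
  contains interior points of the other edges of \<open>C\<close>, which lie in no face.\<close>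

lemma face_meets_three:
  assumes F: "F \<subseteq> E" and C: "C \<subseteq> E" "F \<inter> C = {}" "finite C" "card C \<ge> 3"
    and forests: "\<And>D. \<lbrakk>D \<subseteq> C; card D \<le> 2\<rbrakk> \<Longrightarrow> forest (F \<union> D)"
    and x: "x \<in> topspace X" "x \<notin> drawing (F \<union> C)"
  shows "card {e \<in> C. \<exists>t\<in>{0<..<1}. \<gamma> e t \<in> X closure_of Collect (connected_off (F \<union> C) x)} \<ge> 3"
proof (rule ccontr)
  define D where "D = {e \<in> C. \<exists>t\<in>{0<..<1}. \<gamma> e t \<in> X closure_of Collect (connected_off (F \<union> C) x)}"
  assume "\<not> ?thesis"
  then have cD: "card D \<le> 2" by (simp add: D_def)
  have DC: "D \<subseteq> C" by (auto simp: D_def)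
  have FD: "F \<union> D \<subseteq> E" "F \<union> C \<subseteq> E" using F C DC by auto
  let ?Y = "subtopology X (topspace X - drawing (F \<union> D))"
  let ?f = "Collect (connected_off (F \<union> C) x)"
  have sub: "?f \<subseteq> topspace X - drawing (F \<union> C)"
    using connected_off_D by blast
  have dm: "drawing (F \<union> D) \<subseteq> drawing (F \<union> C)" using DC by (intro drawing_mono) blast
  have "path_connected_space ?Y"
    unfolding path_connected_space_iff_path_component
    using connected_off_forest[OF forests[OF DC cD] FD(1)] by auto
  then have "connected_space ?Y" by (rule path_connected_imp_connected_space)
  moreover have "openin ?Y ?f"
  proof -
    have "openin X (topspace X - drawing (F \<union> D))" using closedin_drawing[OF FD(1)] by blast
    moreover have "?f \<subseteq> topspace X - drawing (F \<union> D)" using sub dm by (rule order.trans[OF _ Diff_mono[OF order.refl]])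
    moreover have "openin X ?f" by (rule openin_face[OF FD(2)])
    ultimately show ?thesis by (metis openin_open_subtopology)
  qed
  moreover have "closedin ?Y ?f"
  proof -
    have "q \<in> ?f" if q: "q \<in> X closure_of ?f" "q \<in> topspace X - drawing (F \<union> D)" for q
    proof (cases "q \<in> drawing (F \<union> C)")
      case True
      \<comment> \<open>A limit point on the larger drawing would lie inside an edge of
        \<open>C\<close> outside \<open>D\<close>, which the definition of \<open>D\<close>
        excludes.\<close>
      then obtain e t where e: "e \<in> C" "e \<notin> D" "t \<in> {0..1}" "q = \<gamma> e t"
        using q(2) by (auto simp: drawing_def)
      obtain u v where "ends e u v" using ends_exists e C by blast
      then have "t \<noteq> 0" "t \<noteq> 1" using q(2) e(4) by (auto simp: ends_def drawing_def)
      then show ?thesis using e q(1) by (auto simp: D_def)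
    next
      case False
      then have "q \<in> Collect (connected_off (F \<union> C) q)" using q(2) connected_off_refl by simp
      from closure_of_meets_open[OF q(1) openin_face[OF FD(2)] this]
      have "\<exists>r. r \<in> Collect (connected_off (F \<union> C) x) \<and> r \<in> Collect (connected_off (F \<union> C) q)" .
      then obtain r where "connected_off (F \<union> C) x r" "connected_off (F \<union> C) q r" by auto
      then have "connected_off (F \<union> C) x q" by (rule path_component_of_trans[OF _ path_component_of_sym])
      then show ?thesis by simp
    qed
    moreover have "?f \<subseteq> topspace X - drawing (F \<union> D)" using sub dm by blast
    ultimately have "(topspace X - drawing (F \<union> D)) \<inter> X closure_of ?f = ?f"
      using closure_of_subset[of ?f X] sub by blast
    then show ?thesis
      by (metis closedin_closure_of closedin_subtopology inf_commute)
  qed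
  moreover have "?f \<noteq> {}" using connected_off_refl[OF x] by blast
  ultimately have all: "?f = topspace ?Y" unfolding connected_space_clopen_in by blast
  have "D \<noteq> C" using cD C(4) by auto
  then obtain e where e: "e \<in> C" "e \<notin> D" using DC by blast
  then have eE: "e \<in> E" "e \<notin> F \<union> D" using C by auto
  then have "\<gamma> e (1/2) \<notin> drawing (F \<union> D)" using open_arc_disjoint[OF FD(1), of e "1/2"] by simp
  moreover have "\<gamma> e (1/2) \<in> topspace X"
    using surface_arc.arc_in_topspace[OF arc[OF eE(1)]] by simp
  moreover have "\<gamma> e (1/2) \<in> \<gamma> e ` {0..1}" by (rule imageI) simp
  then have "\<gamma> e (1/2) \<in> drawing (F \<union> C)" using e(1) unfolding drawing_def by blast
  ultimately show False using all sub by auto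
qed

end

lemma sum_frag_restrict:
  fixes w :: "nat \<Rightarrow> 'b \<Rightarrow>\<^sub>0 int"
  assumes "a \<le> b"
  shows "(\<Sum>i<b. frag_cmul (if i < a then k i else 0) (w i)) = (\<Sum>i<a. frag_cmul (k i) (w i))"
proof -
  have "(\<Sum>i<b. frag_cmul (if i < a then k i else 0) (w i)) = (\<Sum>i\<in>{..<a}. frag_cmul (if i < a then k i else 0) (w i))"
    by (rule sum.mono_neutral_right) (use assms in auto)
  then show ?thesis by simp
qed

lemma card_pairs_less: "2 * card {(x::nat, y). x < y \<and> y < h} = h * (h - 1)"
proof (induction h)
  case (Suc h)
  let ?A = "{(x::nat, y). x < y \<and> y < h}" and ?B = "(\<lambda>x. (x, h)) ` {..<h}"
  have eq: "{(x::nat, y). x < y \<and> y < Suc h} = ?A \<union> ?B"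
    by (auto simp: less_Suc_eq)
  have "finite ?A"
    by (rule finite_subset[of _ "{..<h} \<times> {..<h}"]) auto
  then have "card (?A \<union> ?B) = card ?A + card ?B"
    by (rule card_Un_disjoint) auto
  moreover have "card ?B = h"
    by (subst card_image) (auto simp: inj_on_def)
  ultimately have "card {(x::nat, y). x < y \<and> y < Suc h} = card ?A + h"
    unfolding eq by simp
  then show ?case using Suc by (cases h) (auto simp: algebra_simps)
qed auto

context embedded_graph
begin

text \<open>Each edge of \<open>R\<close> closes a cycle. Either it separates two points and
  \<open>S\<close> gains a representative, or it separates nothing and
  \<open>connected_off_insert_cycle\<close> gives one more independent class of H_1(X); so
  \<open>card S + b\<close> grows by at least 1. The points of \<open>S\<close> avoid the drawing of
  all of \<open>E\<close>, so that no later edge passes through them.\<close>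

lemma faces_lower_bound:
  assumes dense: "\<forall>N. openin X N \<longrightarrow> N \<noteq> {} \<longrightarrow> (\<exists>x\<in>N. x \<notin> drawing E)"
    and R: "finite R" and "F \<subseteq> E" "R \<subseteq> E" "F \<inter> R = {}"
    and "\<forall>u v. {u, v} \<in> R \<longrightarrow> (u, v) \<in> reachable F"
  shows "\<exists>S w b. finite S \<and> S \<subseteq> topspace X - drawing E \<and>
      (\<forall>x\<in>S. \<forall>y\<in>S. connected_off (F \<union> R) x y \<longrightarrow> x = y) \<and>
      (\<forall>i<b. singular_relcycle (Suc 0) X {} (w i)) \<and>
      (\<forall>k. nul1 (drawing (F \<union> R)) (\<Sum>i<b. frag_cmul (k i) (w i)) \<longrightarrow> (\<forall>i<b. k i = 0)) \<and>
      card S + b \<ge> Suc (card R)"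
  using assms(2-)
proof (induction R)
  case empty
  have "\<exists>x. x \<in> topspace X \<and> x \<notin> drawing E"
  proof -
    have "V \<noteq> {}" using finite_graph by (simp add: finite_simple_graph_def)
    then have "topspace X \<noteq> {}" using f_in by blast
    then show ?thesis using dense[rule_format, of "topspace X"] by blast
  qed
  then obtain x where "x \<in> topspace X - drawing E" by blast
  then show ?case
    by (intro exI[of _ "{x}"] exI[of _ "\<lambda>_. 0"] exI[of _ "0::nat"]) simp
next
  case (insert e R)
  let ?F = "F \<union> R"
  have FR: "?F \<subseteq> E" "e \<in> E" "e \<notin> ?F" using insert by auto
  have ins: "F \<union> insert e R = insert e ?F" by blast
  have prem: "F \<subseteq> E" "R \<subseteq> E" "F \<inter> R = {}" using insert.prems by auto
  have "\<forall>u v. {u, v} \<in> R \<longrightarrow> (u, v) \<in> reachable F" using insert.prems(4) by simp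
  from insert.IH[OF prem this]
  obtain S w b where S: "finite S" "S \<subseteq> topspace X - drawing E"
      and sep: "\<forall>x\<in>S. \<forall>y\<in>S. connected_off ?F x y \<longrightarrow> x = y"
      and w: "\<forall>i<b. singular_relcycle (Suc 0) X {} (w i)"
      and indep: "\<forall>k. nul1 (drawing ?F) (\<Sum>i<b. frag_cmul (k i) (w i)) \<longrightarrow> (\<forall>i<b. k i = 0)"
      and cardS: "Suc (card R) \<le> card S + b"
    by (elim exE conjE)
  obtain u v where uv: "ends e u v" using ends_exists FR by blast
  then have "e = {u, v}" unfolding ends_def by (elim conjE)
  then have "(u, v) \<in> reachable F" using insert.prems(4) by simp
  then have re: "(u, v) \<in> reachable ?F" using reachable_mono[of F ?F] by (rule rev_subsetD) simp
  have dins: "drawing ?F \<subseteq> drawing (insert e ?F)" by (rule drawing_mono) blast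
  have dE: "drawing (insert e ?F) \<subseteq> drawing E" by (rule drawing_mono) (use FR in simp)
  show ?case
  proof (cases "\<forall>x y. x \<notin> drawing (insert e ?F) \<longrightarrow> y \<notin> drawing (insert e ?F) \<longrightarrow> connected_off ?F x y
      \<longrightarrow> connected_off (insert e ?F) x y")
    case True
    obtain w' where w': "singular_relcycle (Suc 0) X {} w'" "nul1 (drawing ?F) w'"
      and w'k: "\<And>k. nul1 (drawing (insert e ?F)) (frag_cmul k w') \<Longrightarrow> k = 0"
      by (rule connected_off_insert_cycle[OF FR uv re]) (use True in simp_all)
    let ?w = "\<lambda>i. if i < b then w i else w'"
    have sum: "(\<Sum>i<Suc b. frag_cmul (k i) (?w i)) = (\<Sum>i<b. frag_cmul (k i) (w i)) + frag_cmul (k b) w'" for k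
      by simp
    show ?thesis unfolding ins
    proof (intro exI[of _ S] exI[of _ ?w] exI[of _ "Suc b"] conjI S)
      show "\<forall>x\<in>S. \<forall>y\<in>S. connected_off (insert e ?F) x y \<longrightarrow> x = y"
      proof (intro ballI impI)
        fix x y assume "x \<in> S" "y \<in> S" "connected_off (insert e ?F) x y"
        moreover from this(3) have "connected_off ?F x y" by (rule connected_off_antimono) blast
        ultimately show "x = y" using sep by simp
      qed
      show "\<forall>i<Suc b. singular_relcycle (Suc 0) X {} (?w i)" using w w' by simp
      show "\<forall>k. nul1 (drawing (insert e ?F)) (\<Sum>i<Suc b. frag_cmul (k i) (?w i)) \<longrightarrow> (\<forall>i<Suc b. k i = 0)"
      proof (rule allI, rule impI)
        fix k assume "nul1 (drawing (insert e ?F)) (\<Sum>i<Suc b. frag_cmul (k i) (?w i))"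
        then have n: "nul1 (drawing (insert e ?F)) ((\<Sum>i<b. frag_cmul (k i) (w i)) + frag_cmul (k b) w')"
          unfolding sum .
        \<comment> \<open>\<open>w'\<close> is null relative to the complement of the smaller
          drawing, so there the relation involves only the older classes.\<close>
        have "nul1 (drawing ?F) ((\<Sum>i<b. frag_cmul (k i) (w i)) + frag_cmul (k b) w' - frag_cmul (k b) w')"
          by (intro singular_relboundary_diff nul_mono[OF n dins] singular_relboundary_cmul w'(2))
        then have k: "\<forall>i<b. k i = 0" using indep by simp
        then have "(\<Sum>i<b. frag_cmul (k i) (w i)) = 0" by simp
        then have "k b = 0" using n w'k by simp
        then show "\<forall>i<Suc b. k i = 0" using k by (simp add: less_Suc_eq)
      qed
      show "Suc (card (insert e R)) \<le> card S + Suc b" using cardS insert.hyps by simp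
    qed
  next
    case False
    then obtain x y where xy: "x \<notin> drawing (insert e ?F)" "y \<notin> drawing (insert e ?F)" "connected_off ?F x y"
      "\<not> connected_off (insert e ?F) x y"
      by (simp only: not_all not_imp) (elim exE conjE)
    \<comment> \<open>\<open>x\<close> and \<open>y\<close> may lie on other edges of
      \<open>E\<close>; density moves them inside their faces to points off all of
      \<open>E\<close>.\<close>
    have shift: "\<exists>z. z \<in> topspace X - drawing E \<and> connected_off (insert e ?F) x z"
      if "x \<in> topspace X" "x \<notin> drawing (insert e ?F)" for x
    proof -
      have "x \<in> Collect (connected_off (insert e ?F) x)" using connected_off_refl[OF that] by simp
      moreover have "openin X (Collect (connected_off (insert e ?F) x))"
        by (rule openin_face) (use FR in simp)
      ultimately obtain z where "z \<in> Collect (connected_off (insert e ?F) x)" "z \<notin> drawing E"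
        using dense[rule_format, of "Collect (connected_off (insert e ?F) x)"] by (elim bexE[rotated]) auto
      then show ?thesis using connected_off_D(2)[of "insert e ?F" x z] by auto
    qed
    obtain p where p: "p \<in> topspace X - drawing E" "connected_off (insert e ?F) x p"
      using shift[OF connected_off_D(1)[OF xy(3)] xy(1)] by blast
    obtain q where q: "q \<in> topspace X - drawing E" "connected_off (insert e ?F) y q"
      using shift[OF connected_off_D(2)[OF xy(3)] xy(2)] by blast
    have npq: "\<not> connected_off (insert e ?F) p q"
      using xy(4) path_component_of_trans[OF path_component_of_trans[OF p(2)] path_component_of_sym[OF q(2)]] by (rule contrapos_nn)
    have pq: "connected_off ?F p q"
    proof -
      have "connected_off ?F x p" "connected_off ?F y q"
        using connected_off_antimono[OF p(2), of ?F] connected_off_antimono[OF q(2), of ?F] by auto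
      from path_component_of_trans[OF path_component_of_sym[OF this(1)] path_component_of_trans[OF xy(3) this(2)]]
      show ?thesis .
    qed
    \<comment> \<open>The face that splits loses its representative, if it had one, and
      \<open>p\<close> and \<open>q\<close> are gained.\<close>
    define S' where "S' = {s \<in> S. \<not> connected_off ?F p s}"
    have "card (S - S') \<le> 1"
    proof -
      have "x = y" if "x \<in> S - S'" "y \<in> S - S'" for x y
      proof -
        have "connected_off ?F p x" "connected_off ?F p y" using that by (auto simp: S'_def)
        from path_component_of_trans[OF path_component_of_sym[OF this(1)] this(2)]
        have "connected_off ?F x y" .
        then show ?thesis using sep that by simp
      qed
      then show ?thesis using S(1) card_le_Suc0_iff_eq[of "S - S'"] by auto
    qed
    moreover have "card (S - S') = card S - card S'"
      using S(1) by (intro card_Diff_subset) (auto simp: S'_def)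
    moreover have "finite S'" "p \<notin> S'" "q \<notin> S'" "p \<noteq> q"
      using S(1) pq npq connected_off_refl[of p ?F] connected_off_refl[of p "insert e ?F"] p dins dE by (auto simp: S'_def)
    ultimately have card': "card (insert p (insert q S')) \<ge> Suc (card S)" by auto
    have sepF: "\<not> connected_off ?F p s \<and> \<not> connected_off ?F q s \<and> \<not> connected_off ?F s p \<and> \<not> connected_off ?F s q"
      if "s \<in> S'" for s
    proof -
      have n: "\<not> connected_off ?F p s" using that by (simp add: S'_def)
      moreover have "\<not> connected_off ?F q s"
        using n path_component_of_trans[OF pq] by (rule contrapos_nn)
      moreover have "\<not> connected_off ?F s p" using n path_component_of_sym by (rule contrapos_nn)
      moreover have "\<not> connected_off ?F s q"
        using n path_component_of_trans[OF pq path_component_of_sym] by (rule contrapos_nn)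
      ultimately show ?thesis by simp
    qed
    show ?thesis unfolding ins
    proof (intro exI[of _ "insert p (insert q S')"] exI[of _ w] exI[of _ b] conjI)
      show "finite (insert p (insert q S'))" using \<open>finite S'\<close> by simp
      show "insert p (insert q S') \<subseteq> topspace X - drawing E" using S(2) p q by (auto simp: S'_def)
      show "\<forall>x\<in>insert p (insert q S'). \<forall>y\<in>insert p (insert q S'). connected_off (insert e ?F) x y \<longrightarrow> x = y"
      proof (intro ballI impI)
        fix x y assume x: "x \<in> insert p (insert q S')" and y: "y \<in> insert p (insert q S')"
          and c: "connected_off (insert e ?F) x y"
        have c': "connected_off ?F x y" using c by (rule connected_off_antimono) blast
        have c'': "connected_off (insert e ?F) y x" using c by (rule path_component_of_sym)
        have "x = y" if "x \<in> S'" "y \<in> S'" using sep c' that by (simp add: S'_def)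
        then show "x = y" using x y c c' c'' npq sepF by (elim insertE) simp_all
      qed
      show "\<forall>k. nul1 (drawing (insert e ?F)) (\<Sum>i<b. frag_cmul (k i) (w i)) \<longrightarrow> (\<forall>i<b. k i = 0)"
      proof (rule allI, rule impI)
        fix k assume "nul1 (drawing (insert e ?F)) (\<Sum>i<b. frag_cmul (k i) (w i))"
        from nul_mono[OF this dins] show "\<forall>i<b. k i = 0" using indep by simp
      qed
      show "Suc (card (insert e R)) \<le> card (insert p (insert q S')) + b" using cardS card' insert.hyps by simp
    qed (use w in simp)
  qed
qed

end

section \<open>Complete minors of embedded graphs\<close>

context embedded_graph
begin

text \<open>With \<open>m = h (h - 1) / 2\<close> this is twice the Euler bound
  \<open>m \<le> 3 h - 6 + 6 g\<close> for a graph with \<open>h\<close> vertices and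
  \<open>m\<close> edges. The branch sets act as the vertices; their spanning trees add no faces
  because forests do not separate.\<close>

lemma complete_minor_bound:
  assumes dense: "\<forall>N. openin X N \<longrightarrow> N \<noteq> {} \<longrightarrow> (\<exists>x\<in>N. x \<notin> drawing E)"
    and rank: "\<And>w. \<forall>i<Suc (2 * g). singular_relcycle (Suc 0) X {} (w i) \<Longrightarrow>
        \<exists>k. (\<exists>i<Suc (2 * g). k i \<noteq> 0) \<and> singular_relboundary (Suc 0) X {} (\<Sum>i<Suc (2 * g). frag_cmul (k i) (w i))"
    and minor: "is_minor {..<h} (complete_edges {..<h}) V E" and h: "h \<ge> 3"
  shows "h * (h - 1) + 12 \<le> 6 * h + 12 * g"
proof -
  obtain W where W: "\<And>x. x < h \<Longrightarrow> W x \<subseteq> V" "\<And>x. x < h \<Longrightarrow> connected_in E (W x)"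
    and disj: "\<And>x y. \<lbrakk>x < h; y < h; x \<noteq> y\<rbrakk> \<Longrightarrow> W x \<inter> W y = {}"
    and adj: "\<And>x y. \<lbrakk>x < h; y < h; x \<noteq> y\<rbrakk> \<Longrightarrow> \<exists>u\<in>W x. \<exists>v\<in>W y. {u, v} \<in> E"
  proof -
    from minor obtain W where 1: "\<forall>x\<in>{..<h}. W x \<subseteq> V \<and> connected_in E (W x)"
      and 2: "\<forall>x\<in>{..<h}. \<forall>y\<in>{..<h}. x \<noteq> y \<longrightarrow> W x \<inter> W y = {}"
      and 3: "\<forall>x\<in>{..<h}. \<forall>y\<in>{..<h}. {x, y} \<in> complete_edges {..<h} \<longrightarrow> (\<exists>u\<in>W x. \<exists>v\<in>W y. {u, v} \<in> E)"
      unfolding is_minor_def by (elim exE conjE)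
    have "\<exists>u\<in>W x. \<exists>v\<in>W y. {u, v} \<in> E" if "x < h" "y < h" "x \<noteq> y" for x y
    proof -
      have "{x, y} \<in> complete_edges {..<h}" unfolding complete_edges_def using that by blast
      then show ?thesis using 3 that by simp
    qed
    with 1 2 show thesis by (intro that[of W]) simp_all
  qed
  \<comment> \<open>Labels a vertex by its branch set; a label that is constant along edges refutes
    reachability.\<close>
  define idx where "idx v = (THE x. x < h \<and> v \<in> W x)" for v
  have idx: "idx v = x" if "x < h" "v \<in> W x" for x v
    unfolding idx_def by (rule the_equality) (use that disj in blast)+

  define P where "P = {(x, y). x < y \<and> y < h}"
  have finP: "finite P"
    by (rule finite_subset[of _ "{..<h} \<times> {..<h}"]) (auto simp: P_def)
  have cardP: "2 * card P = h * (h - 1)" unfolding P_def by (rule card_pairs_less)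
  have "\<exists>q. fst q \<in> W (fst p) \<and> snd q \<in> W (snd p) \<and> {fst q, snd q} \<in> E" if "p \<in> P" for p
  proof -
    have "fst p < h" "snd p < h" "fst p \<noteq> snd p" using that by (auto simp: P_def)
    from adj[OF this] obtain u v where "u \<in> W (fst p)" "v \<in> W (snd p)" "{u, v} \<in> E" by (elim bexE)
    then show ?thesis by (intro exI[of _ "(u, v)"]) simp
  qed
  then obtain ab where ab: "\<And>p. p \<in> P \<Longrightarrow> fst (ab p) \<in> W (fst p)" "\<And>p. p \<in> P \<Longrightarrow> snd (ab p) \<in> W (snd p)"
    "\<And>p. p \<in> P \<Longrightarrow> {fst (ab p), snd (ab p)} \<in> E" by metis
  define c where "c p = {fst (ab p), snd (ab p)}" for p
  have idx_ab: "idx (fst (ab p)) = fst p" "idx (snd (ab p)) = snd p" if "p \<in> P" for p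
    using that idx ab(1,2)[OF that] by (auto simp: P_def)
  have lt: "fst p < snd p" "snd p < h" "fst p < h" if "p \<in> P" for p using that by (auto simp: P_def)
  have idx_c: "idx ` c p = {fst p, snd p}" if "p \<in> P" for p
    unfolding c_def using idx_ab[OF that] by simp
  have inj_c: "inj_on c P"
  proof (rule inj_onI)
    fix p q assume p: "p \<in> P" and q: "q \<in> P" and "c p = c q"
    then have "{fst p, snd p} = {fst q, snd q}" using idx_c by metis
    then show "p = q" using lt[OF p] lt[OF q] by (auto simp: doubleton_eq_iff prod_eq_iff)
  qed
  define C where "C = c ` P"
  have CE: "C \<subseteq> E" unfolding C_def c_def using ab(3) by auto
  have finC: "finite C" unfolding C_def using finP by simp
  have cardC: "card C = card P" unfolding C_def using inj_c by (rule card_image)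

  \<comment> \<open>A maximal forest among the edges inside branch sets is taken; maximality makes
    it span each connected branch set.\<close>
  define Ein where "Ein = {e \<in> E. \<exists>x<h. e \<subseteq> W x}"
  have "finite {F. F \<subseteq> Ein \<and> forest F}"
    by (rule finite_subset[of _ "Pow E"]) (use finite_E in \<open>auto simp: Ein_def\<close>)
  moreover have "{F. F \<subseteq> Ein \<and> forest F} \<noteq> {}" using forest_empty by blast
  ultimately have "\<exists>F\<in>{F. F \<subseteq> Ein \<and> forest F}. \<forall>G\<in>{F. F \<subseteq> Ein \<and> forest F}. F \<le> G \<longrightarrow> F = G"
    by (rule finite_has_maximal)
  then obtain F where F': "F \<in> {F. F \<subseteq> Ein \<and> forest F}"
      and maxF': "\<forall>G\<in>{F. F \<subseteq> Ein \<and> forest F}. F \<le> G \<longrightarrow> F = G" by (elim bexE)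
  have F: "F \<subseteq> Ein" "forest F" using F' by simp_all
  have maxF: "F = G" if "G \<subseteq> Ein" "forest G" "F \<subseteq> G" for G
    using maxF' that by simp
  have FE: "F \<subseteq> E" using F by (auto simp: Ein_def)
  have idxF: "idx p = idx q" if "{p, q} \<in> F" for p q
  proof -
    have "{p, q} \<in> Ein" using F(1) that by (rule subsetD)
    then obtain x where "x < h" "p \<in> W x" "q \<in> W x" by (auto simp: Ein_def)
    then show ?thesis using idx by simp
  qed
  have span: "(u, v) \<in> reachable F" if x: "x < h" "u \<in> W x" "v \<in> W x" for x u v
  proof -
    have edge: "(p, q) \<in> reachable F" if pq: "p \<in> W x" "q \<in> W x" "{p, q} \<in> E" for p q
    proof (rule ccontr)
      assume n: "(p, q) \<notin> reachable F"
      have "insert {p, q} F \<subseteq> Ein" using F(1) pq x(1) unfolding Ein_def by auto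
      from maxF[OF this forest_insert[OF F(2) n]] have "{p, q} \<in> F" by auto
      then show False using n reachable_edge[of p q F] by simp
    qed
    have "(u, v) \<in> {(a, b). a \<in> W x \<and> b \<in> W x \<and> {a, b} \<in> E}\<^sup>*"
      using W(2)[OF x(1)] x unfolding connected_in_def by simp
    then show ?thesis
    proof (induction rule: rtrancl_induct)
      case base
      then show ?case by (simp add: reachable_def)
    next
      case (step y z)
      then have "(y, z) \<in> reachable F" using edge by simp
      with step.IH show ?case by (rule reachable_trans)
    qed
  qed
  have FC: "F \<inter> C = {}"
  proof (rule ccontr)
    assume "F \<inter> C \<noteq> {}"
    then obtain p where p: "p \<in> P" "c p \<in> F" by (auto simp: C_def)
    then have "fst p = snd p" using idxF idx_ab[OF p(1)] unfolding c_def by metis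
    then show False using lt[OF p(1)] by simp
  qed
  \<comment> \<open>Needed for \<open>face_meets_three\<close>: two connecting edges close no cycle.
    They join different pairs of branch sets, so after one pair is identified, by \<open>L\<close>
    below, the other edge still joins two distinct ones.\<close>
  have forest2: "forest (F \<union> D)" if D: "D \<subseteq> C" "card D \<le> 2" for D
  proof -
    have forest1: "forest (insert (c p) F)" if p: "p \<in> P" for p
      unfolding c_def
    proof (rule forest_insert[OF F(2)])
      show "(fst (ab p), snd (ab p)) \<notin> reachable F"
      proof
        assume "(fst (ab p), snd (ab p)) \<in> reachable F"
        then have "idx (fst (ab p)) = idx (snd (ab p))"
          by (rule reachable_invariant) (rule idxF)
        then show False using idx_ab[OF p] lt[OF p] by simp
      qed
    qed
    have forest2: "forest (insert (c q) (insert (c p) F))" if p: "p \<in> P" and q: "q \<in> P" and pq: "p \<noteq> q" for p q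
      unfolding c_def[of q]
    proof (rule forest_insert[OF forest1[OF p]])
      define L where "L v = (if idx v = snd p then fst p else idx v)" for v
      show "(fst (ab q), snd (ab q)) \<notin> reachable (insert (c p) F)"
      proof
        assume "(fst (ab q), snd (ab q)) \<in> reachable (insert (c p) F)"
        then have "L (fst (ab q)) = L (snd (ab q))"
        proof (rule reachable_invariant)
          fix s t assume st: "{s, t} \<in> insert (c p) F"
          show "L s = L t"
          proof (cases "{s, t} \<in> F")
            case True
            then show ?thesis using idxF[of s t] by (simp add: L_def)
          next
            case False
            then have "{s, t} = {fst (ab p), snd (ab p)}" using st by (simp add: c_def)
            then have "s = fst (ab p) \<and> t = snd (ab p) \<or> s = snd (ab p) \<and> t = fst (ab p)"
              by (simp add: doubleton_eq_iff)
            then show ?thesis using idx_ab[OF p] by (auto simp: L_def)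
          qed
        qed
        then have eq: "(if fst q = snd p then fst p else fst q) = (if snd q = snd p then fst p else snd q)"
          unfolding L_def idx_ab[OF q] .
        have "fst p = fst q \<and> snd p = snd q"
          using eq lt[OF p] lt[OF q] by (auto split: if_splits)
        then show False using pq by (simp add: prod_eq_iff)
      qed
    qed
    have "finite D" using D finC finite_subset by blast
    then consider "D = {}" | e where "D = {e}" | e e' where "D = {e, e'}" "e \<noteq> e'"
      using D(2) by (metis One_nat_def card_0_eq card_1_singletonE card_2_iff le_Suc_eq le_zero_eq numeral_2_eq_2)
    then show ?thesis
    proof cases
      case 1 then show ?thesis using F by simp
    next
      case 2
      then obtain p where "p \<in> P" "D = {c p}" using D(1) by (auto simp: C_def)
      then show ?thesis using forest1 by simp
    next
      case 3
      then obtain p q where "p \<in> P" "q \<in> P" "D = {c q, c p}" "p \<noteq> q" using D(1) by (auto simp: C_def)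
      then show ?thesis using forest2[of p q] by (simp add: Un_insert_right)
    qed
  qed

  \<comment> \<open>The star at branch set 0, with \<open>h - 1\<close> edges: together with
    \<open>F\<close> it connects all branch sets, so every other connecting edge closes a
    cycle.\<close>
  define P0 where "P0 = (\<lambda>y. (0::nat, y)) ` {1..<h}"
  have P0: "P0 \<subseteq> P" unfolding P0_def P_def by auto
  have cardP0: "card P0 = h - 1" unfolding P0_def by (subst card_image) (auto simp: inj_on_def)
  define R where "R = c ` (P - P0)"
  define F1 where "F1 = F \<union> c ` P0"
  have FR: "F1 \<union> R = F \<union> C" unfolding F1_def R_def C_def using P0 by blast
  have RC: "R \<subseteq> C" "c ` P0 \<subseteq> C" unfolding R_def C_def using P0 by blast+
  have cardR: "card R = card P - (h - 1)"
    unfolding R_def using inj_on_subset[OF inj_c, of "P - P0"] card_Diff_subset[OF _ P0] finite_subset[OF P0 finP] cardP0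
    by (subst card_image) auto
  have "c ` P0 \<inter> R = {}"
    unfolding R_def using inj_c P0 by (auto simp: inj_on_def)
  then have F1R: "F1 \<inter> R = {}" using FC RC unfolding F1_def by blast
  have F1E: "F1 \<subseteq> E" "R \<subseteq> E" using FE CE RC unfolding F1_def by blast+
  have FF1: "reachable F \<subseteq> reachable F1" unfolding F1_def by (rule reachable_mono) blast
  obtain r where r: "r \<in> W 0" using W(2)[of 0] h unfolding connected_in_def by auto
  have root: "(v, r) \<in> reachable F1" if x: "x < h" "v \<in> W x" for x v
  proof (cases "x = 0")
    case True
    then show ?thesis using span[of 0 v r] r x FF1 by auto
  next
    case False
    then have p: "(0, x) \<in> P0" "(0, x) \<in> P" using x P0 by (auto simp: P0_def P_def)
    have "(v, snd (ab (0, x))) \<in> reachable F1" using span[OF x(1) x(2)] ab(2)[OF p(2)] FF1 by auto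
    moreover have "(snd (ab (0, x)), fst (ab (0, x))) \<in> reachable F1"
      by (rule reachable_edge) (use p in \<open>auto simp: F1_def c_def insert_commute\<close>)
    moreover have "(fst (ab (0, x)), r) \<in> reachable F1" using span[of 0 "fst (ab (0, x))" r] ab(1)[OF p(2)] r h FF1 by auto
    ultimately show ?thesis using reachable_trans by metis
  qed
  have closing: "\<forall>u v. {u, v} \<in> R \<longrightarrow> (u, v) \<in> reachable F1"
  proof (intro allI impI)
    fix u v assume "{u, v} \<in> R"
    then obtain p where p: "p \<in> P" "{u, v} = {fst (ab p), snd (ab p)}" by (auto simp: R_def c_def)
    have "(fst (ab p), r) \<in> reachable F1" "(snd (ab p), r) \<in> reachable F1"
      using root[OF _ ab(1)[OF p(1)]] root[OF _ ab(2)[OF p(1)]] lt[OF p(1)] by auto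
    moreover have "u = fst (ab p) \<and> v = snd (ab p) \<or> u = snd (ab p) \<and> v = fst (ab p)"
      using p(2) by (simp add: doubleton_eq_iff)
    ultimately have "(u, r) \<in> reachable F1" "(v, r) \<in> reachable F1" by auto
    then show "(u, v) \<in> reachable F1" by (rule reachable_trans[OF _ reachable_sym])
  qed
  have finR: "finite R" using finite_subset[OF RC(1) finC] .
  from faces_lower_bound[OF dense finR F1E F1R closing]
  obtain S w b where S: "finite S" "S \<subseteq> topspace X - drawing E"
      and sep: "\<forall>x\<in>S. \<forall>y\<in>S. connected_off (F \<union> C) x y \<longrightarrow> x = y"
      and w: "\<forall>i<b. singular_relcycle (Suc 0) X {} (w i)"
      and indep: "\<forall>k. nul1 (drawing (F \<union> C)) (\<Sum>i<b. frag_cmul (k i) (w i)) \<longrightarrow> (\<forall>i<b. k i = 0)"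
      and cardS: "Suc (card R) \<le> card S + b"
    unfolding FR by (elim exE conjE)
  have b: "b \<le> 2 * g"
  proof (rule ccontr)
    assume "\<not> b \<le> 2 * g"
    then have gb: "Suc (2 * g) \<le> b" by simp
    then have "\<forall>i<Suc (2 * g). singular_relcycle (Suc 0) X {} (w i)" using w by simp
    from rank[OF this] obtain k where k': "(\<exists>i<Suc (2 * g). k i \<noteq> 0) \<and>
      singular_relboundary (Suc 0) X {} (\<Sum>i<Suc (2 * g). frag_cmul (k i) (w i))" by (rule exE)
    note k = conjunct1[OF k'] conjunct2[OF k']
    \<comment> \<open>Padding with zeros turns a relation among the first \<open>2 * g + 1\<close>
      classes into one among all \<open>b\<close>.\<close>
    let ?k = "\<lambda>i. if i < Suc (2 * g) then k i else 0"
    have "nul1 (drawing (F \<union> C)) (\<Sum>i<b. frag_cmul (?k i) (w i))"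
      unfolding sum_frag_restrict[OF gb] by (rule singular_relboundary_mono[OF k(2)]) simp
    with spec[OF indep, of ?k] have "\<forall>i<b. ?k i = 0" by (rule mp)
    then have "?k i = 0" if "i < Suc (2 * g)" for i using order.strict_trans2[OF that gb] by blast
    then have "\<forall>i<Suc (2 * g). k i = 0" by simp
    then show False using k(1) by blast
  qed
  \<comment> \<open>Incidence of the face of \<open>s\<close> with the edge \<open>e\<close>. The
    ends of the arc are left out, since many faces can meet at a vertex.\<close>
  define Q where "Q s e \<longleftrightarrow> (\<exists>t\<in>{0<..<1}. \<gamma> e t \<in> X closure_of Collect (connected_off (F \<union> C) s))" for s e
  have dG: "drawing (F \<union> C) \<subseteq> drawing E" by (rule drawing_mono) (use FE CE in blast)
  have "card P \<ge> 3"
  proof -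
    have "6 \<le> h * (h - 1)" using mult_le_mono[of 3 h 2 "h - 1"] h by simp
    then show ?thesis using cardP by simp
  qed
  have three: "3 \<le> card {e \<in> C. Q s e}" if s: "s \<in> S" for s
    unfolding Q_def
  proof (rule face_meets_three[OF FE CE FC finC])
    show "3 \<le> card C" using cardC \<open>card P \<ge> 3\<close> by simp
    show "s \<in> topspace X" "s \<notin> drawing (F \<union> C)" using s S(2) dG by blast+
  qed (rule forest2)
  have two: "card {s \<in> S. Q s e} \<le> 2" if e: "e \<in> C" for e
  proof -
    have ins: "insert e (F \<union> (C - {e})) = F \<union> C" using e by blast
    have "finite {s \<in> S. Q s e} \<and> card {s \<in> S. Q s e} \<le> 2"
    proof (rule edge_at_most_two_faces)
      show "F \<union> (C - {e}) \<subseteq> E" "e \<in> E" "e \<notin> F \<union> (C - {e})" using e FE CE FC by blast+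
      show "{s \<in> S. Q s e} \<subseteq> topspace X - drawing (insert e (F \<union> (C - {e})))"
        unfolding ins using S(2) dG by blast
      show "x = y" if "x \<in> {s \<in> S. Q s e}" "y \<in> {s \<in> S. Q s e}" "connected_off (insert e (F \<union> (C - {e}))) x y" for x y
        using that sep unfolding ins by simp
      show "\<exists>t\<in>{0<..<1}. \<gamma> e t \<in> X closure_of path_component_of_set (subtopology X (topspace X - drawing (insert e (F \<union> (C - {e}))))) x"
        if "x \<in> {s \<in> S. Q s e}" for x
        using that unfolding ins Q_def by simp
    qed
    then show ?thesis by simp
  qed
  \<comment> \<open>Incidences of faces with connecting edges are counted from both sides.\<close>
  have "3 * card S \<le> (\<Sum>s\<in>S. card {e \<in> C. Q s e})"
    using sum_mono[of S "\<lambda>_. 3" "\<lambda>s. card {e \<in> C. Q s e}"] three by simp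
  also have "\<dots> = (\<Sum>e\<in>C. card {s \<in> S. Q s e})"
    by (rule sum_multicount_gen[OF S(1) finC]) simp
  also have "\<dots> \<le> 2 * card C"
    using sum_mono[of C "\<lambda>e. card {s \<in> S. Q s e}" "\<lambda>_. 2"] two by simp
  finally have "3 * card S \<le> 2 * card P" using cardC by simp
  moreover have "Suc (card P) \<le> card S + 2 * g + (h - 1)"
    using cardS b cardR by simp
  ultimately have "card P + 6 \<le> 3 * h + 6 * g" using h by simp
  then show ?thesis using cardP by simp
qed

end

section \<open>Closed orientable surfaces\<close>

lemma homologous_rel_set_mult:
  "homologous_rel_set p X S a \<otimes>\<^bsub>relative_homology_group (int p) X S\<^esub> homologous_rel_set p X S b
    = homologous_rel_set p X S (a + b)"
proof -
  have "\<exists>r s. homologous_rel p X S a r \<and> homologous_rel p X S b s \<and> t = r + s"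
    if "homologous_rel p X S (a + b) t" for t
  proof (intro exI conjI)
    show "homologous_rel p X S b (t - a)"
      using homologous_rel_diff[OF that homologous_rel_refl[of p X S a]] by simp
    show "t = a + (t - a)" by simp
  qed simp
  then show ?thesis
    unfolding mult_relative_homology_group by (auto intro: homologous_rel_add)
qed

lemma homologous_rel_set_pow:
  fixes n :: int
  assumes "singular_relcycle p X S c"
  shows "homologous_rel_set p X S c [^]\<^bsub>relative_homology_group (int p) X S\<^esub> n
    = homologous_rel_set p X S (frag_cmul n c)"
proof -
  have "c \<in> carrier (subgroup_generated (free_Abelian_group (singular_simplex_set p X)) (singular_relcycle_set p X S))"
    by (metis assms carrier_relcycle_group chain_group_def mem_Collect_eq relcycle_group_def)
  moreover have "Poly_Mapping.keys c \<subseteq> singular_simplex_set p X"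
    using assms by (simp add: singular_relcycle singular_chain_def)
  ultimately have ff: "c [^]\<^bsub>relcycle_group p X S\<^esub> n = frag_cmul n c"
    by (simp add: relcycle_group_def chain_group_def group.int_pow_subgroup_generated)
  show ?thesis
    apply (rule subst [OF right_coset_singular_relboundary])
    apply (simp add: ff normal.FactGroup_int_pow normal_subgroup_singular_relboundary_relcycle relative_homology_group_def assms)
    done
qed

lemma homologous_rel_set_carrier:
  "singular_relcycle p X S c \<Longrightarrow> homologous_rel_set p X S c \<in> carrier (relative_homology_group (int p) X S)"
  by (auto simp: carrier_relative_homology_group)

text \<open>Elimination without division: a vector with nonzero last coordinate is the pivot, and
  the others are cross-multiplied against it so that this coordinate cancels.\<close>

lemma int_vectors_dependent:
  fixes v :: "'i \<Rightarrow> nat \<Rightarrow> int"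
  assumes "finite I" "card I > N"
  shows "\<exists>k. (\<exists>i\<in>I. k i \<noteq> 0) \<and> (\<forall>j<N. (\<Sum>i\<in>I. k i * v i j) = 0)"
  using assms
proof (induction N arbitrary: I v)
  case 0
  then obtain i where "i \<in> I" by fastforce
  then show ?case by (intro exI[of _ "\<lambda>_. 1"]) auto
next
  case (Suc N)
  show ?case
  proof (cases "\<forall>i\<in>I. v i N = 0")
    case True
    obtain k where "\<exists>i\<in>I. k i \<noteq> 0" "\<forall>j<N. (\<Sum>i\<in>I. k i * v i j) = 0"
      using Suc.IH[of I v] Suc.prems by auto
    then show ?thesis using True by (intro exI[of _ k]) (auto simp: less_Suc_eq)
  next
    case False
    then obtain a where a: "a \<in> I" "v a N \<noteq> 0" by blast
    let ?J = "I - {a}"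
    define u where "u i j = v a N * v i j - v i N * v a j" for i j
    have "finite ?J" "card ?J > N" using Suc.prems a by auto
    then obtain k where k: "\<exists>i\<in>?J. k i \<noteq> 0" "\<forall>j<N. (\<Sum>i\<in>?J. k i * u i j) = 0"
      using Suc.IH[of ?J u] by auto
    \<comment> \<open>The coefficient of the pivot collects what the cross-multiplication has
      subtracted.\<close>
    define k' where "k' i = (if i = a then - (\<Sum>i\<in>?J. k i * v i N) else v a N * k i)" for i
    have eq: "(\<Sum>i\<in>I. k' i * v i j) = (\<Sum>i\<in>?J. k i * u i j)" for j
    proof -
      have "(\<Sum>i\<in>I. k' i * v i j) = k' a * v a j + (\<Sum>i\<in>?J. k' i * v i j)"
        using Suc.prems(1) a(1) by (rule sum.remove)
      also have "(\<Sum>i\<in>?J. k' i * v i j) = (\<Sum>i\<in>?J. v a N * k i * v i j)"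
        by (rule sum.cong) (auto simp: k'_def)
      also have "k' a * v a j = - (\<Sum>i\<in>?J. k i * v i N * v a j)"
        by (simp add: k'_def sum_distrib_right)
      also have "- (\<Sum>i\<in>?J. k i * v i N * v a j) + (\<Sum>i\<in>?J. v a N * k i * v i j) = (\<Sum>i\<in>?J. k i * u i j)"
        by (simp add: u_def sum_subtractf[symmetric] algebra_simps)
      finally show ?thesis .
    qed
    have "u i N = 0" for i by (simp add: u_def)
    then have "\<forall>j<Suc N. (\<Sum>i\<in>I. k' i * v i j) = 0"
      using k(2) by (auto simp: eq less_Suc_eq)
    moreover have "\<exists>i\<in>I. k' i \<noteq> 0" using k(1) a(2) by (auto simp: k'_def)
    ultimately show ?thesis by blast
  qed
qed

text \<open>The isomorphism turns the classes into \<open>N + 1\<close> vectors with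
  \<open>N\<close> integer coordinates; injectivity pulls a relation among them back to
  homology.\<close>

lemma homology_rank_dependent:
  assumes iso: "homology_group 1 X \<cong> free_Abelian_group {..<N::nat}"
    and w: "\<forall>i<Suc N. singular_relcycle (Suc 0) X {} (w i)"
  shows "\<exists>k. (\<exists>i<Suc N. k i \<noteq> 0) \<and> singular_relboundary (Suc 0) X {} (\<Sum>i<Suc N. frag_cmul (k i) (w i))"
proof -
  let ?H = "relative_homology_group (int (Suc 0)) X {}"
  let ?A = "free_Abelian_group {..<N}"
  let ?c = "homologous_rel_set (Suc 0) X {}"
  obtain \<phi> where \<phi>: "\<phi> \<in> iso ?H ?A" using iso by (auto simp: is_iso_def)
  then have hom: "\<phi> \<in> hom ?H ?A" and inj: "inj_on \<phi> (carrier ?H)" by (auto simp: iso_def bij_betw_def)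
  have carr: "?c a \<in> carrier ?H" if "singular_relcycle (Suc 0) X {} a" for a
    using that by (rule homologous_rel_set_carrier)
  have keys: "Poly_Mapping.keys (\<phi> (?c a)) \<subseteq> {..<N}" if "singular_relcycle (Suc 0) X {} a" for a
    using hom_in_carrier[OF hom carr[OF that]] by (simp add: free_Abelian_group_def)
  have add: "\<phi> (?c (a + b)) = \<phi> (?c a) + \<phi> (?c b)"
    if "singular_relcycle (Suc 0) X {} a" "singular_relcycle (Suc 0) X {} b" for a b
    using hom_mult[OF hom carr[OF that(1)] carr[OF that(2)]] unfolding homologous_rel_set_mult
    by (simp add: free_Abelian_group_def)
  have cmul: "\<phi> (?c (frag_cmul n a)) = frag_cmul n (\<phi> (?c a))" if "singular_relcycle (Suc 0) X {} a" for a n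
    using hom_int_pow[OF hom carr[OF that] group_relative_homology_group group_free_Abelian_group, of n]
      keys[OF that] unfolding homologous_rel_set_pow[OF that] by simp
  have zero: "\<phi> (?c 0) = 0" using cmul[of 0 0] by simp
  have cyc: "singular_relcycle (Suc 0) X {} (\<Sum>i<n. frag_cmul (k i) (w i))" if "n \<le> Suc N" for k n
    by (rule singular_relcycle_sum) (use w that in \<open>auto intro: singular_relcycle_cmul\<close>)
  have sum: "\<phi> (?c (\<Sum>i<n. frag_cmul (k i) (w i))) = (\<Sum>i<n. frag_cmul (k i) (\<phi> (?c (w i))))" if "n \<le> Suc N" for k n
    using that
  proof (induction n)
    case (Suc n)
    then have "singular_relcycle (Suc 0) X {} (w n)" using w by simp
    then show ?case using Suc add[OF cyc[of n k] singular_relcycle_cmul[of _ _ _ "w n" "k n"]] cmul[of "w n"] by simp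
  qed (simp add: zero)
  obtain k where k: "\<exists>i\<in>{..<Suc N}. k i \<noteq> 0"
    "\<forall>j<N. (\<Sum>i\<in>{..<Suc N}. k i * Poly_Mapping.lookup (\<phi> (?c (w i))) j) = 0"
    using int_vectors_dependent[of "{..<Suc N}" N "\<lambda>i. Poly_Mapping.lookup (\<phi> (?c (w i)))"] by auto
  have "(\<Sum>i<Suc N. frag_cmul (k i) (\<phi> (?c (w i)))) = 0"
  proof (rule poly_mapping_eqI)
    fix j
    have "Poly_Mapping.lookup (\<Sum>i<Suc N. frag_cmul (k i) (\<phi> (?c (w i)))) j
        = (\<Sum>i<Suc N. k i * Poly_Mapping.lookup (\<phi> (?c (w i))) j)"
      by (simp only: lookup_sum lookup_frag_cmul)
    also have "\<dots> = 0"
    proof (cases "j < N")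
      case True
      then show ?thesis using k(2) by simp
    next
      case False
      have "Poly_Mapping.lookup (\<phi> (?c (w i))) j = 0" if "i < Suc N" for i
        using keys[of "w i"] w that False by (meson in_keys_iff lessThan_iff subsetD)
      then show ?thesis by simp
    qed
    finally show "Poly_Mapping.lookup (\<Sum>i<Suc N. frag_cmul (k i) (\<phi> (?c (w i)))) j = Poly_Mapping.lookup 0 j" by simp
  qed
  then have "\<phi> (?c (\<Sum>i<Suc N. frag_cmul (k i) (w i))) = \<phi> (?c 0)"
    using sum[of "Suc N" k] zero by simp
  then have "?c (\<Sum>i<Suc N. frag_cmul (k i) (w i)) = ?c 0"
    using inj carr[OF cyc[OF order.refl]] carr[OF singular_relcycle_0] by (auto dest: inj_onD)
  then have "homologous_rel (Suc 0) X {} (\<Sum>i<Suc N. frag_cmul (k i) (w i)) 0"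
    unfolding homologous_rel_set_eq .
  then have "singular_relboundary (Suc 0) X {} (\<Sum>i<Suc N. frag_cmul (k i) (w i))"
    unfolding homologous_rel_def diff_zero .
  then show ?thesis using k(1) by blast
qed

text \<open>Excision reduces to a planar chart, a homeomorphism and a change of base point to the
  plane at the origin, and two dimension steps for complements in Euclidean space to a single
  point.\<close>

lemma surface_local_homology:
  assumes cs: "closed_surface X" and x: "x \<in> topspace X"
  shows "relative_homology_group p X (topspace X - {x}) \<cong> relative_homology_group (p - 2) (Euclidean_space 0) {}"
proof -
  obtain U where U: "openin X U" "x \<in> U" "subtopology X U homeomorphic_space Euclidean_space 2"
    using cs x unfolding closed_surface_def by blast
  have UX: "U \<subseteq> topspace X" using U openin_subset by blast
  have clx: "closedin X {x}"
    using cs x unfolding closed_surface_def by (auto intro: closedin_Hausdorff_singleton)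
  obtain h where h: "homeomorphic_map (subtopology X U) (Euclidean_space 2) h"
    using U(3) unfolding homeomorphic_space by blast
  let ?E = "Euclidean_space 2"
  let ?z = "\<lambda>i::nat. 0::real"
  have "X closure_of (topspace X - U) \<subseteq> X interior_of (topspace X - {x})"
  proof -
    have "closedin X (topspace X - U)" "openin X (topspace X - {x})" using U(1) clx by auto
    then show ?thesis using U(2) by (simp add: closure_of_closedin interior_of_openin) blast
  qed
  from homology_excision_axiom[OF this, of "topspace X" p]
  have "relative_homology_group p (subtopology X (topspace X - (topspace X - U))) (topspace X - {x} - (topspace X - U))
      \<cong> relative_homology_group p (subtopology X (topspace X)) (topspace X - {x})"
    by (auto simp: is_iso_def)
  moreover have "topspace X - (topspace X - U) = U" "topspace X - {x} - (topspace X - U) = U - {x}"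
    using UX by auto
  ultimately have 1: "relative_homology_group p (subtopology X U) (U - {x}) \<cong> relative_homology_group p X (topspace X - {x})"
    by simp
  have topU: "topspace (subtopology X U) = U" using UX by auto
  have hx: "h x \<in> topspace ?E" using h U(2) topU homeomorphic_imp_surjective_map by blast
  have "h ` (U - {x}) = topspace ?E - {h x}"
    using homeomorphic_imp_surjective_map[OF h] homeomorphic_imp_injective_map[OF h] U(2) unfolding topU
    by (auto simp: inj_on_def)
  from homeomorphic_map_relative_homology_iso[OF h _ this, of p]
  have 2: "relative_homology_group p (subtopology X U) (U - {x}) \<cong> relative_homology_group p ?E (topspace ?E - {h x})"
    unfolding topU by (auto simp: is_iso_def)
  have z: "?z \<in> topspace (Euclidean_space n)" for n by (simp add: topspace_Euclidean_space)
  have cl: "closedin (Euclidean_space n) {y}" if "y \<in> topspace (Euclidean_space n)" for n y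
    using that by (intro closedin_Hausdorff_singleton Hausdorff_Euclidean_space)
  \<comment> \<open>Complements of homeomorphic closed sets have isomorphic relative homology, which
    moves \<open>h x\<close> to the origin without a translation.\<close>
  have "subtopology ?E {h x} homeomorphic_space subtopology ?E {?z}"
  proof -
    have "homeomorphic_maps (subtopology ?E {h x}) (subtopology ?E {?z}) (\<lambda>_. ?z) (\<lambda>_. h x)"
      using hx z[of 2] by (auto simp: homeomorphic_maps_def)
    then show ?thesis by (rule homeomorphic_maps_imp_homeomorphic_space)
  qed
  from isomorphic_relative_homology_groups_Euclidean_complements[OF cl[OF hx] cl[OF z] this]
  have 3: "relative_homology_group p ?E (topspace ?E - {h x}) \<cong> relative_homology_group p ?E (topspace ?E - {?z})" .
  have top0: "topspace (Euclidean_space 0) = {?z}" by (auto simp: topspace_Euclidean_space)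
  have "relative_homology_group (p - 2) (Euclidean_space 0) (topspace (Euclidean_space 0) - {?z})
     \<cong> relative_homology_group (p - 2 + int 2) (Euclidean_space (0 + 2)) (topspace (Euclidean_space (0 + 2)) - {?z})"
    by (rule relative_homology_group_Euclidean_complement_step[OF cl[OF z]])
  then have 4: "relative_homology_group (p - 2) (Euclidean_space 0) {}
     \<cong> relative_homology_group p ?E (topspace ?E - {?z})"
    unfolding top0 by (simp add: numeral_2_eq_2)
  have "relative_homology_group p X (topspace X - {x}) \<cong> relative_homology_group p (subtopology X U) (U - {x})"
    by (rule group.iso_sym[OF _ 1]) simp
  also note 2
  also note 3
  also have "relative_homology_group p ?E (topspace ?E - {?z}) \<cong> relative_homology_group (p - 2) (Euclidean_space 0) {}"
    by (rule group.iso_sym[OF _ 4]) simp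
  finally show ?thesis .
qed

section \<open>Local topology: connectedness and dimension\<close>

lemma surface_locally_path_connected:
  assumes cs: "closed_surface X"
  shows "locally_path_connected_space X"
  unfolding locally_path_connected_space
proof (intro allI impI)
  fix N x assume N: "openin X N \<and> x \<in> N"
  then have "x \<in> topspace X" using openin_subset by blast
  then obtain U where U: "openin X U" "x \<in> U" "subtopology X U homeomorphic_space Euclidean_space 2"
    using cs unfolding closed_surface_def by blast
  have "locally_path_connected_space (subtopology X U)"
    using homeomorphic_locally_path_connected_space[OF U(3)] locally_path_connected_Euclidean_space by blast
  moreover have "openin (subtopology X U) (U \<inter> N)" using N U(1) by (simp add: openin_subtopology_Int2)
  ultimately obtain W where W: "openin (subtopology X U) W" "path_connectedin (subtopology X U) W" "x \<in> W" "W \<subseteq> U \<inter> N"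
    using N U(2) unfolding locally_path_connected_space by blast
  then have "openin X W" "path_connectedin X W"
    using U(1) by (auto simp: openin_open_subtopology path_connectedin_subtopology)
  then show "\<exists>U. openin X U \<and> path_connectedin X U \<and> x \<in> U \<and> U \<subseteq> N" using W by blast
qed

text \<open>A chart would turn \<open>q\<close> into a continuous injection of a nonempty open
  subset of the plane into the line, against invariance of dimension.\<close>

lemma surface_no_1d_open:
  assumes cs: "closed_surface X" and N: "openin X N" "N \<noteq> {}"
    and q: "continuous_map (subtopology X N) euclideanreal q" "inj_on q N"
  shows False
proof -
  obtain x where x: "x \<in> N" using N by blast
  then have "x \<in> topspace X" using N openin_subset by blast
  then obtain U where U: "openin X U" "x \<in> U" "subtopology X U homeomorphic_space Euclidean_space 2"
    using cs unfolding closed_surface_def by blast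
  obtain f :: "(nat \<Rightarrow> real) \<Rightarrow> complex" and g where fg: "homeomorphic_maps (Euclidean_space (DIM(complex))) euclidean f g"
    using homeomorphic_maps_Euclidean_space_euclidean .
  then have "Euclidean_space 2 homeomorphic_space (euclidean :: complex topology)"
    using homeomorphic_maps_imp_homeomorphic_space by fastforce
  with U(3) have "subtopology X U homeomorphic_space (euclidean :: complex topology)"
    by (rule homeomorphic_space_trans)
  then obtain h k where hk: "homeomorphic_maps (subtopology X U) (euclidean :: complex topology) h k"
    unfolding homeomorphic_space_def by blast
  let ?S = "h ` (U \<inter> N)"
  have UX: "U \<subseteq> topspace X" using U openin_subset by blast
  have hm: "homeomorphic_map (subtopology X U) (euclidean :: complex topology) h"
    using hk homeomorphic_map_maps by blast
  have "openin (subtopology X U) (U \<inter> N)" using N U(1) by (simp add: openin_subtopology_Int2)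
  then have "open ?S"
    using hm homeomorphic_imp_open_map unfolding open_map_def by fastforce
  moreover have kh: "k (h y) = y" if "y \<in> U" for y
    using hk that UX unfolding homeomorphic_maps_def by auto
  have "continuous_map (top_of_set ?S) (subtopology X N) k"
  proof -
    have "continuous_map euclidean (subtopology X U) k" using hk unfolding homeomorphic_maps_def by blast
    then have "continuous_map (top_of_set ?S) X k"
      by (simp add: continuous_map_from_subtopology continuous_map_in_subtopology)
    moreover have "k ` ?S \<subseteq> N" using kh by auto
    ultimately show ?thesis by (auto simp: continuous_map_in_subtopology)
  qed
  then have "continuous_map (top_of_set ?S) euclideanreal (q \<circ> k)"
    using q(1) by (rule continuous_map_compose)
  then have "continuous_on ?S (q \<circ> k)" by simp
  moreover have "inj_on (q \<circ> k) ?S"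
    using q(2) kh by (auto simp: inj_on_def)
  moreover have "?S \<noteq> {}" using x U by blast
  ultimately have "DIM(complex) \<le> DIM(real)" by (intro invariance_of_dimension[of ?S "q \<circ> k"])
  then show False by simp
qed

text \<open>An arc in a Hausdorff space is embedded by compactness, so the inverse of
  \<open>\<gamma>\<close> would be a continuous injection of \<open>N\<close> into the
  reals.\<close>

lemma surface_arc_empty_interior:
  assumes cs: "closed_surface X" and \<gamma>: "pathin X \<gamma>" "inj_on \<gamma> {0..1}"
    and N: "openin X N" "N \<noteq> {}"
  shows "\<not> N \<subseteq> \<gamma> ` {0..1}"
proof
  assume sub: "N \<subseteq> \<gamma> ` {0..1}"
  have "embedding_map (top_of_set {0..1}) X \<gamma>"
  proof (rule injective_closed_imp_embedding_map)
    show c: "continuous_map (top_of_set {0..1}) X \<gamma>" using \<gamma>(1) by (simp add: pathin_def)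
    show "closed_map (top_of_set {0..1}) X \<gamma>"
      using cs by (intro T1_Spaces.continuous_imp_closed_map c) (auto simp: closed_surface_def compact_space_subtopology)
    show "inj_on \<gamma> (topspace (top_of_set {0..1}))" using \<gamma>(2) by simp
  qed
  then have "homeomorphic_map (top_of_set {0..1}) (subtopology X (\<gamma> ` {0..1})) \<gamma>"
    by (simp add: embedding_map_def)
  then obtain q where q: "homeomorphic_maps (top_of_set {0..1}) (subtopology X (\<gamma> ` {0..1})) \<gamma> q"
    unfolding homeomorphic_map_maps by blast
  then have "continuous_map (subtopology X (\<gamma> ` {0..1})) euclideanreal q"
    by (auto simp: homeomorphic_maps_def continuous_map_in_subtopology)
  then have 1: "continuous_map (subtopology X N) euclideanreal q"
    using sub by (metis continuous_map_from_subtopology_mono)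
  have "inj_on q N"
  proof (rule inj_on_inverseI)
    fix y assume "y \<in> N"
    then have "y \<in> topspace (subtopology X (\<gamma> ` {0..1}))" using sub openin_subset[OF N(1)] by auto
    then show "\<gamma> (q y) = y" using q by (auto simp: homeomorphic_maps_def)
  qed
  with 1 show False using surface_no_1d_open[OF cs N] by blast
qed

lemma surface_singleton_not_open:
  assumes cs: "closed_surface X" and N: "openin X N"
  shows "N \<noteq> {x}"
proof
  assume "N = {x}"
  moreover have "continuous_map (subtopology X N) euclideanreal (\<lambda>_. 0)" by simp
  ultimately show False using surface_no_1d_open[OF cs N] by blast
qed

text \<open>\<open>m x\<close> is a chain representing the generator \<open>\<mu> x\<close>. Local
  homology gives the rest: H_1(X, X - {x}) is the homology of a point in degree -1, hence zero, and
  H_2(X, X - {x}) is that in degree 0, hence infinite cyclic.\<close>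

lemma closed_orientable_surface_oriented:
  assumes cs: "closed_surface X" and orient: "orientable_surface X"
  shows "\<exists>m. oriented_surface X m"
proof -
  have two: "int (Suc (Suc 0)) = 2" by simp
  obtain \<mu> where \<mu>: "\<And>x. x \<in> topspace X \<Longrightarrow> \<mu> x \<in> carrier (relative_homology_group 2 X (topspace X - {x}))"
      and gen: "\<And>x. x \<in> topspace X \<Longrightarrow> subgroup_generated (relative_homology_group 2 X (topspace X - {x})) {\<mu> x}
             = relative_homology_group 2 X (topspace X - {x})"
      and cons: "\<And>x. x \<in> topspace X \<Longrightarrow> \<exists>B. openin X B \<and> x \<in> B \<and>
           (\<exists>\<nu>\<in>carrier (relative_homology_group 2 X (topspace X - B)).
              \<forall>y\<in>B. hom_induced 2 X (topspace X - B) X (topspace X - {y}) id \<nu> = \<mu> y)"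
  proof -
    from orient obtain \<mu> where
       1: "\<forall>x\<in>topspace X. \<mu> x \<in> carrier (relative_homology_group 2 X (topspace X - {x})) \<and>
           subgroup_generated (relative_homology_group 2 X (topspace X - {x})) {\<mu> x}
             = relative_homology_group 2 X (topspace X - {x})"
       and 2: "\<forall>x\<in>topspace X. \<exists>B. openin X B \<and> x \<in> B \<and>
           (\<exists>\<nu>\<in>carrier (relative_homology_group 2 X (topspace X - B)).
              \<forall>y\<in>B. hom_induced 2 X (topspace X - B) X (topspace X - {y}) id \<nu> = \<mu> y)"
      unfolding orientable_surface_def by (elim exE conjE)
    show thesis by (rule that[of \<mu>]) (use 1 2 in simp_all)
  qed
  have "\<exists>c. singular_relcycle (Suc (Suc 0)) X (topspace X - {x}) c \<and> \<mu> x = homologous_rel_set (Suc (Suc 0)) X (topspace X - {x}) c"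
    if "x \<in> topspace X" for x
    using \<mu>[OF that] carrier_relative_homology_group[of "Suc (Suc 0)" X "topspace X - {x}"] unfolding two by auto
  then obtain m where m: "\<And>x. x \<in> topspace X \<Longrightarrow> singular_relcycle (Suc (Suc 0)) X (topspace X - {x}) (m x)"
    and \<mu>m: "\<And>x. x \<in> topspace X \<Longrightarrow> \<mu> x = homologous_rel_set (Suc (Suc 0)) X (topspace X - {x}) (m x)"
    by metis
  have pow: "\<mu> x [^]\<^bsub>relative_homology_group 2 X (topspace X - {x})\<^esub> (n::int)
      = homologous_rel_set (Suc (Suc 0)) X (topspace X - {x}) (frag_cmul n (m x))" if "x \<in> topspace X" for x n
    using homologous_rel_set_pow[OF m[OF that], of n] unfolding two \<mu>m[OF that] .
  have carr: "carrier (relative_homology_group 2 X (topspace X - {x}))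
      = range (\<lambda>n::int. \<mu> x [^]\<^bsub>relative_homology_group 2 X (topspace X - {x})\<^esub> n)" if "x \<in> topspace X" for x
    using group.carrier_subgroup_generated_by_singleton[OF group_relative_homology_group \<mu>[OF that]] gen[OF that] by simp
  have "oriented_surface X m"
  proof
    show "Hausdorff_space X" using cs by (simp add: closed_surface_def)
    show lpc: "locally_path_connected_space X" using cs by (rule surface_locally_path_connected)
    show "path_connected_space X"
      using cs path_connected_eq_connected_space[OF lpc] by (simp add: closed_surface_def)
  next
    fix x c assume x: "x \<in> topspace X" and c: "singular_relcycle (Suc 0) X (topspace X - {x}) c"
    have one: "int (Suc 0) = 1" by simp
    have "relative_homology_group (1 - 2) (Euclidean_space 0) {} \<cong> relative_homology_group 1 X (topspace X - {x})"
      using group.iso_sym[OF _ surface_local_homology[OF cs x, of 1]] by simp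
    moreover have "trivial_group (relative_homology_group (1 - 2) (Euclidean_space 0) {})" by simp
    ultimately have "trivial_group (relative_homology_group 1 X (topspace X - {x}))"
      using isomorphic_group_triviality group_relative_homology_group by metis
    then have "homologous_rel_set (Suc 0) X (topspace X - {x}) c = singular_relboundary_set (Suc 0) X (topspace X - {x})"
      using homologous_rel_set_carrier[OF c] one_relative_homology_group[of "Suc 0" X "topspace X - {x}"]
      unfolding trivial_group_def one by auto
    then show "singular_relboundary (Suc 0) X (topspace X - {x}) c"
      unfolding homologous_rel_set_eq_relboundary .
  next
    fix x assume "x \<in> topspace X"
    then show "singular_relcycle (Suc (Suc 0)) X (topspace X - {x}) (m x)" by (rule m)
  next
    fix x c assume x: "x \<in> topspace X" and c: "singular_relcycle (Suc (Suc 0)) X (topspace X - {x}) c"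
    have "homologous_rel_set (Suc (Suc 0)) X (topspace X - {x}) c \<in> carrier (relative_homology_group 2 X (topspace X - {x}))"
      using homologous_rel_set_carrier[OF c] unfolding two .
    then obtain k where "homologous_rel_set (Suc (Suc 0)) X (topspace X - {x}) c
       = homologous_rel_set (Suc (Suc 0)) X (topspace X - {x}) (frag_cmul k (m x))"
      unfolding carr[OF x] pow[OF x] by blast
    then show "\<exists>k. homologous_rel (Suc (Suc 0)) X (topspace X - {x}) c (frag_cmul k (m x))"
      unfolding homologous_rel_set_eq by blast
  next
    fix x k assume x: "x \<in> topspace X"
      and k: "singular_relboundary (Suc (Suc 0)) X (topspace X - {x}) (frag_cmul k (m x))"
    let ?H = "relative_homology_group 2 X (topspace X - {x})"
    have "?H \<cong> homology_group (2 - 2) (Euclidean_space 0)" by (rule surface_local_homology[OF cs x])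
    also have "homology_group (2 - 2) (Euclidean_space 0) \<cong> integer_group"
      using homology_coefficients[of "Euclidean_space 0" "\<lambda>_. 0"] by (simp add: topspace_Euclidean_space fun_eq_iff set_eq_iff)
    finally obtain \<phi> where \<phi>: "\<phi> \<in> iso ?H integer_group" by (auto simp: is_iso_def)
    then have hom: "\<phi> \<in> hom ?H integer_group" and im: "\<phi> ` carrier ?H = UNIV"
      by (auto simp: iso_def bij_betw_def)
    have \<phi>pow: "\<phi> (\<mu> x [^]\<^bsub>?H\<^esub> n) = n * \<phi> (\<mu> x)" for n :: int
      using hom_int_pow[OF hom \<mu>[OF x] group_relative_homology_group group_integer_group, of n] by simp
    \<comment> \<open>Some multiple of \<open>\<phi> (\<mu> x)\<close> is 1, so the image of the
      generator is nonzero and has infinite order.\<close>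
    have "1 \<in> \<phi> ` carrier ?H" using im by simp
    then obtain n :: int where "1 = n * \<phi> (\<mu> x)" unfolding carr[OF x] by (auto simp: \<phi>pow)
    then have ne: "\<phi> (\<mu> x) \<noteq> 0" by auto
    have "homologous_rel_set (Suc (Suc 0)) X (topspace X - {x}) (frag_cmul k (m x)) = \<one>\<^bsub>?H\<^esub>"
      using k one_relative_homology_group[of "Suc (Suc 0)" X "topspace X - {x}"]
      unfolding two by (simp add: homologous_rel_set_eq_relboundary)
    then have "\<mu> x [^]\<^bsub>?H\<^esub> k = \<one>\<^bsub>?H\<^esub>" unfolding pow[OF x] .
    then have "k * \<phi> (\<mu> x) = \<phi> \<one>\<^bsub>?H\<^esub>" using \<phi>pow[of k] by simp
    moreover have "\<phi> \<one>\<^bsub>?H\<^esub> = \<one>\<^bsub>integer_group\<^esub>"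
      by (rule hom_one[OF hom group_relative_homology_group group_integer_group])
    ultimately show "k = 0" using ne by simp
  next
    fix x assume x: "x \<in> topspace X"
    obtain B \<nu> where B: "openin X B" "x \<in> B" and \<nu>: "\<nu> \<in> carrier (relative_homology_group 2 X (topspace X - B))"
      and hi: "\<And>y. y \<in> B \<Longrightarrow> hom_induced 2 X (topspace X - B) X (topspace X - {y}) id \<nu> = \<mu> y"
      using cons[OF x] by blast
    obtain n where n: "singular_relcycle (Suc (Suc 0)) X (topspace X - B) n"
      "\<nu> = homologous_rel_set (Suc (Suc 0)) X (topspace X - B) n"
      using \<nu> carrier_relative_homology_group[of "Suc (Suc 0)" X "topspace X - B"] unfolding two by auto
    have "homologous_rel (Suc (Suc 0)) X (topspace X - {y}) n (m y)" if y: "y \<in> B" for y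
    proof -
      have yX: "y \<in> topspace X" using y B openin_subset by blast
      have "hom_induced (int (Suc (Suc 0))) X (topspace X - B) X (topspace X - {y}) id \<nu>
          = homologous_rel_set (Suc (Suc 0)) X (topspace X - {y}) (chain_map (Suc (Suc 0)) id n)"
        unfolding n(2) by (rule hom_induced_chain_map) (use n y in auto)
      also have "chain_map (Suc (Suc 0)) id n = n"
        using n(1) by (intro chain_map_ident[of _ X]) (simp add: singular_relcycle)
      finally have eq: "hom_induced 2 X (topspace X - B) X (topspace X - {y}) id \<nu>
          = homologous_rel_set (Suc (Suc 0)) X (topspace X - {y}) n" unfolding two .
      from trans[OF sym[OF eq] hi[OF y]]
      show ?thesis unfolding \<mu>m[OF yX] homologous_rel_set_eq .
    qed
    then show "\<exists>B n. openin X B \<and> x \<in> B \<and> singular_relcycle (Suc (Suc 0)) X (topspace X - B) n \<and>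
            (\<forall>y\<in>B. homologous_rel (Suc (Suc 0)) X (topspace X - {y}) n (m y))"
      using B n(1) by blast
  qed
  then show ?thesis by blast
qed

section \<open>Separators in graphs without a complete minor\<close>

definition inner_edges :: "'a set set \<Rightarrow> 'a set \<Rightarrow> ('a \<times> 'a) set" where
  "inner_edges E U = {(x, y). x \<in> U \<and> y \<in> U \<and> {x, y} \<in> E}"

definition component :: "'a set set \<Rightarrow> 'a set \<Rightarrow> 'a \<Rightarrow> 'a set" where
  "component E U v = {w. (v, w) \<in> (inner_edges E U)\<^sup>*}"

section \<open>Connected vertex sets and components\<close>

lemma connected_in_iff:
  "connected_in E U \<longleftrightarrow> U \<noteq> {} \<and> (\<forall>u\<in>U. \<forall>v\<in>U. (u, v) \<in> (inner_edges E U)\<^sup>*)"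
  by (simp add: connected_in_def inner_edges_def)

lemma inner_edges_sym: "(x, y) \<in> (inner_edges E U)\<^sup>* \<Longrightarrow> (y, x) \<in> (inner_edges E U)\<^sup>*"
  by (rule symD[OF sym_rtrancl]) (auto simp: sym_def inner_edges_def insert_commute)

lemma inner_edges_mono: "U \<subseteq> W \<Longrightarrow> (inner_edges E U)\<^sup>* \<subseteq> (inner_edges E W)\<^sup>*"
  by (rule rtrancl_mono) (auto simp: inner_edges_def)

lemma component_refl: "v \<in> component E U v"
  by (simp add: component_def)

lemma component_subset: "v \<in> U \<Longrightarrow> component E U v \<subseteq> U"
proof
  fix w assume "v \<in> U" "w \<in> component E U v"
  then have "(v, w) \<in> (inner_edges E U)\<^sup>*" by (simp add: component_def)
  then show "w \<in> U"
    by (induction rule: rtrancl_induct) (simp_all add: \<open>v \<in> U\<close> inner_edges_def)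
qed

lemma component_closed:
  assumes "v \<in> U" "x \<in> component E U v" "y \<in> U" "{x, y} \<in> E"
  shows "y \<in> component E U v"
proof -
  have "x \<in> U" using component_subset[OF assms(1)] assms(2) by (rule subsetD)
  then have "(x, y) \<in> inner_edges E U" using assms by (simp add: inner_edges_def)
  with assms(2) show ?thesis unfolding component_def mem_Collect_eq by (rule rtrancl_into_rtrancl)
qed

lemma component_connected:
  assumes "v \<in> U" shows "connected_in E (component E U v)"
proof -
  have root: "(v, w) \<in> (inner_edges E (component E U v))\<^sup>*" if "w \<in> component E U v" for w
  proof -
    have "(v, w) \<in> (inner_edges E U)\<^sup>*" using that by (simp add: component_def)
    then show ?thesis
    proof (induction rule: rtrancl_induct)
      case (step y z)
      have y: "y \<in> component E U v" using step.hyps(1) by (simp add: component_def)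
      have "z \<in> component E U v" using step.hyps by (simp add: component_def)
      with y step.hyps(2) have "(y, z) \<in> inner_edges E (component E U v)" by (simp add: inner_edges_def)
      with step.IH show ?case by (rule rtrancl_into_rtrancl)
    qed simp
  qed
  have "(x, y) \<in> (inner_edges E (component E U v))\<^sup>*" if "x \<in> component E U v" "y \<in> component E U v" for x y
    using rtrancl_trans[OF inner_edges_sym[OF root[OF that(1)]] root[OF that(2)]] .
  then show ?thesis
    unfolding connected_in_iff using component_refl[of v E U] by (intro conjI ballI) auto
qed

lemma connected_in_induct:
  assumes "connected_in E D" "a \<in> D" "b \<in> D" "P a"
    and "\<And>x y. \<lbrakk>x \<in> D; y \<in> D; {x, y} \<in> E; P x\<rbrakk> \<Longrightarrow> P y"
  shows "P b"
proof -
  have "(a, b) \<in> (inner_edges E D)\<^sup>*" using assms(1-3) by (simp add: connected_in_iff)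
  then show ?thesis
    using assms(4)
  proof (induction rule: rtrancl_induct)
    case (step y z)
    then show ?case using assms(5)[of y z] by (simp add: inner_edges_def)
  qed
qed

lemma connected_subset_component:
  assumes "connected_in E D" "D \<subseteq> U" "v \<in> D"
  shows "D \<subseteq> component E U v"
proof
  fix w assume "w \<in> D"
  then have "(v, w) \<in> (inner_edges E D)\<^sup>*" using assms by (simp add: connected_in_iff)
  then show "w \<in> component E U v" using inner_edges_mono[OF assms(2)] by (auto simp: component_def)
qed

lemma connected_in_insert:
  assumes "connected_in E T" "v \<in> T" "{v, w} \<in> E"
  shows "connected_in E (insert w T)"
proof -
  have sub: "(inner_edges E T)\<^sup>* \<subseteq> (inner_edges E (insert w T))\<^sup>*" by (rule inner_edges_mono) blast
  have "(v, w) \<in> inner_edges E (insert w T)" using assms by (simp add: inner_edges_def)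
  then have "(v, w) \<in> (inner_edges E (insert w T))\<^sup>*" by (rule r_into_rtrancl)
  moreover have "(v, x) \<in> (inner_edges E (insert w T))\<^sup>*" if "x \<in> T" for x
    by (rule subsetD[OF sub]) (use assms(1,2) that in \<open>simp add: connected_in_iff\<close>)
  ultimately have root: "(v, x) \<in> (inner_edges E (insert w T))\<^sup>*" if "x \<in> insert w T" for x
    using that by (elim insertE) simp_all
  have "(x, y) \<in> (inner_edges E (insert w T))\<^sup>*" if "x \<in> insert w T" "y \<in> insert w T" for x y
    using rtrancl_trans[OF inner_edges_sym[OF root[OF that(1)]] root[OF that(2)]] .
  then show ?thesis unfolding connected_in_iff by (intro conjI ballI) simp_all
qed

lemma connected_in_singleton: "connected_in E {v}"
  by (simp add: connected_in_iff)

text \<open>A maximal union of components of total size at most \<open>2n/3\<close> is one side of a balanced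
  partition.\<close>

lemma balanced_separator_of_small_components:
  assumes fin: "finite V" and S: "S \<subseteq> V"
    and small: "\<And>v. v \<in> V - S \<Longrightarrow> 3 * card (component E (V - S) v) \<le> 2 * card V"
  shows "balanced_vertex_separator V E S"
proof -
  define U where "U = V - S"
  have finU: "finite U" "card U \<le> card V" using fin by (auto simp: U_def card_mono)
  \<comment> \<open>The unions of components of \<open>V - S\<close> that fit on one side.\<close>
  define closed where "closed A \<longleftrightarrow> A \<subseteq> U \<and> (\<forall>a\<in>A. \<forall>b\<in>U. {a, b} \<in> E \<longrightarrow> b \<in> A) \<and> 3 * card A \<le> 2 * card V" for A
  have "closed {}" by (simp add: closed_def)
  moreover have "\<And>A. closed A \<Longrightarrow> card A \<le> card U" using finU by (auto simp: closed_def card_mono)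
  ultimately have "\<exists>A. closed A \<and> (\<forall>A'. closed A' \<longrightarrow> card A' \<le> card A)"
    by (intro ex_has_greatest_nat[of closed "{}" card "Suc (card U)"]) (simp_all add: less_Suc_eq_le)
  then obtain A where A: "closed A" and max: "\<And>A'. closed A' \<Longrightarrow> card A' \<le> card A"
    by (elim exE conjE) simp
  have AU: "A \<subseteq> U" and Acl: "\<And>a b. \<lbrakk>a \<in> A; b \<in> U; {a, b} \<in> E\<rbrakk> \<Longrightarrow> b \<in> A" and Acard: "3 * card A \<le> 2 * card V"
    using A by (auto simp: closed_def)
  have "3 * card (U - A) \<le> 2 * card V"
  proof (rule ccontr)
    assume big: "\<not> 3 * card (U - A) \<le> 2 * card V"
    have "card (U - A) = card U - card A" "card A \<le> card U"
      using AU finU by (auto simp: card_Diff_subset finite_subset card_mono)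
    \<comment> \<open>If the rest is too large, \<open>A\<close> has fewer than n/3 vertices. A
      component outside \<open>A\<close> cannot be added to it, so that component has more than n/3
      vertices; but it fits on one side alone, against the maximality of \<open>A\<close>.\<close>
    then have Asmall: "3 * card A < card V" using big finU by simp
    have "U - A \<noteq> {}" using big by (intro notI) simp
    then obtain v where v: "v \<in> U - A" by blast
    let ?c = "component E U v"
    have cU: "?c \<subseteq> U" by (rule component_subset) (use v in simp)
    have csmall: "3 * card ?c \<le> 2 * card V" using small v by (simp add: U_def)
    have ccl: "b \<in> ?c" if "a \<in> ?c" "b \<in> U" "{a, b} \<in> E" for a b
      using component_closed[of v U a E b] that v by simp
    have "?c \<inter> A = {}"
    proof -
      have "w \<notin> A" if "w \<in> ?c" for w
      proof (rule connected_in_induct[OF component_connected[of v U E] component_refl that])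
        show "v \<in> U" "v \<notin> A" using v by simp_all
        fix x y assume xy: "x \<in> ?c" "y \<in> ?c" "{x, y} \<in> E" "x \<notin> A"
        have "x \<in> U" using cU xy(1) by (rule subsetD)
        then show "y \<notin> A" using Acl[of y x] xy(3,4) by (metis insert_commute)
      qed
      then show ?thesis by blast
    qed
    then have card: "card (A \<union> ?c) = card A + card ?c"
      using finU AU cU by (simp add: card_Un_disjoint finite_subset inf_commute)
    have "finite ?c" using cU finU(1) by (rule finite_subset)
    then have "card ?c \<noteq> 0" using component_refl[of v E U] by auto
    then have "\<not> closed (A \<union> ?c)" using max[of "A \<union> ?c"] card by auto
    then have "3 * card A + 3 * card ?c > 2 * card V"
      using AU cU Acl ccl card unfolding closed_def by auto
    moreover have "card ?c \<le> card A"
      by (rule max) (use cU ccl csmall in \<open>auto simp: closed_def\<close>)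
    ultimately show False using Asmall by simp
  qed
  then have "real (card (U - A)) \<le> 2 / 3 * real (card V)" "real (card A) \<le> 2 / 3 * real (card V)"
    using Acard by linarith+
  moreover have "no_edges_between E A (U - A)" using Acl by (auto simp: no_edges_between_def)
  ultimately show ?thesis
    unfolding balanced_vertex_separator_def using S AU
    by (intro conjI exI[of _ A] exI[of _ "U - A"]) (auto simp: U_def)
qed

text \<open>A state \<open>(v, i)\<close> records a walk in \<open>B\<close> that ends at \<open>v\<close> and has visited \<open>N 0, \<dots>, N (i - 1)\<close> in this order.\<close>

fun walk_states :: "'a set set \<Rightarrow> 'a set \<Rightarrow> (nat \<Rightarrow> 'a set) \<Rightarrow> nat \<Rightarrow> nat \<Rightarrow> ('a \<times> nat) set" where
  "walk_states E B N k 0 = B \<times> {0}"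
| "walk_states E B N k (Suc t) = walk_states E B N k t
     \<union> {(w, i) | v w i. (v, i) \<in> walk_states E B N k t \<and> w \<in> B \<and> {v, w} \<in> E}
     \<union> {(v, Suc i) | v i. (v, i) \<in> walk_states E B N k t \<and> v \<in> N i \<and> i < k}"

lemma walk_states_mono: "s \<le> t \<Longrightarrow> walk_states E B N k s \<subseteq> walk_states E B N k t"
  by (rule lift_Suc_mono_le[of "walk_states E B N k"]) auto

text \<open>\<open>T\<close> is the set of vertices on the walk. Raising the counter uses a step
  without a new vertex, so \<open>t\<close> steps visit at most \<open>t + 1\<close>
  vertices.\<close>

lemma walk_states_connected:
  assumes "(v, i) \<in> walk_states E B N k t"
  shows "v \<in> B \<and> i \<le> k \<and> (\<exists>T\<subseteq>B. finite T \<and> connected_in E T \<and> v \<in> T \<and> card T \<le> Suc t \<and> (\<forall>j<i. T \<inter> N j \<noteq> {}))"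
  using assms
proof (induction t arbitrary: v i)
  case 0
  then have "v \<in> B" "i = 0" by auto
  then show ?case by (auto intro!: exI[of _ "{v}"] connected_in_singleton)
next
  case (Suc t)
  from Suc.prems consider "(v, i) \<in> walk_states E B N k t"
    | u where "(u, i) \<in> walk_states E B N k t" "v \<in> B" "{u, v} \<in> E"
    | i' where "i = Suc i'" "(v, i') \<in> walk_states E B N k t" "v \<in> N i'" "i' < k"
    by auto
  then show ?case
  proof cases
    case 1
    from Suc.IH[OF this] show ?thesis by (meson le_Suc_eq)
  next
    case 2
    from Suc.IH[OF 2(1)] obtain T where T: "i \<le> k" "T \<subseteq> B" "finite T" "connected_in E T" "u \<in> T"
      "card T \<le> Suc t" "\<forall>j<i. T \<inter> N j \<noteq> {}" by blast
    show ?thesis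
    proof (intro conjI exI[of _ "insert v T"])
      show "connected_in E (insert v T)" using connected_in_insert[OF T(4,5) 2(3)] .
      show "card (insert v T) \<le> Suc (Suc t)" using T card_insert_le_m1[of "Suc (Suc t)" T v] by simp
    qed (use 2 T in auto)
  next
    case 3
    from Suc.IH[OF 3(2)] obtain T where T: "v \<in> B" "T \<subseteq> B" "finite T" "connected_in E T" "v \<in> T"
      "card T \<le> Suc t" "\<forall>j<i'. T \<inter> N j \<noteq> {}" by blast
    then show ?thesis using 3 by (intro conjI exI[of _ T]) (auto simp: less_Suc_eq)
  qed
qed

lemma disjoint_subset_Diff: "A \<subseteq> C \<Longrightarrow> A \<inter> (D - C) = {}"
  by blast

text \<open>Breadth-first search in the states. Counter \<open>k\<close> within \<open>d\<close>
  steps gives \<open>T\<close>. Otherwise the \<open>d\<close> layers \<open>L t\<close> are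
  disjoint subsets of \<open>B \<times> {1..k}\<close>, one of them has at most the average size
  \<open>k * card B / d\<close>, and its projection is \<open>Z\<close>: a connected
  \<open>D\<close> off \<open>Z\<close> that meets all \<open>N i\<close> would pass through all
  counters up to \<open>k\<close> without crossing that layer.\<close>

lemma connected_hitting_or_separating:
  assumes fin: "finite B" and d: "d \<ge> 1"
  shows "(\<exists>T\<subseteq>B. connected_in E T \<and> card T \<le> Suc d \<and> (\<forall>i<k. T \<inter> N i \<noteq> {})) \<or>
    (\<exists>Z\<subseteq>B. d * card Z \<le> k * card B \<and> (\<forall>D\<subseteq>B - Z. connected_in E D \<longrightarrow> (\<exists>i<k. D \<inter> N i = {})))"
proof (cases "\<exists>v. (v, k) \<in> walk_states E B N k d")
  case True
  then obtain v where "(v, k) \<in> walk_states E B N k d" ..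
  from walk_states_connected[OF this] show ?thesis by blast
next
  case False
  define L where "L t = walk_states E B N k (Suc t) - walk_states E B N k t" for t
  have states: "walk_states E B N k t \<subseteq> B \<times> {0..k}" for t
    using walk_states_connected[of _ _ E B N k t] by auto
  have LQ: "L t \<subseteq> B \<times> {1..k}" for t
  proof -
    \<comment> \<open>Counter 0 is filled from the start, so the layers occupy \<open>k\<close>
      counters and not \<open>k + 1\<close>.\<close>
    have 0: "B \<times> {0} \<subseteq> walk_states E B N k t" using walk_states_mono[of 0 t E B N k] by simp
    show ?thesis
    proof (rule subrelI)
      fix v i assume vi: "(v, i) \<in> L t"
      then have "(v, i) \<in> B \<times> {0..k}" using states[of "Suc t"] unfolding L_def by (elim DiffE) (rule subsetD)
      moreover have "i \<noteq> 0"
      proof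
        assume "i = 0"
        with calculation have "(v, i) \<in> B \<times> {0}" by simp
        with 0 have "(v, i) \<in> walk_states E B N k t" by (rule subsetD)
        then show False using vi by (simp add: L_def)
      qed
      ultimately show "(v, i) \<in> B \<times> {1..k}" by simp
    qed
  qed
  have finL: "finite (L t)" for t using finite_subset[OF LQ] fin by simp
  have "\<exists>t<d. d * card (L t) \<le> k * card B"
  proof (rule ccontr)
    assume "\<not> ?thesis"
    then have "(\<Sum>t<d. k * card B) < (\<Sum>t<d. d * card (L t))"
      using d by (intro sum_strict_mono) (auto simp: lessThan_empty_iff)
    then have "k * card B < (\<Sum>t<d. card (L t))" using d by (simp add: sum_distrib_left[symmetric])
    also have "\<dots> = card (\<Union>t<d. L t)"
    proof (rule card_UN_disjoint[symmetric])
      show "\<forall>i\<in>{..<d}. \<forall>j\<in>{..<d}. i \<noteq> j \<longrightarrow> L i \<inter> L j = {}"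
      proof (intro ballI impI)
        fix i j :: nat assume "i \<noteq> j"
        have "L i \<inter> L j = {}" if "i < j" for i j
        proof -
          have "L i \<subseteq> walk_states E B N k (Suc i)" unfolding L_def by (rule Diff_subset)
          also have "\<dots> \<subseteq> walk_states E B N k j" by (rule walk_states_mono) (use that in simp)
          finally have "L i \<subseteq> walk_states E B N k j" .
          then show ?thesis unfolding L_def[of j] by (rule disjoint_subset_Diff)
        qed
        then show "L i \<inter> L j = {}" using \<open>i \<noteq> j\<close> by (metis inf_commute nat_neq_iff)
      qed
    qed (use finL in auto)
    also have "\<dots> \<le> card (B \<times> {1..k})"
      by (rule card_mono) (use fin LQ in auto)
    also have "\<dots> = k * card B" by (simp add: card_cartesian_product)
    finally show False by simp
  qed
  then obtain t where t: "t < d" "d * card (L t) \<le> k * card B" by blast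
  define Z where "Z = fst ` L t"
  have ZB: "Z \<subseteq> B" using LQ[of t] by (auto simp: Z_def)
  have "card Z \<le> card (L t)" unfolding Z_def using finL by (rule card_image_le)
  then have cardZ: "d * card Z \<le> k * card B" using t(2) by (meson le_trans mult_le_mono2)
  have "\<exists>i<k. D \<inter> N i = {}" if D: "D \<subseteq> B - Z" "connected_in E D" for D
  proof (rule ccontr)
    assume neg: "\<not> ?thesis"
    \<comment> \<open>Over vertices off \<open>Z\<close> the search adds nothing at time
      \<open>t\<close>, so the states over \<open>D\<close> are closed under both kinds of
      moves.\<close>
    have stay: "(v, i) \<in> walk_states E B N k t" if "v \<in> D" "(v, i) \<in> walk_states E B N k (Suc t)" for v i
    proof (rule ccontr)
      assume "(v, i) \<notin> walk_states E B N k t"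
      then have "(v, i) \<in> L t" using that by (simp add: L_def)
      then have "v \<in> Z" unfolding Z_def by force
      then show False using that D by blast
    qed
    have "\<forall>v\<in>D. (v, i) \<in> walk_states E B N k t" if "i \<le> k" for i
      using that
    proof (induction i)
      case 0
      then show ?case using walk_states_mono[of 0 t E B N k] D by auto
    next
      case (Suc i)
      then obtain u where u: "u \<in> D" "u \<in> N i" using neg by (meson Suc_le_eq disjoint_iff)
      then have "(u, i) \<in> walk_states E B N k t" using Suc by simp
      then have "(u, Suc i) \<in> walk_states E B N k (Suc t)" using u Suc.prems by auto
      then have base: "(u, Suc i) \<in> walk_states E B N k t" using stay u by blast
      show ?case
      proof
        fix v assume "v \<in> D"
        show "(v, Suc i) \<in> walk_states E B N k t"
        proof (rule connected_in_induct[where P = "\<lambda>v. (v, Suc i) \<in> walk_states E B N k t",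
              OF D(2) u(1) \<open>v \<in> D\<close> base])
          fix x y assume xy: "x \<in> D" "y \<in> D" "{x, y} \<in> E" "(x, Suc i) \<in> walk_states E B N k t"
          then have "(y, Suc i) \<in> walk_states E B N k (Suc t)" using D by auto
          then show "(y, Suc i) \<in> walk_states E B N k t" using stay xy by blast
        qed
      qed
    qed
    then have "\<forall>v\<in>D. (v, k) \<in> walk_states E B N k t" by simp
    moreover have "D \<noteq> {}" using D by (simp add: connected_in_iff)
    ultimately show False using False walk_states_mono[of t d E B N k] t(1) by fastforce
  qed
  then show ?thesis using ZB cardZ by blast
qed

text \<open>The sets \<open>C 0, \<dots>, C (k - 1)\<close> are the branch sets of a \<open>K\<^sub>k\<close>-minor, and the large connected set \<open>B\<close>
  is attached to the rest of the graph only through the small sets \<open>X i \<subseteq> C i\<close>.\<close>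

definition partial_minor :: "'a set \<Rightarrow> 'a set set \<Rightarrow> nat \<Rightarrow> nat \<Rightarrow> (nat \<Rightarrow> 'a set) \<Rightarrow> (nat \<Rightarrow> 'a set) \<Rightarrow> 'a set \<Rightarrow> bool" where
  "partial_minor V E R k C X B \<longleftrightarrow>
     (\<forall>i<k. C i \<subseteq> V \<and> connected_in E (C i) \<and> X i \<subseteq> C i \<and> card (X i) \<le> R \<and> B \<inter> C i = {}) \<and>
     (\<forall>i<k. \<forall>j<k. i \<noteq> j \<longrightarrow> C i \<inter> C j = {} \<and> (\<exists>u\<in>C i. \<exists>v\<in>C j. {u, v} \<in> E)) \<and>
     B \<subseteq> V \<and> connected_in E B \<and> 2 * card V < 3 * card B \<and>
     (\<forall>b\<in>B. \<forall>v\<in>V - B. {b, v} \<in> E \<longrightarrow> (\<exists>i<k. v \<in> X i))"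

text \<open>A walk in \<open>D\<close> that starts in \<open>B\<close> could leave \<open>B\<close>
  only through some \<open>X i\<close>.\<close>

lemma partial_minor_absorb:
  assumes pm: "partial_minor V E R k C X B" and D: "connected_in E D" "D \<subseteq> V" "D \<inter> B \<noteq> {}" "\<And>i. i < k \<Longrightarrow> D \<inter> X i = {}"
  shows "D \<subseteq> B"
proof
  obtain b where b: "b \<in> D" "b \<in> B" using D(3) by blast
  fix v assume v: "v \<in> D"
  show "v \<in> B"
  proof (rule connected_in_induct[where P = "\<lambda>v. v \<in> B", OF D(1) b(1) v b(2)])
    fix x y assume xy: "x \<in> D" "y \<in> D" "{x, y} \<in> E" "x \<in> B"
    show "y \<in> B"
    proof (rule ccontr)
      assume "y \<notin> B"
      then obtain i where "i < k" "y \<in> X i"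
        using pm xy D(2) unfolding partial_minor_def by (meson Diff_iff subsetD)
      then show False using D(4) xy(2) by blast
    qed
  qed
qed

lemma large_subsets_meet:
  assumes "finite V" "A \<subseteq> V" "B \<subseteq> V" "2 * card V < 3 * card A" "2 * card V < 3 * card B"
  shows "A \<inter> B \<noteq> {}"
proof
  assume "A \<inter> B = {}"
  then have "card (A \<union> B) = card A + card B"
    using assms finite_subset by (intro card_Un_disjoint) blast+
  moreover have "card (A \<union> B) \<le> card V" using assms by (intro card_mono) auto
  ultimately show False using assms by linarith
qed

lemma partial_minor_complete:
  assumes pm: "partial_minor V E R h C X B"
  shows "is_minor {..<h} (complete_edges {..<h}) V E"
proof -
  have "x \<noteq> y" if "{x, y} \<in> complete_edges {..<h}" for x y :: nat
    using that by (auto simp: complete_edges_def doubleton_eq_iff)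
  then show ?thesis
    using pm unfolding is_minor_def partial_minor_def
    by (intro exI[of _ C]) simp
qed

text \<open>The measure orders the pairs of \<open>card B\<close> and \<open>k\<close>
  lexicographically, since \<open>k \<le> h\<close>. \<open>R\<close> bounds each guard
  \<open>X i\<close>: a new branch set has at most \<open>d + 1\<close> vertices, and
  \<open>d * card Z \<le> k * card B \<le> h * card V \<le> d * R\<close> bounds a separating set.
  All guards and one more such set have at most \<open>(k + 1) * R \<le> h * R\<close> vertices, so
  \<open>big\<close> applies to them.\<close>

lemma partial_minor_descent:
  assumes fin: "finite V" and d: "d \<ge> 1" and dR: "Suc d \<le> R" "h * card V \<le> d * R"
    and big: "\<And>S. S \<subseteq> V \<Longrightarrow> card S \<le> h * R \<Longrightarrow> \<exists>v\<in>V - S. 2 * card V < 3 * card (component E (V - S) v)"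
    and pm: "partial_minor V E R k C X B" and k: "k < h"
  shows "\<exists>k' C' X' B'. partial_minor V E R k' C' X' B' \<and> k' \<le> h \<and> card B' * Suc h + k' < card B * Suc h + k"
proof -
  have C: "C i \<subseteq> V" "connected_in E (C i)" "X i \<subseteq> C i" "card (X i) \<le> R" "B \<inter> C i = {}" if "i < k" for i
    using pm that unfolding partial_minor_def by blast+
  have CC: "C i \<inter> C j = {}" "\<exists>u\<in>C i. \<exists>v\<in>C j. {u, v} \<in> E" if "i < k" "j < k" "i \<noteq> j" for i j
    using pm that unfolding partial_minor_def by blast+
  have B: "B \<subseteq> V" "connected_in E B" "2 * card V < 3 * card B"
    using pm unfolding partial_minor_def by blast+
  have bd: "\<exists>i<k. v \<in> X i" if "b \<in> B" "v \<in> V" "v \<notin> B" "{b, v} \<in> E" for b v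
    using pm that unfolding partial_minor_def by blast
  have finB: "finite B" using B(1) fin by (rule finite_subset)
  define XX where "XX = (\<Union>i<k. X i)"
  have XXV: "XX \<subseteq> V" unfolding XX_def using C(1,3) by blast
  have finX: "finite (X i)" if "i < k" for i
    using C(1,3)[OF that] fin by (meson finite_subset)
  have cardXX: "card XX \<le> k * R"
  proof -
    have "card XX \<le> (\<Sum>i<k. card (X i))" unfolding XX_def by (rule card_UN_le) simp
    also have "\<dots> \<le> (\<Sum>i<k. R)" by (rule sum_mono) (use C(4) in simp)
    finally show ?thesis by simp
  qed
  have sep: "\<exists>v\<in>V - (XX \<union> T). 2 * card V < 3 * card (component E (V - (XX \<union> T)) v)"
    if "T \<subseteq> B" "card T \<le> R" for T
  proof (rule big)
    show "XX \<union> T \<subseteq> V" using XXV that B by blast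
    have "card (XX \<union> T) \<le> card XX + card T" by (rule card_Un_le)
    also have "\<dots> \<le> Suc k * R" using cardXX that by simp
    also have "\<dots> \<le> h * R" using k by (intro mult_le_mono1) simp
    finally show "card (XX \<union> T) \<le> h * R" .
  qed
  \<comment> \<open>The large component meets \<open>B\<close>, as any two sets of more than 2n/3
    vertices do, and cannot leave \<open>B\<close> because it avoids all guards.\<close>
  have sepB: "component E (V - (XX \<union> T)) v \<subseteq> B - T"
    if "v \<in> V - (XX \<union> T)" "2 * card V < 3 * card (component E (V - (XX \<union> T)) v)" for T v
  proof -
    have sub: "component E (V - (XX \<union> T)) v \<subseteq> V - (XX \<union> T)" using that(1) by (rule component_subset)
    have "component E (V - (XX \<union> T)) v \<subseteq> B"
    proof (rule partial_minor_absorb[OF pm component_connected[OF that(1)]])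
      show V: "component E (V - (XX \<union> T)) v \<subseteq> V" using sub by blast
      show "component E (V - (XX \<union> T)) v \<inter> B \<noteq> {}"
        by (rule large_subsets_meet[OF fin V B(1) that(2) B(3)])
      show "component E (V - (XX \<union> T)) v \<inter> X i = {}" if "i < k" for i
        using sub that unfolding XX_def by blast
    qed
    then show ?thesis using sub by blast
  qed
  define N where "N i = {b \<in> B. \<exists>c\<in>C i. {b, c} \<in> E}" for i
  consider (hit) T where "T \<subseteq> B" "connected_in E T" "card T \<le> Suc d" "\<forall>i<k. T \<inter> N i \<noteq> {}"
    | (sep) Z where "Z \<subseteq> B" "d * card Z \<le> k * card B" "\<forall>D\<subseteq>B - Z. connected_in E D \<longrightarrow> (\<exists>i<k. D \<inter> N i = {})"
    using connected_hitting_or_separating[OF finB d, of E k N] by (elim disjE exE conjE)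
  then show ?thesis
  proof cases
    case hit
    have cardT: "card T \<le> R" using hit(3) dR(1) by simp
    obtain v where v: "v \<in> V - (XX \<union> T)" "2 * card V < 3 * card (component E (V - (XX \<union> T)) v)"
      using sep[OF hit(1) cardT] by (elim bexE)
    define B' where "B' = component E (V - (XX \<union> T)) v"
    have B': "B' \<subseteq> B - T" unfolding B'_def using v by (rule sepB)
    have adjT: "\<exists>u\<in>T. \<exists>w\<in>C i. {u, w} \<in> E" if "i < k" for i
      using hit(4) that unfolding N_def by blast
    have "T \<noteq> {}" using hit(2) by (simp add: connected_in_iff)
    then have "B' \<subset> B" using B' hit(1) by blast
    then have less: "card B' < card B" using finB by (rule psubset_card_mono[rotated])
    let ?C = "C(k := T)" and ?X = "X(k := T)"
    \<comment> \<open>\<open>T\<close> touches every branch set, so it becomes a new one, small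
      enough to be its own guard.\<close>
    have "partial_minor V E R (Suc k) ?C ?X B'"
      unfolding partial_minor_def
    proof (intro conjI allI impI ballI)
      fix i assume i: "i < Suc k"
      show "?C i \<subseteq> V" "connected_in E (?C i)" "?X i \<subseteq> ?C i" "card (?X i) \<le> R"
        using i C[of i] hit(2) order.trans[OF hit(1) B(1)] cardT by (cases "i = k"; simp)+
      show "B' \<inter> ?C i = {}" using i C(5) B' by (auto simp: less_Suc_eq)
      fix j assume j: "j < Suc k" and ij: "i \<noteq> j"
      show "?C i \<inter> ?C j = {}"
      proof -
        have "T \<inter> C l = {}" "C l \<inter> T = {}" if "l < k" for l using C(5)[OF that] hit(1) by blast+
        then show ?thesis using i j ij CC(1)[of i j] by (auto simp only: less_Suc_eq fun_upd_apply split: if_split)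
      qed
      show "\<exists>u\<in>?C i. \<exists>v\<in>?C j. {u, v} \<in> E"
      proof (cases "i = k")
        case True
        then show ?thesis using adjT[of j] j ij by simp
      next
        case False
        then have ik: "i < k" using i by simp
        show ?thesis
        proof (cases "j = k")
          case True
          obtain u w where "u \<in> T" "w \<in> C i" "{u, w} \<in> E" using adjT[OF ik] by (elim bexE)
          then have "{w, u} \<in> E" by (simp add: insert_commute)
          then show ?thesis using True ik \<open>u \<in> T\<close> \<open>w \<in> C i\<close> by auto
        next
          case False
          then show ?thesis using CC(2)[of i j] ik j ij by simp
        qed
      qed
    next
      show "B' \<subseteq> V" using B' B(1) by blast
      show "connected_in E B'" unfolding B'_def using v(1) by (rule component_connected)
      show "2 * card V < 3 * card B'" unfolding B'_def by (rule v(2))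
    next
      fix b w assume b: "b \<in> B'" and w: "w \<in> V - B'" and e: "{b, w} \<in> E"
      have "w \<in> XX \<union> T"
      proof (rule ccontr)
        assume "w \<notin> XX \<union> T"
        then have "w \<in> component E (V - (XX \<union> T)) v"
          by (intro component_closed[OF v(1) b[unfolded B'_def] _ e]) (use w in simp)
        then show False using w by (simp add: B'_def)
      qed
      then show "\<exists>i<Suc k. w \<in> ?X i"
      proof
        assume "w \<in> XX"
        then obtain i where "i < k" "w \<in> X i" unfolding XX_def by blast
        then show ?thesis by (intro exI[of _ i]) simp
      next
        assume "w \<in> T"
        then show ?thesis by (intro exI[of _ k]) simp
      qed
    qed
    moreover have "card B' * Suc h + Suc k < card B * Suc h + k"
    proof -
      have "Suc (card B') * Suc h \<le> card B * Suc h" using less by (intro mult_le_mono1) simp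
      then show ?thesis using k by simp
    qed
    ultimately show ?thesis using k by (intro exI[of _ "Suc k"] exI[of _ ?C] exI[of _ ?X] exI[of _ B']) simp
  next
    case sep': sep
    have "d * card Z \<le> d * R"
    proof -
      have "k * card B \<le> h * card V" using k B(1) fin by (intro mult_le_mono card_mono) auto
      with sep'(2) dR(2) show ?thesis by (meson le_trans)
    qed
    then have cardZ: "card Z \<le> R" using d by simp
    obtain v where v: "v \<in> V - (XX \<union> Z)" "2 * card V < 3 * card (component E (V - (XX \<union> Z)) v)"
      using sep[OF sep'(1) cardZ] by (elim bexE)
    define D where "D = component E (V - (XX \<union> Z)) v"
    have DB: "D \<subseteq> B - Z" unfolding D_def using v by (rule sepB)
    have Dcon: "connected_in E D" unfolding D_def using v(1) by (rule component_connected)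
    have vD: "v \<in> D" unfolding D_def by (rule component_refl)
    obtain i where i: "i < k" "D \<inter> N i = {}" using sep'(3) DB Dcon by blast
    show ?thesis
    proof (cases "N i = {}")
      case True
      \<comment> \<open>Branch set \<open>i\<close> has no neighbour in \<open>B\<close> and is
        dropped; the last one takes over its index.\<close>
      define s where "s j = (if j = i then k - 1 else j)" for j
      have s: "s j < k" "s j \<noteq> i" if "j < k - 1" for j using that i(1) by (auto simp: s_def)
      have sinj: "s j \<noteq> s l" if "j < k - 1" "l < k - 1" "j \<noteq> l" for j l using that by (auto simp: s_def)
      have "partial_minor V E R (k - 1) (C \<circ> s) (X \<circ> s) B"
        unfolding partial_minor_def
      proof (intro conjI allI impI ballI)
        fix j assume j: "j < k - 1"
        show "(C \<circ> s) j \<subseteq> V" "connected_in E ((C \<circ> s) j)" "(X \<circ> s) j \<subseteq> (C \<circ> s) j" "card ((X \<circ> s) j) \<le> R"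
          "B \<inter> (C \<circ> s) j = {}"
          using C[OF s(1)[OF j]] by simp_all
        fix l assume l: "l < k - 1" "j \<noteq> l"
        show "(C \<circ> s) j \<inter> (C \<circ> s) l = {}" "\<exists>u\<in>(C \<circ> s) j. \<exists>v\<in>(C \<circ> s) l. {u, v} \<in> E"
          using CC[OF s(1)[OF j] s(1)[OF l(1)] sinj[OF j l]] by simp_all
      next
        fix b w assume b: "b \<in> B" and w: "w \<in> V - B" and e: "{b, w} \<in> E"
        obtain j where j: "j < k" "w \<in> X j" using bd[OF b _ _ e] w by auto
        have "j \<noteq> i"
        proof
          assume "j = i"
          then have "w \<in> C i" using j C(3)[OF i(1)] by blast
          then have "b \<in> N i" unfolding N_def using b e by blast
          then show False using True by blast
        qed
        then have "s (if j = k - 1 then i else j) = j" "(if j = k - 1 then i else j) < k - 1"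
          using j(1) i(1) by (auto simp: s_def)
        then show "\<exists>j<k - 1. w \<in> (X \<circ> s) j" using j(2) by (intro exI[of _ "if j = k - 1 then i else j"]) simp
      qed (use B in auto)
      then show ?thesis using i(1) k by (intro exI[of _ "k - 1"] exI[of _ "C \<circ> s"] exI[of _ "X \<circ> s"] exI[of _ B]) simp
    next
      case False
      \<comment> \<open>The part of \<open>B - D\<close> that can be reached from the neighbours of
        \<open>C i\<close>; \<open>C i\<close> absorbs it and stays connected.\<close>
      define M where "M = {b. \<exists>u\<in>N i. (u, b) \<in> (inner_edges E (B - D))\<^sup>*}"
      have Nsub: "N i \<subseteq> B - D" using i(2) unfolding N_def by blast
      have NM: "N i \<subseteq> M" unfolding M_def by blast
      have MB: "M \<subseteq> B - D"
      proof
        fix b assume "b \<in> M"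
        then obtain u where u: "u \<in> N i" "(u, b) \<in> (inner_edges E (B - D))\<^sup>*" unfolding M_def by auto
        have "b \<in> component E (B - D) u" using u(2) by (simp add: component_def)
        then show "b \<in> B - D" using component_subset[of u "B - D" E] Nsub u(1) by blast
      qed
      have Mcl: "w \<in> M" if "b \<in> M" "w \<in> B - D" "{b, w} \<in> E" for b w
      proof -
        obtain u where u: "u \<in> N i" "(u, b) \<in> (inner_edges E (B - D))\<^sup>*" using \<open>b \<in> M\<close> unfolding M_def by auto
        have "(b, w) \<in> inner_edges E (B - D)" using that MB by (auto simp: inner_edges_def)
        with u(2) have "(u, w) \<in> (inner_edges E (B - D))\<^sup>*" by (rule rtrancl_into_rtrancl)
        then show ?thesis using u(1) unfolding M_def by auto
      qed
      define B' where "B' = component E (B - M) v"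
      have vBM: "v \<in> B - M" using vD DB MB by blast
      have DB': "D \<subseteq> B'"
        unfolding B'_def by (rule connected_subset_component[OF Dcon _ vD]) (use DB MB in blast)
      have B'sub: "B' \<subseteq> B - M" unfolding B'_def using vBM by (rule component_subset)
      define Ci where "Ci = C i \<union> M"
      have Cicon: "connected_in E Ci"
      proof -
        obtain c0 where c0: "c0 \<in> C i" using C(2)[OF i(1)] by (auto simp: connected_in_iff)
        have sub1: "(inner_edges E (C i))\<^sup>* \<subseteq> (inner_edges E Ci)\<^sup>*" by (rule inner_edges_mono) (simp add: Ci_def)
        have root0: "(c0, x) \<in> (inner_edges E Ci)\<^sup>*" if "x \<in> C i" for x
          by (rule subsetD[OF sub1]) (use C(2)[OF i(1)] c0 that in \<open>simp add: connected_in_iff\<close>)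
        have rootN: "(c0, x) \<in> (inner_edges E Ci)\<^sup>*" if x: "x \<in> N i" for x
        proof -
          obtain c where c: "c \<in> C i" "{x, c} \<in> E" using x unfolding N_def by blast
          have "(c, x) \<in> inner_edges E Ci" using c x NM by (auto simp: inner_edges_def Ci_def insert_commute)
          with root0[OF c(1)] show ?thesis by (rule rtrancl_into_rtrancl)
        qed
        have rootM: "(c0, x) \<in> (inner_edges E Ci)\<^sup>*" if x: "x \<in> M" for x
        proof -
          obtain u where u: "u \<in> N i" "(u, x) \<in> (inner_edges E (B - D))\<^sup>*" using x unfolding M_def by auto
          have "(u, x) \<in> (inner_edges E Ci)\<^sup>* \<and> x \<in> M" using u(2)
          proof (induction rule: rtrancl_induct)
            case base
            then show ?case using u(1) NM by blast
          next
            case (step y z)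
            then have yz: "y \<in> M" "z \<in> B - D" "{y, z} \<in> E" by (auto simp: inner_edges_def)
            have z: "z \<in> M" using Mcl[OF yz] .
            then have "(y, z) \<in> inner_edges E Ci" using yz by (simp add: inner_edges_def Ci_def)
            then show ?case using step.IH z by (meson rtrancl_into_rtrancl)
          qed
          then show ?thesis using rtrancl_trans[OF rootN[OF u(1)]] by simp
        qed
        have root: "(c0, x) \<in> (inner_edges E Ci)\<^sup>*" if "x \<in> Ci" for x
          using that root0 rootM unfolding Ci_def by (elim UnE) simp_all
        have "(x, y) \<in> (inner_edges E Ci)\<^sup>*" if "x \<in> Ci" "y \<in> Ci" for x y
          using rtrancl_trans[OF inner_edges_sym[OF root[OF that(1)]] root[OF that(2)]] .
        moreover have "Ci \<noteq> {}" using c0 unfolding Ci_def by blast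
        ultimately show ?thesis unfolding connected_in_iff by (intro conjI ballI) simp_all
      qed
      \<comment> \<open>The guard of the enlarged set is \<open>Z \<inter> M\<close>: an edge from
        \<open>B'\<close> into \<open>M\<close> starts in \<open>D\<close>, since \<open>M\<close>
        is closed in \<open>B - D\<close>, and an edge that leaves \<open>D\<close> inside
        \<open>B\<close> ends in \<open>Z\<close>. The old guard \<open>X i\<close> has no neighbour
        in \<open>B'\<close>, because its neighbours in \<open>B\<close> lie in
        \<open>M\<close>.\<close>
      let ?C = "C(i := Ci)" and ?X = "X(i := Z \<inter> M)"
      have "partial_minor V E R k ?C ?X B'"
        unfolding partial_minor_def
      proof (intro conjI allI impI ballI)
        fix j assume j: "j < k"
        show "?C j \<subseteq> V" using C(1)[OF j] C(1)[OF i(1)] MB B(1) unfolding Ci_def by auto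
        show "connected_in E (?C j)" using C(2)[OF j] Cicon by simp
        show "?X j \<subseteq> ?C j" using C(3)[OF j] unfolding Ci_def by auto
        have "card (Z \<inter> M) \<le> card Z" using sep'(1) finB by (meson card_mono finite_subset inf_le1)
        then show "card (?X j) \<le> R" using C(4)[OF j] cardZ by simp
        show "B' \<inter> ?C j = {}" using C(5)[OF j] C(5)[OF i(1)] B'sub unfolding Ci_def by auto
        fix l assume l: "l < k" and jl: "j \<noteq> l"
        have MC: "M \<inter> C l = {}" if "l < k" for l using C(5)[OF that] MB by blast
        show "?C j \<inter> ?C l = {}"
          using CC(1)[OF j l jl] MC[OF j] MC[OF l] jl unfolding Ci_def by auto
        have sub: "C j \<subseteq> ?C j" "C l \<subseteq> ?C l" unfolding Ci_def by auto
        show "\<exists>u\<in>?C j. \<exists>v\<in>?C l. {u, v} \<in> E"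
          using CC(2)[OF j l jl] subsetD[OF sub(1)] subsetD[OF sub(2)] by (elim bexE) blast
      next
        show "B' \<subseteq> V" using B'sub B(1) by blast
        show "connected_in E B'" unfolding B'_def using vBM by (rule component_connected)
        have "card D \<le> card B'" using DB' B'sub finB by (meson card_mono finite_Diff finite_subset)
        then show "2 * card V < 3 * card B'" using v(2) unfolding D_def by simp
      next
        fix b w assume b: "b \<in> B'" and w: "w \<in> V - B'" and e: "{b, w} \<in> E"
        have bB: "b \<in> B" "b \<notin> M" using b B'sub by auto
        show "\<exists>j<k. w \<in> ?X j"
        proof (cases "w \<in> B")
          case False
          then obtain j where j: "j < k" "w \<in> X j" using bd[OF bB(1) _ _ e] w by auto
          have "j \<noteq> i"
          proof
            assume "j = i"
            then have "w \<in> C i" using j C(3)[OF i(1)] by blast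
            then have "b \<in> N i" unfolding N_def using bB(1) e by blast
            then show False using NM bB(2) by blast
          qed
          then show ?thesis using j by (intro exI[of _ j]) simp
        next
          case True
          have wM: "w \<in> M"
          proof (rule ccontr)
            assume "w \<notin> M"
            then have "w \<in> component E (B - M) v"
              by (intro component_closed[OF vBM b[unfolded B'_def] _ e]) (use True in simp)
            then show False using w by (simp add: B'_def)
          qed
          have "b \<in> D"
          proof (rule ccontr)
            assume "b \<notin> D"
            then have "b \<in> M" using Mcl[OF wM, of b] bB(1) e by (simp add: insert_commute)
            then show False using bB(2) by simp
          qed
          have "w \<notin> D" using wM MB by blast
          have "w \<in> XX \<union> Z"
          proof (rule ccontr)
            assume "w \<notin> XX \<union> Z"
            then have "w \<in> D" unfolding D_def
              by (intro component_closed[OF v(1) \<open>b \<in> D\<close>[unfolded D_def] _ e]) (use w in simp)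
            then show False using \<open>w \<notin> D\<close> by simp
          qed
          moreover have "w \<notin> XX" unfolding XX_def using True C(3,5) by blast
          ultimately have "w \<in> Z \<inter> M" using wM by blast
          then show ?thesis using i(1) by (intro exI[of _ i]) simp
        qed
      qed
      moreover have "B' \<subset> B" using B'sub False NM Nsub by blast
      then have "card B' < card B" using finB by (rule psubset_card_mono[rotated])
      then have "card B' * Suc h + k < card B * Suc h + k"
        by (intro add_strict_right_mono mult_strict_right_mono) simp_all
      ultimately show ?thesis using k by (intro exI[of _ k] exI[of _ ?C] exI[of _ ?X] exI[of _ B']) simp
    qed
  qed
qed

text \<open>Without a separator every small set leaves a large component, so each partial minor with
  at most \<open>h\<close> branch sets has a smaller successor; \<open>k = h\<close> is excluded as
  a complete minor. The descent starts from no branch sets and a large component of the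
  graph.\<close>

lemma minor_free_separator:
  assumes fin: "finite V" and free: "complete_minor_free h V E" and d: "d \<ge> 1"
    and dR: "Suc d \<le> R" "h * card V \<le> d * R"
  shows "\<exists>S. balanced_vertex_separator V E S \<and> card S \<le> h * R"
proof (rule ccontr)
  assume neg: "\<not> ?thesis"
  have big: "\<exists>v\<in>V - S. 2 * card V < 3 * card (component E (V - S) v)" if "S \<subseteq> V" "card S \<le> h * R" for S
  proof (rule ccontr)
    assume n: "\<not> ?thesis"
    have "balanced_vertex_separator V E S"
      by (rule balanced_separator_of_small_components[OF fin that(1)]) (use n in \<open>auto simp: not_less\<close>)
    then show False using neg that(2) by blast
  qed
  have none: "\<not> partial_minor V E R k C X B" if "k \<le> h" for k C X B
    using that
  proof (induction "card B * Suc h + k" arbitrary: k C X B rule: less_induct)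
    case less
    show ?case
    proof
      assume pm: "partial_minor V E R k C X B"
      have "k \<noteq> h" using partial_minor_complete[of V E R h C X B] pm free unfolding complete_minor_free_def by blast
      then have "k < h" using less.prems by simp
      from partial_minor_descent[OF fin d dR big pm this]
      obtain k' C' X' B' where "partial_minor V E R k' C' X' B'" "k' \<le> h" "card B' * Suc h + k' < card B * Suc h + k"
        by blast
      then show False using less.hyps by blast
    qed
  qed
  obtain v where v: "v \<in> V" "2 * card V < 3 * card (component E V v)" using big[of "{}"] by auto
  have "partial_minor V E R 0 (\<lambda>_. {}) (\<lambda>_. {}) (component E V v)"
    unfolding partial_minor_def
    using v component_subset[OF v(1)] component_connected[OF v(1)] component_closed[OF v(1)] by auto
  then show False using none by blast
qed

section \<open>Bounds for the separators\<close>

lemma open_not_subset_Union_nowhere_dense: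
  assumes "finite \<K>" "\<And>K. K \<in> \<K> \<Longrightarrow> closedin X K"
    and "\<And>K N. \<lbrakk>K \<in> \<K>; openin X N; N \<noteq> {}\<rbrakk> \<Longrightarrow> \<not> N \<subseteq> K"
    and "openin X N" "N \<noteq> {}"
  shows "\<not> N \<subseteq> \<Union>\<K>"
  using assms
proof (induction \<K> arbitrary: N)
  case (insert K \<K>)
  have "openin X (N - K)" using insert.prems(1)[of K] insert.prems(3) by (simp add: openin_diff)
  moreover have "N - K \<noteq> {}" using insert.prems(2)[of K N] insert.prems(3,4) by auto
  ultimately have "\<not> N - K \<subseteq> \<Union>\<K>"
    by (intro insert.IH) (use insert.prems(1,2) in simp_all)
  then show ?case by auto
qed auto

text \<open>Supplies the two topological inputs of \<open>complete_minor_bound\<close>: points and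
  arcs have empty interior, so the points off the drawing are dense, and H_1(X) has rank
  \<open>2 * g\<close>.\<close>

lemma genus_complete_minor_bound:
  assumes G: "finite_simple_graph V E" and genus: "has_genus g V E"
    and minor: "is_minor {..<h} (complete_edges {..<h}) V E" and h: "h \<ge> 3"
  shows "h * (h - 1) + 12 \<le> 6 * h + 12 * g"
proof -
  obtain X :: "real topology" and f \<gamma> where X: "closed_orientable_surface_of_genus g X"
    and emb: "graph_embedding V E X f \<gamma>"
    using genus unfolding has_genus_def by (elim exE conjE)
  have cs: "closed_surface X" and os: "orientable_surface X"
    and H1: "homology_group 1 X \<cong> free_Abelian_group {..<2 * g}"
    using X unfolding closed_orientable_surface_of_genus_def by blast+
  obtain m where "oriented_surface X m" using closed_orientable_surface_oriented[OF cs os] ..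
  then interpret embedded_graph X m V E f \<gamma>
    by (rule embedded_graph.intro) (use G emb in \<open>simp add: embedded_graph_axioms_def\<close>)
  show ?thesis
  proof (rule complete_minor_bound[OF _ _ minor h])
    show "\<forall>N. openin X N \<longrightarrow> N \<noteq> {} \<longrightarrow> (\<exists>x\<in>N. x \<notin> drawing E)"
    proof (intro allI impI)
      fix N assume N: "openin X N" "N \<noteq> {}"
      let ?K = "(\<lambda>v. {f v}) ` V \<union> (\<lambda>e. \<gamma> e ` {0..1}) ` E"
      have "\<not> N \<subseteq> \<Union>?K"
      proof (rule open_not_subset_Union_nowhere_dense[OF _ _ _ N])
        show "finite ?K" using finite_V finite_E by simp
        fix K assume K: "K \<in> ?K"
        show "closedin X K"
          using K hausdorff f_in surface_arc.closedin_arc[OF arc, of _ 0 1]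
          by (auto intro: closedin_Hausdorff_singleton)
        fix M assume M: "openin X M" "M \<noteq> {}"
        from K show "\<not> M \<subseteq> K"
        proof
          assume "K \<in> (\<lambda>v. {f v}) ` V"
          then obtain v where "K = {f v}" by blast
          then show ?thesis using surface_singleton_not_open[OF cs M(1), of "f v"] M(2) by blast
        next
          assume "K \<in> (\<lambda>e. \<gamma> e ` {0..1}) ` E"
          then obtain e where e: "e \<in> E" "K = \<gamma> e ` {0..1}" by blast
          interpret a: surface_arc X m "\<gamma> e" using arc[OF e(1)] .
          show ?thesis unfolding e(2) by (rule surface_arc_empty_interior[OF cs a.pathin a.inj M])
        qed
      qed
      moreover have "drawing E = \<Union>?K" unfolding drawing_def by blast
      ultimately have "\<not> N \<subseteq> drawing E" by (simp only:) simp
      then show "\<exists>x\<in>N. x \<notin> drawing E" by blast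
    qed
    fix w :: "nat \<Rightarrow> real chain"
    assume "\<forall>i<Suc (2 * g). singular_relcycle (Suc 0) X {} (w i)"
    then show "\<exists>k. (\<exists>i<Suc (2 * g). k i \<noteq> 0) \<and> singular_relboundary (Suc 0) X {} (\<Sum>i<Suc (2 * g). frag_cmul (k i) (w i))"
      by (rule homology_rank_dependent[OF H1])
  qed
qed

text \<open>\<open>A \<union> S\<close> and \<open>B \<union> S\<close> are complements of sides
  with at most 2n/3 vertices, so each has at least n/3; hence the factor 9.\<close>

lemma alpha_le_of_balanced:
  assumes V: "finite V" "V \<noteq> {}" and S: "balanced_vertex_separator V E S"
  shows "alpha V E \<le> 9 * real (card S) / (real (card V))\<^sup>2"
proof -
  let ?n = "real (card V)"
  obtain A B where AB: "A \<union> B = V - S" "A \<inter> B = {}" "no_edges_between E A B"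
    and cA: "real (card A) \<le> 2 / 3 * ?n" and cB: "real (card B) \<le> 2 / 3 * ?n" and SV: "S \<subseteq> V"
    using S unfolding balanced_vertex_separator_def by (elim exE conjE)
  have n: "?n > 0" using V by (simp add: card_gt_0_iff)
  have sub: "A \<subseteq> V" "B \<subseteq> V" using AB(1) by blast+
  have "V - B = A \<union> S" "V - A = B \<union> S" using AB SV by blast+
  then have card: "real (card (A \<union> S)) = ?n - card B" "real (card (B \<union> S)) = ?n - card A"
    using card_Diff_subset[of B V] card_Diff_subset[of A V] sub V(1) finite_subset[of A V] finite_subset[of B V]
      card_mono[of V A] card_mono[of V B] by (auto simp: of_nat_diff)
  then have AS: "real (card (A \<union> S)) \<ge> ?n / 3" "real (card (B \<union> S)) \<ge> ?n / 3" using cA cB by simp_all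
  have "vertex_separator V E A B S" unfolding vertex_separator_def using AB SV by blast
  moreover have "A \<union> S \<noteq> {}" "B \<union> S \<noteq> {}" using AS n by auto
  ultimately have "alpha V E \<le> separator_ratio A B S"
    unfolding alpha_def by (intro Min_le alpha_set_finite_nonempty[OF V]) blast
  also have "\<dots> \<le> real (card S) / (?n / 3 * (?n / 3))"
    unfolding separator_ratio_def using AS n by (intro divide_left_mono mult_mono mult_pos_pos) auto
  also have "\<dots> = 9 * real (card S) / ?n\<^sup>2" by (simp add: power2_eq_square)
  finally show ?thesis .
qed

text \<open>\<open>d\<close> is sqrt n rounded up and \<open>R = h * d\<close>, so that
  \<open>h * card V \<le> d * R\<close>; \<open>h \<ge> 2\<close> gives
  \<open>Suc d \<le> R\<close>. The separator has at most \<open>h * R = h * h * d\<close> vertices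
  with \<open>d\<close> at most 2 sqrt n, and 18 is 9 times 2.\<close>

lemma minor_free_bounds:
  assumes V: "finite V" "V \<noteq> {}" and h: "h \<ge> 2" and free: "complete_minor_free h V E"
  shows "alpha V E \<le> 18 * (real h)\<^sup>2 * real (card V) powr (- 3 / 2)"
    and "\<exists>S. balanced_vertex_separator V E S \<and> real (card S) \<le> 2 * (real h)\<^sup>2 * sqrt (real (card V))"
proof -
  let ?n = "real (card V)"
  have n: "?n \<ge> 1" using V by (simp add: card_gt_0_iff Suc_le_eq)
  define d where "d = nat \<lceil>sqrt ?n\<rceil>"
  have d: "sqrt ?n \<le> real d" "real d \<le> sqrt ?n + 1"
    unfolding d_def using real_sqrt_ge_zero[of ?n] by linarith+
  have s1: "1 \<le> sqrt ?n" using n by simp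
  then have d1: "d \<ge> 1" using d(1) by linarith
  have "?n \<le> real d * real d" using mult_mono[OF d(1) d(1)] n by simp
  then have "card V \<le> d * d" by (metis of_nat_le_iff of_nat_mult)
  then have "h * card V \<le> d * (h * d)" by (metis mult.left_commute mult_le_mono2)
  moreover have "2 * d \<le> h * d" by (rule mult_le_mono1[OF h])
  then have "Suc d \<le> h * d" using d1 by linarith
  ultimately obtain S where S: "balanced_vertex_separator V E S" "card S \<le> h * (h * d)"
    using minor_free_separator[OF V(1) free d1] by blast
  have "real (card S) \<le> real h * (real h * real d)" using S(2) by (metis of_nat_le_iff of_nat_mult)
  also have "\<dots> \<le> real h * (real h * (2 * sqrt ?n))"
  proof -
    have "real d \<le> 2 * sqrt ?n" using d(2) s1 by linarith
    then show ?thesis by (intro mult_left_mono) simp_all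
  qed
  also have "\<dots> = 2 * (real h)\<^sup>2 * sqrt ?n" by (simp add: power2_eq_square algebra_simps)
  finally have cS: "real (card S) \<le> 2 * (real h)\<^sup>2 * sqrt ?n" .
  show "\<exists>S. balanced_vertex_separator V E S \<and> real (card S) \<le> 2 * (real h)\<^sup>2 * sqrt ?n"
    using S(1) cS by (intro exI[of _ S] conjI)
  have "alpha V E \<le> 9 * real (card S) / ?n\<^sup>2" by (rule alpha_le_of_balanced[OF V S(1)])
  also have "\<dots> \<le> 9 * (2 * (real h)\<^sup>2 * sqrt ?n) / ?n\<^sup>2" by (intro divide_right_mono mult_left_mono cS) simp_all
  also have "\<dots> = 18 * (real h)\<^sup>2 * (sqrt ?n / ?n\<^sup>2)" by simp
  also have "sqrt ?n / ?n\<^sup>2 = ?n powr (1/2) / ?n powr 2"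
    using n by (simp add: powr_half_sqrt powr_numeral)
  also have "\<dots> = ?n powr (1 / 2 - 2)" by (rule powr_diff[symmetric])
  also have "1 / 2 - 2 = (- 3 / 2 :: real)" by simp
  finally show "alpha V E \<le> 18 * (real h)\<^sup>2 * ?n powr (- 3 / 2)" .
qed

lemma genus_minor_free:
  assumes "finite_simple_graph V E" "has_genus g V E"
  obtains h where "h \<ge> 2" "complete_minor_free h V E" "(real h)\<^sup>2 \<le> 256 * (real g + 1) powr (3 / 2)"
proof
  define s where "s = nat \<lceil>sqrt (real g)\<rceil>"
  have s: "sqrt (real g) \<le> real s" "real s \<le> sqrt (real g) + 1"
    unfolding s_def using real_sqrt_ge_zero[of "real g"] by linarith+
  \<comment> \<open>With \<open>g \<le> s * s\<close> the Euler bound would imply 16 s^2 + 60 s + 68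
    \<le> 12 s^2 + 24 s + 48. The factor 256 is 16 squared, from 4 sqrt(g) + 12 \<le> 16 sqrt(g +
    1).\<close>
  let ?h = "4 * s + 8"
  show "?h \<ge> 2" by simp
  have "real g \<le> real s * real s" using mult_mono[OF s(1) s(1)] by simp
  then have gs: "g \<le> s * s" by (metis of_nat_le_iff of_nat_mult)
  show "complete_minor_free ?h V E"
    unfolding complete_minor_free_def
  proof
    assume "is_minor {..<?h} (complete_edges {..<?h}) V E"
    from genus_complete_minor_bound[OF assms this]
    have "?h * (?h - 1) + 12 \<le> 6 * ?h + 12 * g" by simp
    moreover have "?h * (?h - 1) = 16 * (s * s) + 60 * s + 56" by (simp add: algebra_simps)
    ultimately show False using gs by simp
  qed
  have g1: "real g \<le> real g + 1" "1 \<le> real g + 1" by simp_all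
  have "real ?h \<le> 4 * sqrt (real g) + 12" using s(2) by simp
  also have "\<dots> \<le> 16 * sqrt (real g + 1)"
    using real_sqrt_le_mono[OF g1(1)] real_sqrt_ge_one[OF g1(2)] by linarith
  finally have "(real ?h)\<^sup>2 \<le> (16 * sqrt (real g + 1))\<^sup>2" by (intro power_mono) auto
  also have "\<dots> = 256 * (real g + 1) powr 1" by (simp add: power_mult_distrib)
  also have "\<dots> \<le> 256 * (real g + 1) powr (3 / 2)" by (intro mult_left_mono powr_mono) auto
  finally show "(real ?h)\<^sup>2 \<le> 256 * (real g + 1) powr (3 / 2)" .
qed

text \<open>The bound \<open>ln 2 \<ge> 1/4\<close> makes \<open>h * sqrt (ln h)\<close> at least 1,
  already for \<open>h = 2\<close>.\<close>

lemma square_le_cube_sqrt_ln: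
  assumes "h \<ge> (2::nat)"
  shows "(real h)\<^sup>2 \<le> real h ^ 3 * sqrt (ln (real h))"
proof -
  have "1 / 4 \<le> ln (2::real)" using ln_one_minus_pos_upper_bound[of "1/2"] by (simp add: ln_div)
  also have "\<dots> \<le> ln (real h)" using assms by simp
  finally have "sqrt (1 / 4) \<le> sqrt (ln (real h))" by (rule real_sqrt_le_mono)
  then have "1 / 2 \<le> sqrt (ln (real h))" by (simp add: real_sqrt_divide)
  then have "2 * (1 / 2) \<le> real h * sqrt (ln (real h))" using assms by (intro mult_mono) auto
  then have "(real h)\<^sup>2 * 1 \<le> (real h)\<^sup>2 * (real h * sqrt (ln (real h)))" by (intro mult_left_mono) auto
  then show ?thesis by (simp add: power2_eq_square power3_eq_cube mult.assoc)
qed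

theorem theorem5p5:
  shows "\<exists>C::real. \<forall>(V::'a set) E. finite_simple_graph V E \<longrightarrow>
    (\<forall>g::nat. has_genus g V E \<longrightarrow>
       alpha V E \<le> C * real (card V) powr (- 3 / 2) * (real g + 1) powr (3 / 2) \<and>
       (\<exists>S. balanced_vertex_separator V E S \<and>
          real (card S) \<le> C * (real g + 1) powr (3 / 2) * sqrt (real (card V)))) \<and>
    (\<forall>h::nat. h \<ge> 2 \<longrightarrow> complete_minor_free h V E \<longrightarrow>
       alpha V E \<le> C * real (card V) powr (- 3 / 2) * real h ^ 3 * sqrt (ln (real h)) \<and>
       (\<exists>S. balanced_vertex_separator V E S \<and>
          real (card S) \<le> C * real h ^ 3 * sqrt (ln (real h)) * sqrt (real (card V))))"
proof (intro exI[of _ 5000] allI impI conjI)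
  fix V :: "'a set" and E g
  assume G: "finite_simple_graph V E" and "has_genus g V E"
  then obtain h where h: "h \<ge> 2" "complete_minor_free h V E" "(real h)\<^sup>2 \<le> 256 * (real g + 1) powr (3 / 2)"
    using genus_minor_free by blast
  have V: "finite V" "V \<noteq> {}" using G by (auto simp: finite_simple_graph_def)
  let ?p = "real (card V) powr (- 3 / 2)" and ?q = "(real g + 1) powr (3 / 2)"
  have "alpha V E \<le> 18 * (real h)\<^sup>2 * ?p" by (rule minor_free_bounds[OF V h(1,2)])
  also have "\<dots> \<le> 18 * (256 * ?q) * ?p" using h(3) by (intro mult_right_mono mult_left_mono) auto
  \<comment> \<open>4608 is 18 times 256, and 512 below is 2 times 256; 5000 covers both, and also
    the factors 18 and 2 of the second part.\<close>
  also have "\<dots> = 4608 * (?p * ?q)" by simp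
  also have "\<dots> \<le> 5000 * (?p * ?q)" by (intro mult_right_mono mult_nonneg_nonneg) auto
  finally show "alpha V E \<le> 5000 * ?p * ?q" by simp
  obtain S where S: "balanced_vertex_separator V E S" "real (card S) \<le> 2 * (real h)\<^sup>2 * sqrt (real (card V))"
    using minor_free_bounds(2)[OF V h(1,2)] by blast
  note S(2)
  also have "2 * (real h)\<^sup>2 * sqrt (real (card V)) \<le> 2 * (256 * ?q) * sqrt (real (card V))"
    using h(3) by (intro mult_right_mono mult_left_mono) auto
  also have "\<dots> = 512 * (?q * sqrt (real (card V)))" by simp
  also have "\<dots> \<le> 5000 * (?q * sqrt (real (card V)))" by (intro mult_right_mono mult_nonneg_nonneg) auto
  finally show "\<exists>S. balanced_vertex_separator V E S \<and> real (card S) \<le> 5000 * ?q * sqrt (real (card V))"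
    by (intro exI[of _ S] conjI S(1)) (simp add: mult.assoc)
next
  fix V :: "'a set" and E and h :: nat
  assume G: "finite_simple_graph V E" and h: "h \<ge> 2" "complete_minor_free h V E"
  have V: "finite V" "V \<noteq> {}" using G by (auto simp: finite_simple_graph_def)
  let ?p = "real (card V) powr (- 3 / 2)" and ?q = "real h ^ 3 * sqrt (ln (real h))"
  have q: "(real h)\<^sup>2 \<le> ?q" by (rule square_le_cube_sqrt_ln[OF h(1)])
  have q0: "0 \<le> ?q" using h(1) by simp
  have "alpha V E \<le> 18 * (real h)\<^sup>2 * ?p" by (rule minor_free_bounds[OF V h])
  also have "\<dots> \<le> 18 * ?q * ?p" using q by (intro mult_right_mono mult_left_mono) auto
  also have "\<dots> = 18 * (?p * ?q)" by simp
  also have "\<dots> \<le> 5000 * (?p * ?q)" by (intro mult_right_mono mult_nonneg_nonneg[OF _ q0]) auto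
  finally show "alpha V E \<le> 5000 * ?p * real h ^ 3 * sqrt (ln (real h))" by (simp add: mult.assoc)
  obtain S where S: "balanced_vertex_separator V E S" "real (card S) \<le> 2 * (real h)\<^sup>2 * sqrt (real (card V))"
    using minor_free_bounds(2)[OF V h] by blast
  note S(2)
  also have "2 * (real h)\<^sup>2 * sqrt (real (card V)) \<le> 2 * ?q * sqrt (real (card V))"
    using q by (intro mult_right_mono mult_left_mono) auto
  also have "\<dots> = 2 * (?q * sqrt (real (card V)))" by simp
  also have "\<dots> \<le> 5000 * (?q * sqrt (real (card V)))" by (intro mult_right_mono mult_nonneg_nonneg[OF q0]) auto
  finally show "\<exists>S. balanced_vertex_separator V E S \<and>
      real (card S) \<le> 5000 * real h ^ 3 * sqrt (ln (real h)) * sqrt (real (card V))"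
    by (intro exI[of _ S] conjI S(1)) (simp add: mult.assoc)
qed

end
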